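(* A fat CW complex $X$ has enough many smooth functions: the $D$-topology of $X$ has an open basis consisting of sets of the form $f^{-1}((0,1))$ with $f:X\to\mathbb{R}$ smooth.
   Context: The $D$-topology of a diffeological space $X$: $O\subset X$ is open iff $P^{-1}(O)$ is open for every plot $P$. Let $\ell(t)=0$ for $t\le0$, $e^{-1/t}$ for $t>0$; $\alpha_0=\int_0^1\ell(3x)\ell(3-3x)dx$; $\lambda(t)=\frac1{\alpha_0}\int_0^t\ell(3x)\ell(3-3x)dx$; $\phi(t)=\int_0^{1/2+t}\lambda(x)dx$. For integers $n,m\ge0$: $\mathbb{D}^{n,m}=\{(u,v)\in\mathbb{R}^n\times\mathbb{R}^m:\|u\|\ge1-\phi(2-\|u\|-\|v\|)\}$, $\mathbb{S}^{n-1,m}=\{(u,v):\|u\|\ge1\}$ (empty for $n=0$), with subset diffeologies. A fat CW complex is a diffeological space $X$ with subspaces $\emptyset=X^{(-1)}\subset X^{(0)}\subset\cdots$, index sets $J_n$, maps $m_n:J_n\to\mathbb{N}_0$ and smooth maps $h_n:\coprod_{j\in J_n}\mathbb{S}^{n-1,m_n(j)}\to X^{(n-1)}$ such that each $X^{(n)}$ is the pushout in diffeological spaces of the inclusion $\coprod_j\mathbb{S}^{n-1,m_n(j)}\hookrightarrow\coprod_j\mathbb{D}^{n,m_n(j)}$ and $h_n$, and $X$ is the diffeological colimit of the $X^{(n)}$. *)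

theory Defs
  imports "HOL-Analysis.Analysis"
begin

type_synonym vec = "nat \<Rightarrow> real"

text \<open>R^n is realised as the vectors whose coordinates vanish from index n on.
  The topology is the (subspace of the) product topology, which is the Euclidean one.\<close>
definition Rn :: "nat \<Rightarrow> vec set" where
  "Rn n = {x. \<forall>i\<ge>n. x i = 0}"

definition domain :: "nat \<Rightarrow> vec set \<Rightarrow> bool" where
  "domain n U \<longleftrightarrow> openin (top_of_set (Rn n)) U"

definition pd :: "nat \<Rightarrow> (vec \<Rightarrow> real) \<Rightarrow> vec \<Rightarrow> real" where
  "pd i f x = deriv (\<lambda>h. f (x(i := x i + h))) 0"

fun iter_pd :: "nat list \<Rightarrow> (vec \<Rightarrow> real) \<Rightarrow> vec \<Rightarrow> real" where
  "iter_pd [] f = f"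
| "iter_pd (i # is) f = pd i (iter_pd is f)"

definition smooth_fun :: "nat \<Rightarrow> vec set \<Rightarrow> (vec \<Rightarrow> real) \<Rightarrow> bool" where
  "smooth_fun n U f \<longleftrightarrow>
     (\<forall>is. set is \<subseteq> {..<n} \<longrightarrow>
        continuous_on U (iter_pd is f) \<and>
        (\<forall>i<n. \<forall>x\<in>U. (\<lambda>h. iter_pd is f (x(i := x i + h))) differentiable (at 0)))"

definition smooth_map :: "nat \<Rightarrow> vec set \<Rightarrow> nat \<Rightarrow> (vec \<Rightarrow> vec) \<Rightarrow> bool" where
  "smooth_map n U k F \<longleftrightarrow> F ` U \<subseteq> Rn k \<and> (\<forall>i<k. smooth_fun n U (\<lambda>x. F x i))"

text \<open>A parametrization is a triple (n, U, P) with U open in R^n and P : U -> X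
  (only the values of P on U matter). A diffeology on a carrier set S is a set of
  parametrizations satisfying the usual axioms.\<close>
type_synonym 'a plots = "(nat \<times> vec set \<times> (vec \<Rightarrow> 'a)) set"

definition diffeology :: "'a set \<Rightarrow> 'a plots \<Rightarrow> bool" where
  "diffeology S D \<longleftrightarrow>
     (\<forall>n U P. (n, U, P) \<in> D \<longrightarrow> domain n U \<and> P ` U \<subseteq> S) \<and>
     (\<forall>n U P Q. (n, U, P) \<in> D \<longrightarrow> (\<forall>x\<in>U. P x = Q x) \<longrightarrow> (n, U, Q) \<in> D) \<and>
     (\<forall>n U x. domain n U \<and> x \<in> S \<longrightarrow> (n, U, \<lambda>_. x) \<in> D) \<and>
     (\<forall>n U P. domain n U \<and> P ` U \<subseteq> S \<and>
        (\<forall>x\<in>U. \<exists>V. x \<in> V \<and> V \<subseteq> U \<and> domain n V \<and> (n, V, P) \<in> D) \<longrightarrow> (n, U, P) \<in> D) \<and>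
     (\<forall>n U P m V F. (n, U, P) \<in> D \<and> domain m V \<and> smooth_map m V n F \<and> F ` V \<subseteq> U
        \<longrightarrow> (m, V, P \<circ> F) \<in> D)"

definition dsmooth :: "'a set \<Rightarrow> 'a plots \<Rightarrow> 'b set \<Rightarrow> 'b plots \<Rightarrow> ('a \<Rightarrow> 'b) \<Rightarrow> bool" where
  "dsmooth S D T E f \<longleftrightarrow> f ` S \<subseteq> T \<and> (\<forall>n U P. (n, U, P) \<in> D \<longrightarrow> (n, U, f \<circ> P) \<in> E)"

definition smooth_real :: "'a set \<Rightarrow> 'a plots \<Rightarrow> ('a \<Rightarrow> real) \<Rightarrow> bool" where
  "smooth_real S D f \<longleftrightarrow> (\<forall>n U P. (n, U, P) \<in> D \<longrightarrow> smooth_fun n U (f \<circ> P))"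

definition subdiff :: "'a plots \<Rightarrow> 'a set \<Rightarrow> 'a plots" where
  "subdiff D A = {(n, U, P). (n, U, P) \<in> D \<and> P ` U \<subseteq> A}"

definition esub :: "nat \<Rightarrow> vec set \<Rightarrow> vec plots" where
  "esub k A = {(n, U, Q). domain n U \<and> smooth_map n U k Q \<and> Q ` U \<subseteq> A}"

definition generated :: "'a set \<Rightarrow> 'a plots \<Rightarrow> 'a plots" where
  "generated S G = {(n, U, P). domain n U \<and> P ` U \<subseteq> S \<and>
     (\<forall>x\<in>U. \<exists>V. x \<in> V \<and> V \<subseteq> U \<and> domain n V \<and>
        ((\<exists>c. \<forall>y\<in>V. P y = c) \<or> (\<exists>Q. (n, V, Q) \<in> G \<and> (\<forall>y\<in>V. P y = Q y))))}"

definition coprod :: "'j set \<Rightarrow> ('j \<Rightarrow> nat) \<Rightarrow> ('j \<Rightarrow> vec set) \<Rightarrow> ('j \<times> vec) plots" where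
  "coprod J k A = generated (Sigma J A)
     {(n, U, \<lambda>y. (j, Q y)) | n U Q j. j \<in> J \<and> (n, U, Q) \<in> esub (k j) (A j)}"

definition Dopen :: "'a set \<Rightarrow> 'a plots \<Rightarrow> 'a set \<Rightarrow> bool" where
  "Dopen S D W \<longleftrightarrow> W \<subseteq> S \<and>
     (\<forall>n U P. (n, U, P) \<in> D \<longrightarrow> openin (top_of_set (Rn n)) {x \<in> U. P x \<in> W})"

definition ell :: "real \<Rightarrow> real" where
  "ell t = (if t \<le> 0 then 0 else exp (- 1 / t))"

definition alpha0 :: real where
  "alpha0 = integral {0..1} (\<lambda>x. ell (3 * x) * ell (3 - 3 * x))"

text \<open>The integrands vanish on negative arguments, so integral over {0..t} (which is 0
  for t < 0) agrees with the oriented integral from 0 to t.\<close>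
definition lam :: "real \<Rightarrow> real" where
  "lam t = integral {0..t} (\<lambda>x. ell (3 * x) * ell (3 - 3 * x)) / alpha0"

definition phi :: "real \<Rightarrow> real" where
  "phi t = integral {0..1/2 + t} lam"

text \<open>A point of R^n x R^m is a vector in Rn (n+m): coordinates 0..n-1 form u,
  coordinates n..n+m-1 form v.\<close>
definition unorm :: "nat \<Rightarrow> vec \<Rightarrow> real" where
  "unorm n x = sqrt (\<Sum>i<n. (x i)\<^sup>2)"

definition vnorm :: "nat \<Rightarrow> nat \<Rightarrow> vec \<Rightarrow> real" where
  "vnorm n m x = sqrt (\<Sum>i\<in>{n..<n+m}. (x i)\<^sup>2)"

definition fat_disk :: "nat \<Rightarrow> nat \<Rightarrow> vec set" where
  "fat_disk n m = {x \<in> Rn (n + m). unorm n x \<ge> 1 - phi (2 - unorm n x - vnorm n m x)}"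

definition fat_sphere :: "nat \<Rightarrow> nat \<Rightarrow> vec set" where
  "fat_sphere n m = {x \<in> Rn (n + m). unorm n x \<ge> 1}"

text \<open>Sk n is the n-skeleton X^(n); prev_sk Sk n is X^(n-1) (empty for n = 0).
  J n are the index sets, m n the maps J_n -> N_0, h n the attaching maps.\<close>
definition prev_sk :: "(nat \<Rightarrow> 'a set) \<Rightarrow> nat \<Rightarrow> 'a set" where
  "prev_sk Sk n = (if n = 0 then {} else Sk (n - 1))"

definition cells_disk :: "(nat \<Rightarrow> 'j set) \<Rightarrow> (nat \<Rightarrow> 'j \<Rightarrow> nat) \<Rightarrow> nat \<Rightarrow> ('j \<times> vec) set" where
  "cells_disk J m n = Sigma (J n) (\<lambda>j. fat_disk n (m n j))"

definition cells_sphere :: "(nat \<Rightarrow> 'j set) \<Rightarrow> (nat \<Rightarrow> 'j \<Rightarrow> nat) \<Rightarrow> nat \<Rightarrow> ('j \<times> vec) set" where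
  "cells_sphere J m n = Sigma (J n) (\<lambda>j. fat_sphere n (m n j))"

text \<open>(Y, E) is the pushout in diffeological spaces of the inclusion of the subspace
  A of (B, DB) and the smooth map h : A -> (Z, DZ), with Z a subspace of Y and
  Phi : B -> Y the other leg: concretely, Y is the set-theoretic pushout and E is
  the final diffeology for the inclusion Z -> Y and Phi.\<close>
definition is_pushout :: "'a set \<Rightarrow> 'a plots \<Rightarrow> 'a set \<Rightarrow> 'a plots \<Rightarrow>
    'b set \<Rightarrow> 'b plots \<Rightarrow> 'b set \<Rightarrow> ('b \<Rightarrow> 'a) \<Rightarrow> ('b \<Rightarrow> 'a) \<Rightarrow> bool" where
  "is_pushout Y E Z DZ B DB A h Phi \<longleftrightarrow>
     Z \<subseteq> Y \<and> A \<subseteq> B \<and>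
     (\<forall>b\<in>A. Phi b = h b) \<and>
     inj_on Phi (B - A) \<and>
     Phi ` (B - A) \<inter> Z = {} \<and>
     Y = Z \<union> Phi ` B \<and>
     E = generated Y (DZ \<union> {(n, U, Phi \<circ> Q) | n U Q. (n, U, Q) \<in> DB})"

definition fat_CW :: "'a set \<Rightarrow> 'a plots \<Rightarrow> (nat \<Rightarrow> 'a set) \<Rightarrow> (nat \<Rightarrow> 'j set) \<Rightarrow>
    (nat \<Rightarrow> 'j \<Rightarrow> nat) \<Rightarrow> (nat \<Rightarrow> 'j \<times> vec \<Rightarrow> 'a) \<Rightarrow> bool" where
  "fat_CW S D Sk J m h \<longleftrightarrow>
     diffeology S D \<and>
     (\<forall>n. Sk n \<subseteq> S) \<and>
     (\<forall>n. prev_sk Sk n \<subseteq> Sk n) \<and>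
     (\<forall>n. dsmooth (cells_sphere J m n)
            (subdiff (coprod (J n) (\<lambda>j. n + m n j) (\<lambda>j. fat_disk n (m n j))) (cells_sphere J m n))
            (prev_sk Sk n) (subdiff D (prev_sk Sk n)) (h n)) \<and>
     (\<forall>n. \<exists>Phi.
        dsmooth (cells_disk J m n) (coprod (J n) (\<lambda>j. n + m n j) (\<lambda>j. fat_disk n (m n j)))
                (Sk n) (subdiff D (Sk n)) Phi \<and>
        is_pushout (Sk n) (subdiff D (Sk n)) (prev_sk Sk n) (subdiff D (prev_sk Sk n))
           (cells_disk J m n) (coprod (J n) (\<lambda>j. n + m n j) (\<lambda>j. fat_disk n (m n j)))
           (cells_sphere J m n) (h n) Phi) \<and>
     S = (\<Union>n. Sk n) \<and>
     D = generated S (\<Union>n. subdiff D (Sk n))"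

end

(* A smooth f with values in the reals is built skeleton by skeleton, keeping {f >= 0} inside the
   given open set W; in the end f is composed with ell, which is positive exactly on the positive
   reals and less than 1. On the first skeleton containing the given point one starts with -1 plus
   a bump inside a cell.
   For an attached cell, f o h is a smooth function g on the fat sphere {|u| >= 1} and has to be
   extended to the fat disk. Substituting |u| = 1 + t^2 turns g into a smooth function G on an open
   set, even in t. Borel's lemma provides a smooth F with the same jet as G at t = 0 after the
   substitution tau = t^2, so G - F(t^2) is flat at t = 0, hence smooth as a function of
   tau = |u| - 1 when continued by zero to tau <= 0; adding F gives the extension.
   The extension is then made negative outside W: the part of the fat disk outside the fat sphere
   is bounded, so the bad points form a compact set in {|u| < 1}, and subtracting a large multiple
   of ell (1 - |u|^2) is enough. That this set is closed uses that the D-topology of the fat disk is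
   the subspace topology, which follows from plots onto neighbourhoods of boundary points
   admitting continuous sections. *)

theory Submission
  imports Defs
begin

subsection \<open>Smooth functions on domains\<close>

text \<open>A smooth function on the fat sphere is known only through plots, so a priori it has no
  derivatives at points with \<open>|u| = 1\<close>. The square substitution produces them: the
  rescaled point lies in the fat sphere for every \<open>t\<close>, so the substitution is itself a
  plot with open domain. The variable \<open>t\<close> (later \<open>tau\<close>) is kept as an
  additional coordinate with index \<open>N = n + m\<close> beside the coordinates of
  \<open>u\<close> and \<open>v\<close>, and \<open>tau = |u| - 1\<close> is inserted only at the
  end, which avoids polar coordinates. Fatness enters through boundedness: off the fat sphere
  \<open>|u| + |v| < 5/2\<close>, so a single compact set of parameters carries all estimates in
  Borel's lemma, without a partition of unity. The invariant uses the weak inequality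
  \<open>f >= 0\<close> because the points violating it must form a closed set; strict positivity is
  used only at the end. Extensions never change values on the previous skeleton, so the functions on
  the skeleta fit together on the colimit, where a plot is locally constant or a plot of one
  skeleton.\<close>

definition near :: "nat \<Rightarrow> vec \<Rightarrow> real \<Rightarrow> vec \<Rightarrow> bool" where
  "near n x d y \<longleftrightarrow> (\<forall>i<n. \<bar>y i - x i\<bar> < d)"

lemma near_mono: "near n x d y \<Longrightarrow> d \<le> e \<Longrightarrow> near n x e y"
  by (force simp: near_def)

lemma near_refl: "d > 0 \<Longrightarrow> near n x d x"
  by (simp add: near_def)

lemma open_near: "open {y. near n x d y}"
proof -
  have "{y. near n x d y} = (\<Inter>i\<in>{..<n}. {y. \<bar>y i - x i\<bar> < d})"
    by (auto simp: near_def)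
  moreover have "open {y::vec. \<bar>y i - x i\<bar> < d}" for i
    by (intro open_Collect_less continuous_intros continuous_on_product_coordinates)
  ultimately show ?thesis by (simp add: open_INT)
qed

text \<open>On \<open>Rn n\<close> the coordinates from index \<open>n\<close> on are constantly
  \<open>0\<close>, so of a basic product neighbourhood only the first \<open>n\<close> factors
  matter, and boxes in these coordinates suffice. Any subset \<open>A\<close> is allowed, so that
  fat disks are covered as well.\<close>

lemma openin_Rn_iff:
  assumes "A \<subseteq> Rn n"
  shows "openin (top_of_set A) U \<longleftrightarrow>
    U \<subseteq> A \<and> (\<forall>x\<in>U. \<exists>d>0. \<forall>y\<in>A. near n x d y \<longrightarrow> y \<in> U)"
proof
  assume "openin (top_of_set A) U"
  then obtain T where T: "open T" "U = A \<inter> T" by (auto simp: openin_open)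
  have "\<exists>d>0. \<forall>y\<in>A. near n x d y \<longrightarrow> y \<in> U" if "x \<in> U" for x
  proof -
    have "openin (product_topology (\<lambda>i. euclidean) UNIV) T" "x \<in> T"
      using T that by (auto simp: open_fun_def)
    from product_topology_open_contains_basis[OF this] obtain V where
      V: "x \<in> (\<Pi>\<^sub>E i\<in>UNIV. V i)" "\<And>i. openin euclidean (V i)" "(\<Pi>\<^sub>E i\<in>UNIV. V i) \<subseteq> T"
      by blast
    have "\<forall>i. \<exists>d>0. \<forall>s. \<bar>s - x i\<bar> < d \<longrightarrow> s \<in> V i"
    proof
      fix i
      have "open (V i)" "x i \<in> V i" using V by (auto simp: PiE_iff)
      then show "\<exists>d>0. \<forall>s. \<bar>s - x i\<bar> < d \<longrightarrow> s \<in> V i"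
        by (metis dist_real_def open_dist)
    qed
    then obtain d where d: "\<And>i. d i > 0" "\<And>i s. \<bar>s - x i\<bar> < d i \<Longrightarrow> s \<in> V i" by metis
    \<comment> \<open>The extra \<open>1\<close> keeps the minimum defined and positive for
      \<open>n = 0\<close>.\<close>
    define e where "e = Min (insert 1 (d ` {..<n}))"
    have e0: "e > 0" unfolding e_def using d by (subst Min_gr_iff) auto
    have ed: "e \<le> d i" if "i < n" for i unfolding e_def using that by (intro Min_le) auto
    have "y \<in> U" if y: "y \<in> A" "near n x e y" for y
    proof -
      have "y i \<in> V i" for i
      proof (cases "i < n")
        case True then show ?thesis using y ed[OF True] d(2) by (force simp: near_def)
      next
        case False
        have "x \<in> Rn n" "y \<in> Rn n" using \<open>x \<in> U\<close> T assms y by auto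
        then show ?thesis using False d by (simp add: Rn_def)
      qed
      then have "y \<in> T" using V by (auto simp: PiE_iff)
      then show ?thesis using T y by auto
    qed
    then show ?thesis using e0 by blast
  qed
  then show "U \<subseteq> A \<and> (\<forall>x\<in>U. \<exists>d>0. \<forall>y\<in>A. near n x d y \<longrightarrow> y \<in> U)"
    using T by auto
next
  assume R: "U \<subseteq> A \<and> (\<forall>x\<in>U. \<exists>d>0. \<forall>y\<in>A. near n x d y \<longrightarrow> y \<in> U)"
  then obtain d where d: "\<And>x. x \<in> U \<Longrightarrow> d x > 0"
    "\<And>x y. x \<in> U \<Longrightarrow> y \<in> A \<Longrightarrow> near n x (d x) y \<Longrightarrow> y \<in> U" by metis
  have "U = A \<inter> (\<Union>x\<in>U. {y. near n x (d x) y})"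
    using R d near_refl by blast
  moreover have "open (\<Union>x\<in>U. {y. near n x (d x) y})" by (intro open_UN ballI open_near)
  ultimately show "openin (top_of_set A) U" unfolding openin_open by blast
qed

lemma continuous_on_Rn_iff:
  fixes f :: "vec \<Rightarrow> real"
  assumes "A \<subseteq> Rn n"
  shows "continuous_on A f \<longleftrightarrow>
    (\<forall>x\<in>A. \<forall>e>0. \<exists>d>0. \<forall>y\<in>A. near n x d y \<longrightarrow> \<bar>f y - f x\<bar> < e)"
proof
  assume c: "continuous_on A f"
  show "\<forall>x\<in>A. \<forall>e>0. \<exists>d>0. \<forall>y\<in>A. near n x d y \<longrightarrow> \<bar>f y - f x\<bar> < e"
  proof (intro ballI allI impI)
    fix x e assume "x \<in> A" "(e::real) > 0"
    have "openin (top_of_set A) (A \<inter> f -` ball (f x) e)"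
      using c continuous_openin_preimage_gen open_ball by blast
    moreover have "x \<in> A \<inter> f -` ball (f x) e" using \<open>x \<in> A\<close> \<open>e > 0\<close> by simp
    ultimately obtain d where "d > 0" "\<forall>y\<in>A. near n x d y \<longrightarrow> y \<in> A \<inter> f -` ball (f x) e"
      unfolding openin_Rn_iff[OF assms] by blast
    then show "\<exists>d>0. \<forall>y\<in>A. near n x d y \<longrightarrow> \<bar>f y - f x\<bar> < e"
      by (intro exI[of _ d]) (auto simp: dist_real_def)
  qed
next
  assume R: "\<forall>x\<in>A. \<forall>e>0. \<exists>d>0. \<forall>y\<in>A. near n x d y \<longrightarrow> \<bar>f y - f x\<bar> < e"
  show "continuous_on A f"
    unfolding continuous_on_open_invariant
  proof (intro allI impI)
    fix B :: "real set" assume "open B"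
    have "openin (top_of_set A) (A \<inter> f -` B)"
      unfolding openin_Rn_iff[OF assms]
    proof (intro conjI ballI)
      fix x assume "x \<in> A \<inter> f -` B"
      then obtain e where e: "e > 0" "\<And>s. \<bar>s - f x\<bar> < e \<Longrightarrow> s \<in> B"
        using \<open>open B\<close> by (metis IntD2 dist_real_def open_dist vimageE)
      then show "\<exists>d>0. \<forall>y\<in>A. near n x d y \<longrightarrow> y \<in> A \<inter> f -` B"
        using R \<open>x \<in> A \<inter> f -` B\<close> by (metis Int_iff vimageI)
    qed auto
    then show "\<exists>T. open T \<and> T \<inter> A = f -` B \<inter> A"
      by (metis Int_commute openin_open)
  qed
qed

lemma domain_subset: "domain n U \<Longrightarrow> U \<subseteq> Rn n"
  by (auto simp: domain_def dest: openin_imp_subset)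

lemma domain_near:
  assumes "domain n U" "x \<in> U"
  obtains d where "d > 0" "\<And>y. y \<in> Rn n \<Longrightarrow> near n x d y \<Longrightarrow> y \<in> U"
  using assms unfolding domain_def openin_Rn_iff[OF order_refl] by blast

lemma domain_Rn: "domain n (Rn n)"
  by (simp add: domain_def)

lemma domain_Int: "domain n U \<Longrightarrow> domain n V \<Longrightarrow> domain n (U \<inter> V)"
  by (auto simp: domain_def)

lemma domain_openin: "domain n U \<Longrightarrow> openin (top_of_set U) V \<Longrightarrow> domain n V"
  using openin_trans by (auto simp: domain_def)

lemma domain_Collect:
  assumes "domain n U" "continuous_on U f" "open B"
  shows "domain n {x\<in>U. f x \<in> B}"
proof (rule domain_openin[OF assms(1)])
  show "openin (top_of_set U) {x \<in> U. f x \<in> B}"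
    using continuous_openin_preimage_gen[OF assms(2,3)] by (simp add: vimage_def Int_def)
qed

lemma domain_Collect_less:
  fixes f g :: "vec \<Rightarrow> real"
  assumes "domain n U" "continuous_on U f" "continuous_on U g"
  shows "domain n {x\<in>U. f x < g x}"
proof -
  have "continuous_on U (\<lambda>x. g x - f x)" using assms by (intro continuous_intros)
  from domain_Collect[OF assms(1) this, of "{0<..}"] show ?thesis by simp
qed

lemma Rn_upd: "x \<in> Rn n \<Longrightarrow> i < n \<Longrightarrow> x(i := s) \<in> Rn n"
  by (auto simp: Rn_def)

lemma slice_in:
  assumes "domain n U" "x \<in> U" "i < n"
  shows "\<forall>\<^sub>F h in nhds (0::real). x(i := x i + h) \<in> U"
proof -
  obtain d where d: "d > 0" "\<And>y. y \<in> Rn n \<Longrightarrow> near n x d y \<Longrightarrow> y \<in> U"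
    using domain_near[OF assms(1,2)] by blast
  have "x(i := x i + h) \<in> U" if "dist h 0 < d" for h
    by (rule d(2)) (use that assms domain_subset d(1) in \<open>auto simp: near_def intro!: Rn_upd\<close>)
  then show ?thesis using d(1) unfolding eventually_nhds_metric by blast
qed

text \<open>\<open>pd\<close> is a \<open>deriv\<close> and has a value even where no derivative
  exists; the relation records differentiability together with the value.\<close>

definition has_pd :: "(vec \<Rightarrow> real) \<Rightarrow> nat \<Rightarrow> vec \<Rightarrow> real \<Rightarrow> bool" where
  "has_pd f i x D \<longleftrightarrow> ((\<lambda>h. f (x(i := x i + h))) has_real_derivative D) (at 0)"

lemma has_pd_imp_pd: "has_pd f i x D \<Longrightarrow> pd i f x = D"
  unfolding has_pd_def pd_def by (rule DERIV_imp_deriv)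

lemma has_pd_cong:
  assumes "domain n U" "x \<in> U" "i < n" "\<And>y. y \<in> U \<Longrightarrow> f y = g y" "has_pd f i x D"
  shows "has_pd g i x D"
proof -
  have "\<forall>\<^sub>F h in nhds 0. f (x(i := x i + h)) = g (x(i := x i + h))"
    using slice_in[OF assms(1-3)] by eventually_elim (use assms in auto)
  then show ?thesis using assms(5) unfolding has_pd_def by (subst (asm) DERIV_cong_ev[OF refl _ refl]) auto
qed

lemma pd_cong:
  assumes "domain n U" "x \<in> U" "i < n" "\<And>y. y \<in> U \<Longrightarrow> f y = g y"
  shows "pd i f x = pd i g x"
proof -
  have "\<forall>\<^sub>F h in nhds 0. f (x(i := x i + h)) = g (x(i := x i + h))"
    using slice_in[OF assms(1-3)] by eventually_elim (use assms in auto)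
  then show ?thesis unfolding pd_def by (rule deriv_cong_ev) simp
qed

lemma has_pd_DERIV:
  "has_pd f i x D \<Longrightarrow> ((\<lambda>s. f (x(i := s))) has_real_derivative D) (at (x i))"
  unfolding has_pd_def using DERIV_shift[of "\<lambda>s. f (x(i := s))" D 0 "x i"]
  by (simp add: add.commute)

lemma DERIV_has_pd:
  "((\<lambda>s. f (x(i := s))) has_real_derivative D) (at (x i)) \<Longrightarrow> has_pd f i x D"
  unfolding has_pd_def using DERIV_shift[of "\<lambda>s. f (x(i := s))" D 0 "x i"]
  by (simp add: add.commute)

lemma has_pd_const: "has_pd (\<lambda>_. c) i x 0"
  by (simp add: has_pd_def)

lemma has_pd_coord: "has_pd (\<lambda>x. x j) i x (if i = j then 1 else 0)"
  unfolding has_pd_def by (auto intro!: derivative_eq_intros)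

lemma has_pd_add: "has_pd f i x D \<Longrightarrow> has_pd g i x E \<Longrightarrow> has_pd (\<lambda>x. f x + g x) i x (D + E)"
  unfolding has_pd_def by (rule DERIV_add)

lemma has_pd_mult:
  "has_pd f i x D \<Longrightarrow> has_pd g i x E \<Longrightarrow> has_pd (\<lambda>x. f x * g x) i x (D * g x + f x * E)"
  unfolding has_pd_def by (auto intro!: derivative_eq_intros)

lemma has_pd_comp:
  "(q has_real_derivative E) (at (f x)) \<Longrightarrow> has_pd f i x D \<Longrightarrow> has_pd (\<lambda>x. q (f x)) i x (E * D)"
  unfolding has_pd_def by (rule DERIV_chain2) auto

text \<open>Working with finite orders of differentiability turns the closure properties of
  smooth functions into plain inductions.\<close>

fun Ck :: "nat \<Rightarrow> vec set \<Rightarrow> nat \<Rightarrow> (vec \<Rightarrow> real) \<Rightarrow> bool" where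
  "Ck n U 0 f \<longleftrightarrow> continuous_on U f"
| "Ck n U (Suc k) f \<longleftrightarrow> continuous_on U f \<and>
     (\<forall>i<n. \<exists>D. (\<forall>x\<in>U. has_pd f i x (D x)) \<and> Ck n U k D)"

lemma Ck_continuous: "Ck n U k f \<Longrightarrow> continuous_on U f"
  by (cases k) auto

lemma Ck_cong:
  assumes "domain n U" "\<And>y. y \<in> U \<Longrightarrow> f y = g y" "Ck n U k f"
  shows "Ck n U k g"
proof (cases k)
  case 0
  then show ?thesis using assms continuous_on_eq by auto
next
  case (Suc l)
  have "continuous_on U g" using assms Ck_continuous continuous_on_eq by blast
  moreover have "\<exists>D. (\<forall>x\<in>U. has_pd g i x (D x)) \<and> Ck n U l D" if i: "i < n" for i
  proof -
    obtain D where D: "\<forall>x\<in>U. has_pd f i x (D x)" "Ck n U l D" using assms(3) Suc i by auto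
    have "has_pd g i x (D x)" if x: "x \<in> U" for x
      by (rule has_pd_cong[OF assms(1) x i assms(2)]) (use D x in auto)
    then show ?thesis using D(2) by blast
  qed
  ultimately show ?thesis using Suc by simp
qed

lemma Ck_SucE:
  assumes "Ck n U (Suc k) f" "i < n"
  obtains D where "\<And>x. x \<in> U \<Longrightarrow> has_pd f i x (D x)" "Ck n U k D"
  using assms unfolding Ck.simps by blast

lemma Ck_Suc_ex:
  "Ck n U (Suc k) f \<Longrightarrow> i < n \<Longrightarrow> \<exists>D. (\<forall>x\<in>U. has_pd f i x (D x)) \<and> Ck n U k D"
  by simp

lemma Ck_SucI:
  assumes "continuous_on U f" "\<And>i x. i < n \<Longrightarrow> x \<in> U \<Longrightarrow> has_pd f i x (D i x)"
    "\<And>i. i < n \<Longrightarrow> Ck n U k (D i)"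
  shows "Ck n U (Suc k) f"
  using assms by auto

lemma Ck_le_Suc: "Ck n U (Suc k) f \<Longrightarrow> Ck n U k f"
proof (induction k arbitrary: f)
  case (Suc k)
  have "\<exists>D. (\<forall>x\<in>U. has_pd f i x (D x)) \<and> Ck n U k D" if i: "i < n" for i
  proof -
    obtain D where "\<And>x. x \<in> U \<Longrightarrow> has_pd f i x (D x)" "Ck n U (Suc k) D"
      using Ck_SucE[OF Suc.prems i] by blast
    then show ?thesis using Suc.IH by blast
  qed
  then show ?case using Ck_continuous[OF Suc.prems] by simp
qed auto

lemma smooth_fun_has_pd:
  assumes "smooth_fun n U f" "set is \<subseteq> {..<n}" "i < n" "x \<in> U"
  shows "has_pd (iter_pd is f) i x (iter_pd (i # is) f x)"
proof -
  have "(\<lambda>h. iter_pd is f (x(i := x i + h))) differentiable (at 0)"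
    using assms unfolding smooth_fun_def by blast
  then show ?thesis unfolding has_pd_def by (simp add: pd_def DERIV_deriv_iff_real_differentiable)
qed

lemma smooth_fun_continuous: "smooth_fun n U f \<Longrightarrow> set is \<subseteq> {..<n} \<Longrightarrow> continuous_on U (iter_pd is f)"
  by (simp add: smooth_fun_def)

text \<open>From right to left, the derivatives provided by \<open>Ck\<close> agree with
  \<open>iter_pd\<close> only on \<open>U\<close>. As \<open>U\<close> is open, this is enough to
  replace one by the other under further partial derivatives, by \<open>Ck_cong\<close>.\<close>

lemma smooth_fun_iff_Ck:
  assumes "domain n U"
  shows "smooth_fun n U f \<longleftrightarrow> (\<forall>k. Ck n U k f)"
proof
  assume s: "smooth_fun n U f"
  have "Ck n U k (iter_pd is f)" if "set is \<subseteq> {..<n}" for k "is"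
    using that
  proof (induction k arbitrary: "is")
    case (Suc k)
    have "Ck n U k (iter_pd (i # is) f)" if "i < n" for i
      by (rule Suc.IH) (use that Suc.prems in auto)
    then show ?case
      using smooth_fun_has_pd[OF s Suc.prems] smooth_fun_continuous[OF s Suc.prems]
      by (intro Ck_SucI[where D = "\<lambda>i. iter_pd (i # is) f"])
  qed (use s smooth_fun_continuous in simp)
  from this[of "[]"] show "\<forall>k. Ck n U k f" by simp
next
  assume C: "\<forall>k. Ck n U k f"
  have *: "Ck n U k (iter_pd is f)" if "set is \<subseteq> {..<n}" "Ck n U (length is + k) f" for k "is" f
    using that
  proof (induction "is" arbitrary: f k)
    case (Cons i js)
    then have "Ck n U (Suc k) (iter_pd js f)"
      by (intro Cons.IH) (auto simp del: Ck.simps)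
    then obtain D where "\<forall>x\<in>U. has_pd (iter_pd js f) i x (D x)" "Ck n U k D"
      using Cons.prems by auto
    then show ?case
      by (auto intro!: Ck_cong[OF assms(1), of D] simp: has_pd_imp_pd)
  qed auto
  show "smooth_fun n U f"
    unfolding smooth_fun_def
  proof (intro allI impI conjI ballI)
    fix "is" :: "nat list" assume i: "set is \<subseteq> {..<n}"
    have c: "Ck n U (Suc 0) (iter_pd is f)" using *[OF i] C by blast
    then show "continuous_on U (iter_pd is f)" by simp
    fix i x assume "i < n" "x \<in> U"
    then show "(\<lambda>h. iter_pd is f (x(i := x i + h))) differentiable (at 0)"
      using Ck_SucE[OF c \<open>i < n\<close>] unfolding has_pd_def real_differentiable_def by blast
  qed
qed

lemma Ck_const: "Ck n U k (\<lambda>_. c)"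
proof (induction k arbitrary: c)
  case (Suc k)
  then show ?case using has_pd_const by (auto intro!: exI[of _ "\<lambda>_. 0"])
qed auto

lemma continuous_coord: "continuous_on U (\<lambda>x::vec. x i)"
  by (rule continuous_on_subset[OF continuous_on_product_coordinates]) simp

lemma Ck_coord: "Ck n U k (\<lambda>x. x j)"
proof (cases k)
  case (Suc l)
  have "Ck n U (Suc l) (\<lambda>x. x j)"
    by (rule Ck_SucI[where D = "\<lambda>i _. if i = j then 1 else 0"])
      (use continuous_coord has_pd_coord Ck_const in blast)+
  then show ?thesis using Suc by simp
qed (simp add: continuous_coord)

lemma Ck_add: "Ck n U k f \<Longrightarrow> Ck n U k g \<Longrightarrow> Ck n U k (\<lambda>x. f x + g x)"
proof (induction k arbitrary: f g)
  case 0
  then show ?case by (auto intro: continuous_intros)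
next
  case (Suc k)
  show ?case
    unfolding Ck.simps
  proof (intro conjI allI impI)
    show "continuous_on U (\<lambda>x. f x + g x)" using Suc.prems by (auto intro: continuous_intros)
    fix i assume "i < n"
    then obtain D E where "\<forall>x\<in>U. has_pd f i x (D x)" "Ck n U k D"
      "\<forall>x\<in>U. has_pd g i x (E x)" "Ck n U k E" using Suc.prems by auto metis
    then show "\<exists>D. (\<forall>x\<in>U. has_pd (\<lambda>x. f x + g x) i x (D x)) \<and> Ck n U k D"
      using Suc.IH has_pd_add by (intro exI[of _ "\<lambda>x. D x + E x"]) auto
  qed
qed

lemma Ck_mult: "Ck n U k f \<Longrightarrow> Ck n U k g \<Longrightarrow> Ck n U k (\<lambda>x. f x * g x)"
proof (induction k arbitrary: f g)
  case 0
  then show ?case by (auto intro: continuous_intros)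
next
  case (Suc k)
  show ?case
    unfolding Ck.simps
  proof (intro conjI allI impI)
    show "continuous_on U (\<lambda>x. f x * g x)" using Suc.prems by (auto intro: continuous_intros)
    fix i assume "i < n"
    then obtain D E where "\<forall>x\<in>U. has_pd f i x (D x)" "Ck n U k D"
      "\<forall>x\<in>U. has_pd g i x (E x)" "Ck n U k E" using Suc.prems by auto metis
    moreover have "Ck n U k f" "Ck n U k g" using Suc.prems Ck_le_Suc by blast+
    ultimately show "\<exists>D. (\<forall>x\<in>U. has_pd (\<lambda>x. f x * g x) i x (D x)) \<and> Ck n U k D"
      using Suc.IH has_pd_mult by (intro exI[of _ "\<lambda>x. D x * g x + f x * E x"]) (auto intro!: Ck_add)
  qed
qed

lemma Ck_sum: "(\<And>j. j \<in> A \<Longrightarrow> Ck n U k (f j)) \<Longrightarrow> Ck n U k (\<lambda>x. \<Sum>j\<in>A. f j x)"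
  by (induction A rule: infinite_finite_induct) (auto intro: Ck_const Ck_add)

text \<open>One order is gained at a time, from the regularity of \<open>q'\<close> along
  \<open>f\<close>. For \<open>inverse\<close>, \<open>sqrt\<close> and the functions
  \<open>ellp p\<close> the derivative is an expression in functions that the induction on the order
  has already treated.\<close>

lemma Ck_comp_Suc:
  assumes "Ck n U (Suc k) f" "\<And>x. x \<in> U \<Longrightarrow> (q has_real_derivative q' (f x)) (at (f x))"
    "Ck n U k (\<lambda>x. q' (f x))"
  shows "Ck n U (Suc k) (\<lambda>x. q (f x))"
  unfolding Ck.simps
proof (intro conjI allI impI)
  have f: "continuous_on U f" using assms(1) by simp
  have "continuous_on (f ` U) q"
    using assms(2) by (intro continuous_at_imp_continuous_on ballI) (auto intro: DERIV_isCont)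
  then show "continuous_on U (\<lambda>x. q (f x))" using f by (rule continuous_on_compose2) auto
  fix i assume "i < n"
  then obtain D where D: "\<forall>x\<in>U. has_pd f i x (D x)" "Ck n U k D" using assms(1) by auto
  then show "\<exists>D. (\<forall>x\<in>U. has_pd (\<lambda>x. q (f x)) i x (D x)) \<and> Ck n U k D"
    using assms(2,3) has_pd_comp by (intro exI[of _ "\<lambda>x. q' (f x) * D x"]) (auto intro!: Ck_mult)
qed

lemma Ck_inverse:
  assumes "Ck n U k f" "\<And>x. x \<in> U \<Longrightarrow> f x \<noteq> 0"
  shows "Ck n U k (\<lambda>x. inverse (f x))"
  using assms(1)
proof (induction k)
  case 0
  then show ?case using assms by (auto intro: continuous_intros)
next
  case (Suc k)
  then have I: "Ck n U k (\<lambda>x. inverse (f x))" using Ck_le_Suc by blast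
  show ?case
  proof (rule Ck_comp_Suc[OF Suc.prems])
    show "(inverse has_real_derivative (-1) * (inverse (f x) * inverse (f x))) (at (f x))" if "x \<in> U" for x
      using assms(2)[OF that] by (auto intro!: derivative_eq_intros)
    show "Ck n U k (\<lambda>x. (-1) * (inverse (f x) * inverse (f x)))"
      by (intro Ck_mult Ck_const I)
  qed
qed

lemma Ck_sqrt:
  assumes "Ck n U k f" "\<And>x. x \<in> U \<Longrightarrow> f x > 0"
  shows "Ck n U k (\<lambda>x. sqrt (f x))"
  using assms(1)
proof (induction k)
  case 0
  then show ?case by (auto intro: continuous_intros)
next
  case (Suc k)
  then have I: "Ck n U k (\<lambda>x. sqrt (f x))" using Ck_le_Suc by blast
  show ?case
  proof (rule Ck_comp_Suc[OF Suc.prems])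
    show "(sqrt has_real_derivative (inverse (sqrt (f x)) * (1/2))) (at (f x))" if "x \<in> U" for x
      using assms(2)[OF that] by (auto intro!: derivative_eq_intros simp: field_simps)
    show "Ck n U k (\<lambda>x. inverse (sqrt (f x)) * (1/2))"
      by (intro Ck_mult Ck_const Ck_inverse I) (use assms(2) in force)
  qed
qed

subsection \<open>The chain rule\<close>

text \<open>Continuous partial derivatives give total differentiability: move from \<open>y\<close>
  to \<open>z\<close> one coordinate at a time and apply the mean value inequality on each
  segment.\<close>

lemma partials_total:
  assumes V: "domain N V" "y \<in> V"
    and f: "\<And>j z. j < N \<Longrightarrow> z \<in> V \<Longrightarrow> has_pd f j z (D j z)"
    and D: "\<And>j. j < N \<Longrightarrow> continuous_on V (D j)"
    and e: "e > 0"
  obtains d where "d > 0" "\<And>z. z \<in> Rn N \<Longrightarrow> near N y d z \<Longrightarrow>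
    \<bar>f z - f y - (\<Sum>j<N. D j y * (z j - y j))\<bar> \<le> e * (\<Sum>j<N. \<bar>z j - y j\<bar>)"
proof -
  obtain d0 where d0: "d0 > 0" "\<And>y'. y' \<in> Rn N \<Longrightarrow> near N y d0 y' \<Longrightarrow> y' \<in> V"
    using domain_near[OF V] by blast
  have "\<forall>j. \<exists>d>0. j < N \<longrightarrow> (\<forall>z\<in>V. near N y d z \<longrightarrow> \<bar>D j z - D j y\<bar> < e)"
    using D V(2) e continuous_on_Rn_iff[OF domain_subset[OF V(1)]] by (metis zero_less_one)
  then obtain dd where dd: "\<And>j. dd j > 0"
    "\<And>j z. j < N \<Longrightarrow> z \<in> V \<Longrightarrow> near N y (dd j) z \<Longrightarrow> \<bar>D j z - D j y\<bar> < e" by metis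
  define d where "d = Min (insert d0 (dd ` {..<N}))"
  have dpos: "d > 0" unfolding d_def using d0 dd by (subst Min_gr_iff) auto
  have dd0: "d \<le> d0" unfolding d_def by (intro Min_le) auto
  have ddj: "d \<le> dd j" if "j < N" for j unfolding d_def using that by (intro Min_le) auto
  show thesis
  proof (rule that[OF dpos])
    fix z assume z: "z \<in> Rn N" "near N y d z"
    define p where "p k = (\<lambda>j. if j < k then z j else y j)" for k
    have yR: "y \<in> Rn N" using V domain_subset by auto
    have step: "\<bar>f (p (Suc k)) - f (p k) - D k y * (z k - y k)\<bar> \<le> e * \<bar>z k - y k\<bar>" if k: "k < N" for k
    proof -
      have inV: "(p k)(k := s) \<in> V \<and> near N y d ((p k)(k := s))" if "\<bar>s - y k\<bar> < d" for s
      proof -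
        have "near N y d ((p k)(k := s))" using z(2) that dpos by (auto simp: near_def p_def)
        moreover have "(p k)(k := s) \<in> Rn N" using k z yR by (auto simp: Rn_def p_def)
        ultimately show ?thesis using d0 dd0 near_mono by blast
      qed
      \<comment> \<open>Subtracting the linear part leaves a function whose derivative is at most
        \<open>e\<close> in absolute value near \<open>y k\<close>.\<close>
      define \<phi> where "\<phi> s = f ((p k)(k := s)) - D k y * s" for s
      have der: "(\<phi> has_real_derivative (D k ((p k)(k := s)) - D k y)) (at s)"
        if "\<bar>s - y k\<bar> < d" for s
      proof -
        have "((\<lambda>s'. f ((p k)(k := s, k := s'))) has_real_derivative D k ((p k)(k := s))) (at (((p k)(k := s)) k))"
          by (rule has_pd_DERIV) (use f k inV that in blast)
        then show ?thesis unfolding \<phi>_def by (auto intro!: derivative_eq_intros)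
      qed
      have zk: "\<bar>z k - y k\<bar> < d" using z k by (simp add: near_def)
      have "norm (\<phi> (z k) - \<phi> (y k)) \<le> e * norm (z k - y k)"
      proof (rule field_differentiable_bound[of "{s. \<bar>s - y k\<bar> < d}"])
        have "{s. \<bar>s - y k\<bar> < d} = ball (y k) d" by (auto simp: dist_real_def)
        then show "convex {s. \<bar>s - y k\<bar> < d}" by simp
        show "(\<phi> has_field_derivative (D k ((p k)(k := s)) - D k y)) (at s within {s. \<bar>s - y k\<bar> < d})"
          if "s \<in> {s. \<bar>s - y k\<bar> < d}" for s
          using der that has_field_derivative_at_within by blast
        show "norm (D k ((p k)(k := s)) - D k y) \<le> e" if "s \<in> {s. \<bar>s - y k\<bar> < d}" for s
          using dd(2)[OF k] inV that ddj[OF k] near_mono by (fastforce intro: less_imp_le)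
      qed (use zk dpos in auto)
      moreover have "(p k)(k := z k) = p (Suc k)" "(p k)(k := y k) = p k"
        by (auto simp: p_def less_Suc_eq)
      ultimately show ?thesis by (simp add: \<phi>_def algebra_simps)
    qed
    have pN: "p N = z" "p 0 = y" using z yR by (auto simp: p_def Rn_def fun_eq_iff)
    have "f z - f y = (\<Sum>k<N. f (p (Suc k)) - f (p k))"
      using pN sum_lessThan_telescope[of "\<lambda>k. f (p k)" N] by simp
    then have "f z - f y - (\<Sum>j<N. D j y * (z j - y j)) =
        (\<Sum>k<N. f (p (Suc k)) - f (p k) - D k y * (z k - y k))"
      by (simp add: sum_subtractf)
    also have "\<bar>\<dots>\<bar> \<le> (\<Sum>k<N. e * \<bar>z k - y k\<bar>)"
      by (rule order_trans[OF sum_abs sum_mono]) (use step in auto)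
    finally show "\<bar>f z - f y - (\<Sum>j<N. D j y * (z j - y j))\<bar> \<le> e * (\<Sum>j<N. \<bar>z j - y j\<bar>)"
      by (simp add: sum_distrib_left)
  qed
qed

text \<open>In the chain rule, \<open>c\<close> will be the image under \<open>F\<close> of a
  segment in a coordinate direction. The error from \<open>partials_total\<close> stays small after
  division by \<open>h\<close> because the difference quotients of the coordinates converge and
  hence are bounded.\<close>

lemma chain_curve:
  fixes c :: "real \<Rightarrow> vec"
  assumes V: "domain N V" "c 0 \<in> V" "\<forall>\<^sub>F h in nhds 0. c h \<in> V"
    and f: "\<And>j z. j < N \<Longrightarrow> z \<in> V \<Longrightarrow> has_pd f j z (D j z)"
    and D: "\<And>j. j < N \<Longrightarrow> continuous_on V (D j)"
    and c: "\<And>j. j < N \<Longrightarrow> ((\<lambda>h. c h j) has_real_derivative d j) (at 0)"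
  shows "((\<lambda>h. f (c h)) has_real_derivative (\<Sum>j<N. D j (c 0) * d j)) (at 0)"
proof -
  define L where "L h = (\<Sum>j<N. D j (c 0) * (c h j - c 0 j))" for h
  \<comment> \<open>Eventually each difference quotient is within \<open>1\<close> of its limit
    \<open>d j\<close>, so \<open>B\<close> bounds the sum of their absolute values.\<close>
  define B where "B = (\<Sum>j<N. \<bar>d j\<bar> + 1)"
  have B0: "B \<ge> 0" unfolding B_def by (intro sum_nonneg) auto
  have c': "((\<lambda>h. (c h j - c 0 j) / h) \<longlongrightarrow> d j) (at 0)" if "j < N" for j
    using c[OF that] by (simp add: has_field_derivative_iff)
  have L: "((\<lambda>h. L h / h) \<longlongrightarrow> (\<Sum>j<N. D j (c 0) * d j)) (at 0)"
  proof -
    have "((\<lambda>h. \<Sum>j<N. D j (c 0) * ((c h j - c 0 j) / h)) \<longlongrightarrow> (\<Sum>j<N. D j (c 0) * d j)) (at 0)"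
      by (intro tendsto_intros c') auto
    then show ?thesis by (simp add: L_def sum_divide_distrib)
  qed
  have "((\<lambda>h. (f (c h) - f (c 0) - L h) / h) \<longlongrightarrow> 0) (at 0)"
  proof (rule tendstoI)
    fix e :: real assume "e > 0"
    define e' where "e' = e / (B + 1)"
    have e': "e' > 0" "e' * B < e" using \<open>e > 0\<close> B0 by (auto simp: e'_def field_simps)
    obtain \<delta> where \<delta>: "\<delta> > 0" "\<And>z. z \<in> Rn N \<Longrightarrow> near N (c 0) \<delta> z \<Longrightarrow>
      \<bar>f z - f (c 0) - (\<Sum>j<N. D j (c 0) * (z j - c 0 j))\<bar> \<le> e' * (\<Sum>j<N. \<bar>z j - c 0 j\<bar>)"
      using partials_total[OF V(1,2) f D e'(1)] by blast
    have "\<forall>\<^sub>F h in at 0. \<forall>j\<in>{..<N}. \<bar>c h j - c 0 j\<bar> < \<delta>"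
    proof (rule eventually_ball_finite)
      show "\<forall>j\<in>{..<N}. \<forall>\<^sub>F h in at 0. \<bar>c h j - c 0 j\<bar> < \<delta>"
      proof
        fix j assume "j \<in> {..<N}"
        then have "((\<lambda>h. c h j) \<longlongrightarrow> c 0 j) (at 0)"
          using c DERIV_isCont isCont_def by blast
        from tendstoD[OF this \<delta>(1)] show "\<forall>\<^sub>F h in at 0. \<bar>c h j - c 0 j\<bar> < \<delta>"
          by (simp add: dist_real_def)
      qed
    qed auto
    moreover have "\<forall>\<^sub>F h in at 0. \<forall>j\<in>{..<N}. \<bar>(c h j - c 0 j) / h\<bar> \<le> \<bar>d j\<bar> + 1"
    proof (rule eventually_ball_finite)
      show "\<forall>j\<in>{..<N}. \<forall>\<^sub>F h in at 0. \<bar>(c h j - c 0 j) / h\<bar> \<le> \<bar>d j\<bar> + 1"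
      proof
        fix j assume "j \<in> {..<N}"
        then have "\<forall>\<^sub>F h in at 0. dist ((c h j - c 0 j) / h) (d j) < 1"
          using tendstoD[OF c'] by simp
        then show "\<forall>\<^sub>F h in at 0. \<bar>(c h j - c 0 j) / h\<bar> \<le> \<bar>d j\<bar> + 1"
          by eventually_elim (unfold dist_real_def, linarith)
      qed
    qed auto
    moreover have "\<forall>\<^sub>F h in at 0. c h \<in> V"
      using V(3) eventually_nhds_conv_at by blast
    moreover have "\<forall>\<^sub>F h in at (0::real). h \<noteq> 0" by (simp add: eventually_at_filter)
    ultimately show "\<forall>\<^sub>F h in at 0. dist ((f (c h) - f (c 0) - L h) / h) 0 < e"
    proof eventually_elim
      case (elim h)
      have "\<bar>f (c h) - f (c 0) - L h\<bar> \<le> e' * (\<Sum>j<N. \<bar>c h j - c 0 j\<bar>)"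
        unfolding L_def using elim domain_subset[OF V(1)] by (intro \<delta>(2)) (auto simp: near_def)
      then have "\<bar>f (c h) - f (c 0) - L h\<bar> / \<bar>h\<bar> \<le> e' * (\<Sum>j<N. \<bar>c h j - c 0 j\<bar>) / \<bar>h\<bar>"
        by (rule divide_right_mono) simp
      also have "\<dots> = e' * (\<Sum>j<N. \<bar>(c h j - c 0 j) / h\<bar>)"
        by (simp add: sum_divide_distrib[symmetric] abs_divide)
      also have "\<dots> \<le> e' * B" unfolding B_def
        using elim e'(1) by (intro mult_left_mono sum_mono) auto
      finally show ?case using e' by (simp add: abs_divide)
    qed
  qed
  from tendsto_add[OF this L] show ?thesis
    by (simp add: has_field_derivative_iff add_divide_distrib[symmetric])
qed

text \<open>Induction on \<open>k\<close>: the partial derivatives of the composite are sums of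
  products of \<open>D j (F x)\<close> and \<open>d j x\<close>, and the functions
  \<open>D j\<close>, being one order less regular than \<open>f\<close>, fall under the induction
  hypothesis.\<close>

lemma Ck_compose:
  assumes "domain n U" "domain N V" "\<And>x. x \<in> U \<Longrightarrow> F x \<in> V"
    "Ck N V k f" "\<And>j. j < N \<Longrightarrow> Ck n U k (\<lambda>x. F x j)"
  shows "Ck n U k (\<lambda>x. f (F x))"
  using assms(4,5)
proof (induction k arbitrary: f)
  case 0
  have "continuous_on U F"
  proof (rule continuous_on_coordinatewise_then_product)
    fix j
    show "continuous_on U (\<lambda>x. F x j)"
    proof (cases "j < N")
      case True then show ?thesis using 0 by simp
    next
      case False
      then have "F x j = 0" if "x \<in> U" for x
        using assms(3)[OF that] domain_subset[OF assms(2)] by (auto simp: Rn_def)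
      then show ?thesis by (simp cong: continuous_on_cong)
    qed
  qed
  then show ?case using 0 assms(3) by (auto intro: continuous_on_compose2[of V f U F])
next
  case (Suc k)
  have cF: "Ck n U k (\<lambda>x. F x j)" if "j < N" for j using Suc.prems Ck_le_Suc that by blast
  show ?case
    unfolding Ck.simps
  proof (intro conjI allI impI)
    have "Ck n U k (\<lambda>x. f (F x))" by (rule Suc.IH[OF Ck_le_Suc[OF Suc.prems(1)] cF])
    then show "continuous_on U (\<lambda>x. f (F x))" by (rule Ck_continuous)
    fix i assume i: "i < n"
    define D where "D j = (SOME D. (\<forall>z\<in>V. has_pd f j z (D z)) \<and> Ck N V k D)" for j
    have D: "(\<forall>z\<in>V. has_pd f j z (D j z)) \<and> Ck N V k (D j)" if "j < N" for j
      unfolding D_def by (rule someI_ex[OF Ck_Suc_ex[OF Suc.prems(1) that]])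
    define d where "d j = (SOME d. (\<forall>x\<in>U. has_pd (\<lambda>x. F x j) i x (d x)) \<and> Ck n U k d)" for j
    have d: "(\<forall>x\<in>U. has_pd (\<lambda>x. F x j) i x (d j x)) \<and> Ck n U k (d j)" if "j < N" for j
      unfolding d_def by (rule someI_ex[OF Ck_Suc_ex[OF Suc.prems(2)[OF that] i]])
    have C: "Ck n U k (\<lambda>x. \<Sum>j<N. D j (F x) * d j x)"
    proof (rule Ck_sum)
      fix j assume "j \<in> {..<N}"
      then have "Ck N V k (D j)" "Ck n U k (d j)" using D[of j] d[of j] by auto
      then show "Ck n U k (\<lambda>x. D j (F x) * d j x)"
        using Ck_mult[OF Suc.IH[OF _ cF]] by blast
    qed
    have "has_pd (\<lambda>x. f (F x)) i x (\<Sum>j<N. D j (F x) * d j x)" if x: "x \<in> U" for x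
    proof -
      have "((\<lambda>h. f (F (x(i := x i + h)))) has_real_derivative
          (\<Sum>j<N. D j (F (x(i := x i + 0))) * d j x)) (at 0)"
      proof (rule chain_curve[OF assms(2)])
        show "F (x(i := x i + 0)) \<in> V" using x assms(3) by simp
        show "\<forall>\<^sub>F h in nhds 0. F (x(i := x i + h)) \<in> V"
          using slice_in[OF assms(1) x i] by eventually_elim (rule assms(3))
        show "has_pd f j z (D j z)" if "j < N" "z \<in> V" for j z using D[OF that(1)] that(2) by simp
        show "continuous_on V (D j)" if "j < N" for j by (rule Ck_continuous) (use D[OF that] in blast)
        show "((\<lambda>h. F (x(i := x i + h)) j) has_real_derivative d j x) (at 0)" if "j < N" for j
          using d[OF that] x unfolding has_pd_def by simp
      qed
      then show ?thesis by (simp add: has_pd_def)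
    qed
    then show "\<exists>D. (\<forall>x\<in>U. has_pd (\<lambda>x. f (F x)) i x (D x)) \<and> Ck n U k D"
      by (intro exI[of _ "\<lambda>x. \<Sum>j<N. D j (F x) * d j x"] conjI ballI C)
  qed
qed

section \<open>Closure properties and locality of smooth functions\<close>

lemma smooth_const: "domain n U \<Longrightarrow> smooth_fun n U (\<lambda>_. c)"
  by (simp add: smooth_fun_iff_Ck Ck_const)

lemma smooth_coord: "domain n U \<Longrightarrow> smooth_fun n U (\<lambda>x. x j)"
  by (simp add: smooth_fun_iff_Ck Ck_coord)

lemma smooth_add:
  "domain n U \<Longrightarrow> smooth_fun n U f \<Longrightarrow> smooth_fun n U g \<Longrightarrow> smooth_fun n U (\<lambda>x. f x + g x)"
  by (simp add: smooth_fun_iff_Ck Ck_add)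

lemma smooth_mult:
  "domain n U \<Longrightarrow> smooth_fun n U f \<Longrightarrow> smooth_fun n U g \<Longrightarrow> smooth_fun n U (\<lambda>x. f x * g x)"
  by (simp add: smooth_fun_iff_Ck Ck_mult)

lemma smooth_diff:
  assumes "domain n U" "smooth_fun n U f" "smooth_fun n U g"
  shows "smooth_fun n U (\<lambda>x. f x - g x)"
  using smooth_add[OF assms(1,2) smooth_mult[OF assms(1) smooth_const[OF assms(1), of "-1"] assms(3)]]
  by simp

lemma smooth_power: "domain n U \<Longrightarrow> smooth_fun n U f \<Longrightarrow> smooth_fun n U (\<lambda>x. f x ^ k)"
  by (induction k) (auto intro: smooth_const smooth_mult)

lemma smooth_sum:
  "domain n U \<Longrightarrow> (\<And>j. j \<in> A \<Longrightarrow> smooth_fun n U (f j)) \<Longrightarrow> smooth_fun n U (\<lambda>x. \<Sum>j\<in>A. f j x)"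
  by (simp add: smooth_fun_iff_Ck Ck_sum)

lemma smooth_divide:
  assumes "domain n U" "smooth_fun n U f" "smooth_fun n U g" "\<And>x. x \<in> U \<Longrightarrow> g x \<noteq> 0"
  shows "smooth_fun n U (\<lambda>x. f x / g x)"
proof -
  have "smooth_fun n U (\<lambda>x. inverse (g x))"
    using assms by (simp add: smooth_fun_iff_Ck Ck_inverse)
  from smooth_mult[OF assms(1,2) this] show ?thesis by (simp add: divide_inverse)
qed

lemma smooth_sqrt:
  "domain n U \<Longrightarrow> smooth_fun n U f \<Longrightarrow> (\<And>x. x \<in> U \<Longrightarrow> f x > 0) \<Longrightarrow> smooth_fun n U (\<lambda>x. sqrt (f x))"
  by (simp add: smooth_fun_iff_Ck Ck_sqrt)

lemma smooth_compose:
  assumes "domain n U" "domain N V" "\<And>x. x \<in> U \<Longrightarrow> F x \<in> V"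
    "smooth_fun N V f" "\<And>j. j < N \<Longrightarrow> smooth_fun n U (\<lambda>x. F x j)"
  shows "smooth_fun n U (\<lambda>x. f (F x))"
  using assms by (simp add: smooth_fun_iff_Ck Ck_compose)

lemma smooth_cong:
  "domain n U \<Longrightarrow> (\<And>x. x \<in> U \<Longrightarrow> f x = g x) \<Longrightarrow> smooth_fun n U f \<Longrightarrow> smooth_fun n U g"
  by (simp add: smooth_fun_iff_Ck) (metis Ck_cong)

lemma smooth_subset: "smooth_fun n U f \<Longrightarrow> V \<subseteq> U \<Longrightarrow> smooth_fun n V f"
  unfolding smooth_fun_def by (meson continuous_on_subset subsetD)

lemma smooth_imp_continuous: "smooth_fun n U f \<Longrightarrow> continuous_on U f"
  using smooth_fun_continuous[of n U f "[]"] by simp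

lemma smooth_iter_pd:
  assumes "smooth_fun n U f" "set is \<subseteq> {..<n}"
  shows "smooth_fun n U (iter_pd is f)"
proof -
  have *: "iter_pd js (iter_pd is f) = iter_pd (js @ is) f" for js
    by (induction js) auto
  show ?thesis using assms unfolding smooth_fun_def * by auto
qed

text \<open>\<open>iter_pd is f\<close> is formed from \<open>f\<close> alone, whatever the domain,
  so all neighbourhoods \<open>V\<close> speak about the same functions, and continuity and
  differentiability at a point are local.\<close>

lemma smooth_local:
  assumes U: "domain n U"
    and loc: "\<And>x. x \<in> U \<Longrightarrow> \<exists>V. x \<in> V \<and> domain n V \<and> smooth_fun n V f"
  shows "smooth_fun n U f"
  unfolding smooth_fun_def
proof (intro allI impI conjI ballI)
  fix "is" :: "nat list" assume i: "set is \<subseteq> {..<n}"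
  show "continuous_on U (iter_pd is f)"
    unfolding continuous_on_Rn_iff[OF domain_subset[OF U]]
  proof (intro ballI allI impI)
    fix x e assume x: "x \<in> U" and e: "(e::real) > 0"
    obtain V where V: "x \<in> V" "domain n V" "smooth_fun n V f" using loc[OF x] by blast
    have c: "continuous_on V (iter_pd is f)" using V i by (simp add: smooth_fun_def)
    obtain d where d: "d > 0" "\<forall>y\<in>V. near n x d y \<longrightarrow> \<bar>iter_pd is f y - iter_pd is f x\<bar> < e"
      using c V(1) e unfolding continuous_on_Rn_iff[OF domain_subset[OF V(2)]] by blast
    obtain d' where d': "d' > 0" "\<And>y. y \<in> Rn n \<Longrightarrow> near n x d' y \<Longrightarrow> y \<in> V"
      using domain_near[OF V(2,1)] by blast
    have "\<bar>iter_pd is f y - iter_pd is f x\<bar> < e" if y: "y \<in> U" "near n x (min d d') y" for y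
    proof -
      have "y \<in> V" using d'(2)[of y] y near_mono[OF y(2), of d'] domain_subset[OF U] by auto
      then show ?thesis using d(2) near_mono[OF y(2), of d] by auto
    qed
    then show "\<exists>d>0. \<forall>y\<in>U. near n x d y \<longrightarrow> \<bar>iter_pd is f y - iter_pd is f x\<bar> < e"
      using d(1) d'(1) by (intro exI[of _ "min d d'"]) auto
  qed
next
  fix "is" :: "nat list" and i x
  assume i: "set is \<subseteq> {..<n}" "i < n" and x: "x \<in> U"
  obtain V where "x \<in> V" "domain n V" "smooth_fun n V f" using loc[OF x] by blast
  then show "(\<lambda>h. iter_pd is f (x(i := x i + h))) differentiable (at 0)"
    using i unfolding smooth_fun_def by blast
qed

subsection \<open>The auxiliary functions of one variable\<close>

text \<open>Up to linear combinations the functions \<open>exp (- 1 / t) / t ^ p\<close>, continued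
  by \<open>0\<close>, are closed under differentiation, and \<open>ell\<close> is the case
  \<open>p = 0\<close>; one induction therefore covers all derivatives of
  \<open>ell\<close>.\<close>

definition ellp :: "nat \<Rightarrow> real \<Rightarrow> real" where
  "ellp p t = (if t \<le> 0 then 0 else exp (- 1 / t) / t ^ p)"

lemma ell_eq_ellp: "ell = ellp 0"
  by (auto simp: ell_def ellp_def)

lemma DERIV_zero_quadratic:
  assumes "\<forall>\<^sub>F h in nhds 0. \<bar>f h\<bar> \<le> C * h\<^sup>2"
  shows "(f has_real_derivative 0) (at (0::real))"
proof -
  have f0: "f 0 = 0" using eventually_nhds_x_imp_x[OF assms] by simp
  have "((\<lambda>h. (f h - f 0) / h) \<longlongrightarrow> 0) (at 0)"
  proof (rule Lim_null_comparison)
    have "\<forall>\<^sub>F h in at 0. \<bar>f h\<bar> \<le> C * h\<^sup>2" using assms eventually_nhds_conv_at by blast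
    moreover have "\<forall>\<^sub>F h in at (0::real). h \<noteq> 0" by (simp add: eventually_at_filter)
    ultimately show "\<forall>\<^sub>F h in at 0. norm ((f h - f 0) / h) \<le> C * \<bar>h\<bar>"
    proof eventually_elim
      case (elim h)
      have "\<bar>f h\<bar> / \<bar>h\<bar> \<le> C * h\<^sup>2 / \<bar>h\<bar>" using elim by (intro divide_right_mono) auto
      also have "C * h\<^sup>2 / \<bar>h\<bar> = C * \<bar>h\<bar>" using elim by (simp add: power2_eq_square abs_if)
      finally show ?case using f0 by simp
    qed
    show "((\<lambda>h. C * \<bar>h\<bar>) \<longlongrightarrow> 0) (at 0)" by (auto intro!: tendsto_eq_intros)
  qed
  then show ?thesis by (simp add: has_field_derivative_iff)
qed

text \<open>Take the \<open>n\<close>-th power of \<open>x <= exp x\<close> at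
  \<open>x = 1 / (h * n)\<close> with \<open>n = p + 2\<close>: two powers of \<open>h\<close>
  remain after division by \<open>h ^ p\<close>, just enough for the derivative at the origin to be
  \<open>0\<close>.\<close>

lemma ellp_bound: "\<bar>ellp p h\<bar> \<le> real (p + 2) ^ (p + 2) * h\<^sup>2"
proof (cases "h \<le> 0")
  case False
  define n where "n = p + 2"
  have h: "h > 0" using False by simp
  have "(1 / h / n) ^ n \<le> exp (1 / h / n) ^ n"
    by (intro power_mono order_trans[OF _ exp_ge_add_one_self]) (use h in auto)
  also have "\<dots> = exp (1 / h)" by (rule exp_divide_power_eq) (simp add: n_def)
  finally have "1 / (h ^ n * real n ^ n) \<le> exp (1 / h)"
    by (simp add: power_divide power_mult_distrib)
  moreover have "h ^ n * real n ^ n > 0" using h by (simp add: n_def)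
  ultimately have *: "1 \<le> exp (1 / h) * (h ^ n * real n ^ n)" by (simp add: divide_le_eq)
  have "exp (- 1 / h) / h ^ p = 1 / (exp (1 / h) * h ^ p)"
    by (simp add: exp_minus divide_inverse)
  also have "\<dots> \<le> real n ^ n * h\<^sup>2"
    using * h by (simp add: divide_le_eq n_def power_add mult_ac power2_eq_square)
  finally show ?thesis using h by (simp add: ellp_def n_def)
qed (simp add: ellp_def)

lemma DERIV_ellp: "(ellp p has_real_derivative (ellp (p + 2) t + (- real p) * ellp (p + 1) t)) (at t)"
proof -
  consider "t < 0" | "t = 0" | "t > 0" by linarith
  then show ?thesis
  proof cases
    case 1
    have "(ellp p has_real_derivative 0) (at t)"
      by (rule has_field_derivative_transform_within_open[where S = "{..<0}" and f = "\<lambda>_. 0"])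
        (use 1 in \<open>auto simp: ellp_def\<close>)
    then show ?thesis using 1 by (simp add: ellp_def)
  next
    case 2
    have "(ellp p has_real_derivative 0) (at 0)"
      by (rule DERIV_zero_quadratic[OF always_eventually[OF allI[OF ellp_bound]]])
    then show ?thesis using 2 by (simp add: ellp_def)
  next
    case 3
    have "((\<lambda>s. exp (- inverse s) * inverse s ^ p) has_real_derivative
        (exp (- inverse t) * (inverse t * inverse t)) * inverse t ^ p +
        (real p * inverse t ^ (p - 1) * - (inverse t * inverse t)) * exp (- inverse t)) (at t)"
      using 3 by (auto intro!: derivative_eq_intros simp: power2_eq_square)
    also have "(exp (- inverse t) * (inverse t * inverse t)) * inverse t ^ p +
        (real p * inverse t ^ (p - 1) * - (inverse t * inverse t)) * exp (- inverse t) =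
        ellp (p + 2) t + (- real p) * ellp (p + 1) t"
      using 3 by (cases p) (auto simp: ellp_def divide_inverse power_inverse algebra_simps)
    finally show ?thesis
      by (rule has_field_derivative_transform_within_open[where S = "{0<..}"])
        (use 3 in \<open>auto simp: ellp_def divide_inverse power_inverse\<close>)
  qed
qed

lemma Ck_ellp: "Ck n U k f \<Longrightarrow> Ck n U k (\<lambda>x. ellp p (f x))"
proof (induction k arbitrary: p)
  case 0
  have "continuous_on UNIV (ellp p)"
    using DERIV_ellp DERIV_isCont continuous_at_imp_continuous_on by blast
  then show ?case using 0 by (auto intro: continuous_on_compose2)
next
  case (Suc k)
  have "Ck n U k (\<lambda>x. ellp (p + 2) (f x) + (- real p) * ellp (p + 1) (f x))"
    by (intro Ck_add Ck_mult Ck_const Suc.IH Ck_le_Suc[OF Suc.prems])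
  then show ?case by (intro Ck_comp_Suc[OF Suc.prems DERIV_ellp])
qed

lemma smooth_ell: "domain n U \<Longrightarrow> smooth_fun n U f \<Longrightarrow> smooth_fun n U (\<lambda>x. ell (f x))"
  by (simp add: smooth_fun_iff_Ck Ck_ellp ell_eq_ellp)

lemma ell_nonneg: "ell t \<ge> 0" and ell_pos_iff: "ell t > 0 \<longleftrightarrow> t > 0" and ell_less_one: "ell t < 1"
  and ell_nonpos: "t \<le> 0 \<Longrightarrow> ell t = 0"
  by (auto simp: ell_def)

lemma continuous_ell: "continuous_on A ell"
  by (rule continuous_at_imp_continuous_on)
    (use DERIV_ellp[of 0] in \<open>auto simp: ell_eq_ellp intro: DERIV_isCont\<close>)

section \<open>The transition functions \<open>lam\<close> and \<open>phi\<close>\<close>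

definition kap :: "real \<Rightarrow> real" where
  "kap x = ell (3 * x) * ell (3 - 3 * x)"

lemma kap_nonneg: "kap x \<ge> 0" and kap_zero: "x \<le> 0 \<or> x \<ge> 1 \<Longrightarrow> kap x = 0"
  and kap_pos: "0 < x \<Longrightarrow> x < 1 \<Longrightarrow> kap x > 0" and kap_sym: "kap (1 - x) = kap x"
  by (auto simp: kap_def ell_nonneg ell_nonpos ell_pos_iff algebra_simps)

lemma continuous_kap: "continuous_on A kap"
proof -
  have "continuous_on A (\<lambda>x. ell (3 * x) * ell (3 - 3 * x))"
    by (intro continuous_intros continuous_on_compose2[OF continuous_ell[of UNIV]]) auto
  then show ?thesis by (simp add: kap_def[abs_def])
qed

lemma DERIV_integral_from_zero:
  assumes "continuous_on UNIV g" "\<And>t. t \<le> 0 \<Longrightarrow> g t = 0"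
  shows "((\<lambda>t. integral {0..t} g) has_real_derivative g t) (at t)"
proof -
  \<comment> \<open>The base point of the integral is moved to a negative \<open>a\<close> below
    \<open>t\<close>, so that \<open>t\<close> is an interior point of \<open>{a..b}\<close> even
    for \<open>t <= 0\<close>; the integral does not change because \<open>g\<close> vanishes
    there.\<close>
  define a b where "a = min (t - 1) (-1)" and "b = t + 1"
  have cont: "continuous_on {a..b} g" using assms continuous_on_subset by blast
  have eq: "integral {a..s} g = integral {0..s} g" for s
  proof (cases "s \<ge> 0")
    case True
    have "integral {a..0} g + integral {0..s} g = integral {a..s} g"
      using True assms by (intro Henstock_Kurzweil_Integration.integral_combine integrable_continuous_interval)
        (auto simp: a_def intro: continuous_on_subset)
    moreover have "integral {a..0} g = integral {a..0} (\<lambda>_. 0)"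
      by (rule integral_cong) (use assms in auto)
    ultimately show ?thesis by simp
  next
    case False
    then have "integral {a..s} g = integral {a..s} (\<lambda>_. 0)"
      by (intro integral_cong) (use assms in auto)
    then show ?thesis using False by simp
  qed
  have "((\<lambda>s. integral {a..s} g) has_real_derivative g t) (at t within {a..b})"
    by (rule integral_has_real_derivative[OF cont]) (auto simp: a_def b_def)
  moreover have "at t within {a..b} = at t"
    by (rule at_within_Icc_at) (auto simp: a_def b_def)
  ultimately show ?thesis by (simp only: eq)
qed

definition Kap :: "real \<Rightarrow> real" where
  "Kap t = integral {0..t} kap"

lemma DERIV_Kap: "(Kap has_real_derivative kap t) (at t)"
  unfolding Kap_def by (rule DERIV_integral_from_zero[OF continuous_kap]) (simp add: kap_zero)

lemma Kap_nonpos: "t \<le> 0 \<Longrightarrow> Kap t = 0"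
  by (cases "t = 0") (simp_all add: Kap_def)

lemma alpha0_eq: "alpha0 = Kap 1"
  by (simp add: alpha0_def Kap_def kap_def[abs_def])

lemma alpha0_pos: "alpha0 > 0"
proof -
  have "Kap 0 < Kap 1"
  proof (rule DERIV_pos_imp_increasing_open[of 0 1 Kap])
    show "\<exists>y. (Kap has_real_derivative y) (at x) \<and> y > 0" if "0 < x" "x < 1" for x
      using DERIV_Kap[of x] kap_pos[OF that] by blast
    show "continuous_on {0..1} Kap"
      using DERIV_Kap DERIV_isCont continuous_at_imp_continuous_on by blast
  qed simp
  then show ?thesis by (simp add: alpha0_eq Kap_nonpos)
qed

lemma lam_eq: "lam t = Kap t / alpha0"
  by (simp add: lam_def Kap_def kap_def[abs_def])

lemma DERIV_lam: "(lam has_real_derivative kap t / alpha0) (at t)"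
proof -
  have "((\<lambda>t. Kap t / alpha0) has_real_derivative kap t / alpha0) (at t)"
    by (intro DERIV_cdivide DERIV_Kap)
  then show ?thesis by (simp add: lam_eq[abs_def])
qed

lemma continuous_lam: "continuous_on A lam"
  using DERIV_lam DERIV_isCont continuous_at_imp_continuous_on by blast

lemma lam_mono: "s \<le> t \<Longrightarrow> lam s \<le> lam t"
proof (rule DERIV_nonneg_imp_nondecreasing[of s t lam])
  show "\<exists>y. (lam has_real_derivative y) (at x) \<and> y \<ge> 0" for x
    using DERIV_lam[of x] kap_nonneg[of x] alpha0_pos by (intro exI[of _ "kap x / alpha0"]) simp
qed

lemma lam_zero: "t \<le> 0 \<Longrightarrow> lam t = 0"
  by (simp add: lam_eq Kap_nonpos)

lemma lam_one: "t \<ge> 1 \<Longrightarrow> lam t = 1"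
proof -
  have "lam t = lam 1" if "t > 1"
  proof (rule DERIV_isconst_end[OF that])
    show "continuous_on {1..t} lam" by (rule continuous_lam)
    show "(lam has_real_derivative 0) (at x)" if "1 < x" for x
      using DERIV_lam[of x] kap_zero[of x] that by simp
  qed
  moreover have "lam 1 = 1" using alpha0_pos by (simp add: lam_eq alpha0_eq)
  ultimately show "t \<ge> 1 \<Longrightarrow> lam t = 1" by (cases "t = 1") auto
qed

lemma lam_bounds: "0 \<le> lam t" "lam t \<le> 1"
  using lam_mono[of "min 0 t" t] lam_mono[of t "max 1 t"] lam_zero[of "min 0 t"] lam_one[of "max 1 t"]
  by auto

text \<open>\<open>kap\<close> is symmetric about \<open>1/2\<close>, so the sum has derivative
  \<open>0\<close>; its value is read off at \<open>t = 0\<close>.\<close>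

lemma lam_sym: "lam t + lam (1 - t) = 1"
proof -
  have "\<forall>x. ((\<lambda>t. lam t + lam (1 - t)) has_real_derivative 0) (at x)"
  proof
    fix x
    have "((\<lambda>t. lam (1 - t)) has_real_derivative kap (1 - x) / alpha0 * (-1)) (at x)"
      by (rule DERIV_chain2[OF DERIV_lam]) (auto intro!: derivative_eq_intros)
    from DERIV_add[OF DERIV_lam this]
    show "((\<lambda>t. lam t + lam (1 - t)) has_real_derivative 0) (at x)" by (simp add: kap_sym)
  qed
  from DERIV_isconst_all[OF this, of t 0] show ?thesis by (simp add: lam_zero lam_one)
qed

lemma DERIV_phi: "(phi has_real_derivative lam (1/2 + t)) (at t)"
proof -
  have "((\<lambda>s. integral {0..s} lam) has_real_derivative lam (1/2 + t)) (at (1/2 + t))"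
    by (rule DERIV_integral_from_zero[OF continuous_lam lam_zero])
  then have "((\<lambda>t. integral {0..1/2 + t} lam) has_real_derivative lam (1/2 + t) * 1) (at t)"
    by (rule DERIV_chain2) (auto intro!: derivative_eq_intros)
  then show ?thesis by (simp add: phi_def[abs_def])
qed

lemma continuous_phi: "continuous_on A phi"
  using DERIV_phi DERIV_isCont continuous_at_imp_continuous_on by blast

lemma phi_mono: "s \<le> t \<Longrightarrow> phi s \<le> phi t"
proof (rule DERIV_nonneg_imp_nondecreasing[of s t phi])
  show "\<exists>y. (phi has_real_derivative y) (at x) \<and> y \<ge> 0" for x
    using DERIV_phi[of x] lam_bounds(1) by blast
qed

lemma phi_zero: "t \<le> - 1/2 \<Longrightarrow> phi t = 0"
  by (cases "t = - 1/2") (auto simp: phi_def)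

lemma phi_nonneg: "phi t \<ge> 0"
  using phi_mono[of "min t (- 1/2)" t] phi_zero[of "min t (- 1/2)"] by simp

lemma phi_sym: "phi t = t + phi (- t)"
proof -
  have "\<forall>x. ((\<lambda>t. phi t - phi (- t) - t) has_real_derivative 0) (at x)"
  proof
    fix x
    have "((\<lambda>t. phi (- t)) has_real_derivative lam (1/2 + - x) * (-1)) (at x)"
      by (rule DERIV_chain2[OF DERIV_phi]) (auto intro!: derivative_eq_intros)
    from DERIV_diff[OF DERIV_diff[OF DERIV_phi this] DERIV_ident]
    show "((\<lambda>t. phi t - phi (- t) - t) has_real_derivative 0) (at x)"
      using lam_sym[of "1/2 + x"] by simp
  qed
  from DERIV_isconst_all[OF this, of t 0] show ?thesis by simp
qed

text \<open>Geometrically, for \<open>|u| + |v| <= 3/2\<close> the condition defining the fat disk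
  reduces to \<open>|v| <= 1\<close>.\<close>

lemma phi_ident: "t \<ge> 1/2 \<Longrightarrow> phi t = t"
  using phi_sym[of t] phi_zero[of "- t"] by simp

lemma Ck_lam: "Ck n U k f \<Longrightarrow> Ck n U k (\<lambda>x. lam (f x))"
proof (cases k)
  case 0
  then show "Ck n U k f \<Longrightarrow> ?thesis" using continuous_lam by (auto intro: continuous_on_compose2)
next
  case (Suc l)
  assume f: "Ck n U k f"
  then have fl: "Ck n U l f" using Suc Ck_le_Suc by blast
  have "Ck n U l (\<lambda>x. (ellp 0 (3 * f x) * ellp 0 (3 + (- 3) * f x)) * inverse alpha0)"
    by (intro Ck_mult Ck_add Ck_const Ck_ellp fl)
  then have "Ck n U l (\<lambda>x. kap (f x) / alpha0)"
    by (simp add: kap_def ell_eq_ellp divide_inverse)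
  then show ?thesis unfolding Suc by (rule Ck_comp_Suc[OF f[unfolded Suc] DERIV_lam])
qed

lemma smooth_lam: "domain n U \<Longrightarrow> smooth_fun n U f \<Longrightarrow> smooth_fun n U (\<lambda>x. lam (f x))"
  by (simp add: smooth_fun_iff_Ck Ck_lam)

lemma smooth_phi:
  assumes U: "domain n U" and f: "smooth_fun n U f"
  shows "smooth_fun n U (\<lambda>x. phi (f x))"
  unfolding smooth_fun_iff_Ck[OF U]
proof
  fix k
  have f: "Ck n U k f" for k using U f by (simp add: smooth_fun_iff_Ck)
  show "Ck n U k (\<lambda>x. phi (f x))"
  proof (cases k)
    case 0
    then show ?thesis using f[of 0] continuous_phi by (auto intro: continuous_on_compose2)
  next
    case (Suc l)
    have "Ck n U l (\<lambda>x. lam (1/2 + f x))" by (intro Ck_lam Ck_add Ck_const f)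
    then show ?thesis unfolding Suc by (rule Ck_comp_Suc[OF f DERIV_phi])
  qed
qed

subsection \<open>The D-topology of the fat disk\<close>

lemma continuous_on_vecI:
  fixes F :: "vec \<Rightarrow> vec"
  assumes "\<And>i. i < N \<Longrightarrow> continuous_on A (\<lambda>x. F x i)" "F ` A \<subseteq> Rn N"
  shows "continuous_on A F"
proof (rule continuous_on_coordinatewise_then_product)
  fix i
  show "continuous_on A (\<lambda>x. F x i)"
  proof (cases "i < N")
    case False
    then have "F x i = 0" if "x \<in> A" for x using assms(2) that by (auto simp: Rn_def)
    then show ?thesis by (simp cong: continuous_on_cong)
  qed (use assms in auto)
qed

lemma smooth_map_continuous: "smooth_map n U k F \<Longrightarrow> continuous_on U F"
  by (intro continuous_on_vecI[of k]) (auto simp: smooth_map_def intro: smooth_imp_continuous)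

lemma smooth_map_preimage:
  assumes "domain n U" "smooth_map n U k F" "domain k V"
  shows "domain n {x\<in>U. F x \<in> V}"
proof (rule domain_openin[OF assms(1)])
  have "openin (top_of_set U) (U \<inter> F -` V)"
    by (rule continuous_openin_preimage[OF smooth_map_continuous[OF assms(2)]])
      (use assms in \<open>auto simp: smooth_map_def domain_def\<close>)
  then show "openin (top_of_set U) {x\<in>U. F x \<in> V}" by (simp add: vimage_def Int_def)
qed

lemma esub_subset:
  "(k, U, Q) \<in> esub N A \<Longrightarrow> domain k V \<Longrightarrow> V \<subseteq> U \<Longrightarrow> Q ` V \<subseteq> B \<Longrightarrow> (k, V, Q) \<in> esub N B"
  by (auto simp: esub_def smooth_map_def intro: smooth_subset)

text \<open>Smoothness for the subset diffeology of \<open>A\<close> in \<open>R^N\<close>: only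
  compositions with plots count, and nothing is said about an extension to a neighbourhood of
  \<open>A\<close>.\<close>

definition dfun :: "nat \<Rightarrow> vec set \<Rightarrow> (vec \<Rightarrow> real) \<Rightarrow> bool" where
  "dfun N A f \<longleftrightarrow> (\<forall>k U Q. (k, U, Q) \<in> esub N A \<longrightarrow> smooth_fun k U (\<lambda>x. f (Q x)))"

lemma dfunD: "dfun N A f \<Longrightarrow> (k, U, Q) \<in> esub N A \<Longrightarrow> smooth_fun k U (\<lambda>x. f (Q x))"
  by (simp add: dfun_def)

lemma esubD:
  assumes "(k, U, Q) \<in> esub N A"
  shows "domain k U" "smooth_map k U N Q" "Q ` U \<subseteq> A"
  using assms by (simp_all add: esub_def)

lemma smooth_imp_dfun:
  assumes "domain N V" "smooth_fun N V f"
  shows "dfun N V f"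
  unfolding dfun_def
proof (intro allI impI)
  fix k U Q assume "(k, U, Q) \<in> esub N V"
  note Q = esubD[OF this]
  show "smooth_fun k U (\<lambda>x. f (Q x))"
    by (rule smooth_compose[OF Q(1) assms(1) _ assms(2)]) (use Q in \<open>auto simp: smooth_map_def\<close>)
qed

lemma dfun_subset: "dfun N A f \<Longrightarrow> B \<subseteq> A \<Longrightarrow> dfun N B f"
  unfolding dfun_def esub_def by auto

lemma dfun_diff:
  assumes "dfun N A f" "dfun N A g"
  shows "dfun N A (\<lambda>x. f x - g x)"
  unfolding dfun_def
proof (intro allI impI)
  fix k U Q assume Q: "(k, U, Q) \<in> esub N A"
  show "smooth_fun k U (\<lambda>x. f (Q x) - g (Q x))"
    by (rule smooth_diff[OF esubD(1)[OF Q] dfunD[OF assms(1) Q] dfunD[OF assms(2) Q]])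
qed

text \<open>Permits different formulas on overlapping relatively open pieces: a plot pulls the
  pieces back to an open cover of its domain.\<close>

lemma dfun_local:
  assumes "\<And>y. y \<in> A \<Longrightarrow> \<exists>V g. y \<in> V \<and> domain N V \<and> dfun N (A \<inter> V) g \<and> (\<forall>z\<in>A \<inter> V. f z = g z)"
  shows "dfun N A f"
  unfolding dfun_def
proof (intro allI impI)
  fix k U Q assume Q: "(k, U, Q) \<in> esub N A"
  have U: "domain k U" and sQ: "smooth_map k U N Q" and QA: "Q ` U \<subseteq> A" by (rule esubD[OF Q])+
  show "smooth_fun k U (\<lambda>x. f (Q x))"
  proof (rule smooth_local[OF U])
    fix x assume x: "x \<in> U"
    obtain V g where V: "Q x \<in> V" "domain N V" "dfun N (A \<inter> V) g" "\<forall>z\<in>A \<inter> V. f z = g z"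
      using assms[OF subsetD[OF QA imageI[OF x]]] by blast
    define U' where "U' = {x\<in>U. Q x \<in> V}"
    have U': "domain k U'" unfolding U'_def by (rule smooth_map_preimage[OF U sQ V(2)])
    have "(k, U', Q) \<in> esub N (A \<inter> V)"
      by (rule esub_subset[OF Q U']) (use QA in \<open>auto simp: U'_def\<close>)
    then have "smooth_fun k U' (\<lambda>x. g (Q x))" by (rule dfunD[OF V(3)])
    then have "smooth_fun k U' (\<lambda>x. f (Q x))"
      by (rule smooth_cong[OF U', rotated]) (use V(4) QA in \<open>auto simp: U'_def\<close>)
    then show "\<exists>V. x \<in> V \<and> domain k V \<and> smooth_fun k V (\<lambda>x. f (Q x))"
      using U' x V(1) by (intro exI[of _ U']) (simp add: U'_def)
  qed
qed

section \<open>Norms, rescaling and the defining function of the fat disk\<close>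

lemma unorm_nonneg: "unorm n x \<ge> 0" and vnorm_nonneg: "vnorm n m x \<ge> 0"
  by (auto simp: unorm_def vnorm_def intro!: sum_nonneg)

lemma continuous_unorm: "continuous_on A (unorm n)"
  unfolding unorm_def[abs_def] by (intro continuous_intros continuous_coord)

lemma continuous_vnorm: "continuous_on A (vnorm n m)"
  unfolding vnorm_def[abs_def] by (intro continuous_intros continuous_coord)

lemma smooth_unorm: "domain N U \<Longrightarrow> (\<And>x. x \<in> U \<Longrightarrow> unorm n x > 0) \<Longrightarrow> smooth_fun N U (unorm n)"
  unfolding unorm_def[abs_def]
  by (intro smooth_sqrt smooth_sum smooth_power smooth_coord) auto

lemma smooth_vnorm: "domain N U \<Longrightarrow> (\<And>x. x \<in> U \<Longrightarrow> vnorm n m x > 0) \<Longrightarrow> smooth_fun N U (vnorm n m)"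
  unfolding vnorm_def[abs_def]
  by (intro smooth_sqrt smooth_sum smooth_power smooth_coord) auto

text \<open>The value \<open>0\<close> from index \<open>n + m\<close> on discards any further
  coordinates of \<open>z\<close>, so that points carrying an additional coordinate are also sent
  into \<open>Rn (n + m)\<close>.\<close>

definition scl :: "nat \<Rightarrow> nat \<Rightarrow> real \<Rightarrow> real \<Rightarrow> vec \<Rightarrow> vec" where
  "scl n m a b z = (\<lambda>i. if i < n then a * z i else if i < n + m then b * z i else 0)"

lemma scl_Rn: "scl n m a b z \<in> Rn (n + m)"
  by (simp add: scl_def Rn_def)

lemma unorm_scl: "unorm n (scl n m a b z) = \<bar>a\<bar> * unorm n z"
proof -
  have "(\<Sum>i<n. (scl n m a b z i)\<^sup>2) = a\<^sup>2 * (\<Sum>i<n. (z i)\<^sup>2)"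
    by (simp add: scl_def power_mult_distrib sum_distrib_left)
  then show ?thesis by (simp add: unorm_def real_sqrt_mult)
qed

lemma vnorm_scl: "vnorm n m (scl n m a b z) = \<bar>b\<bar> * vnorm n m z"
proof -
  have "(\<Sum>i\<in>{n..<n+m}. (scl n m a b z i)\<^sup>2) = b\<^sup>2 * (\<Sum>i\<in>{n..<n+m}. (z i)\<^sup>2)"
    by (simp add: scl_def power_mult_distrib sum_distrib_left)
  then show ?thesis by (simp add: vnorm_def real_sqrt_mult)
qed

lemma scl_scl: "scl n m a b (scl n m c d z) = scl n m (a * c) (b * d) z"
  by (auto simp: scl_def)

lemma scl_one: "z \<in> Rn (n + m) \<Longrightarrow> scl n m 1 1 z = z"
  by (auto simp: scl_def Rn_def fun_eq_iff)

lemma smooth_scl: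
  assumes "domain N U" "smooth_fun N U a" "smooth_fun N U b"
  shows "smooth_map N U (n + m) (\<lambda>x. scl n m (a x) (b x) x)"
  unfolding smooth_map_def
proof (intro conjI allI impI)
  show "(\<lambda>x. scl n m (a x) (b x) x) ` U \<subseteq> Rn (n + m)" using scl_Rn by auto
  fix i assume "i < n + m"
  then show "smooth_fun N U (\<lambda>x. scl n m (a x) (b x) x i)"
    by (cases "i < n") (auto simp: scl_def intro!: smooth_mult smooth_coord assms)
qed

lemma continuous_scl:
  assumes "continuous_on A a" "continuous_on A b"
  shows "continuous_on A (\<lambda>x. scl n m (a x) (b x) x)"
proof (rule continuous_on_vecI)
  show "(\<lambda>x. scl n m (a x) (b x) x) ` A \<subseteq> Rn (n + m)" using scl_Rn by auto
  fix i assume "i < n + m"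
  then show "continuous_on A (\<lambda>x. scl n m (a x) (b x) x i)"
    by (cases "i < n") (auto simp: scl_def intro!: continuous_intros continuous_coord assms)
qed

definition gfat :: "nat \<Rightarrow> nat \<Rightarrow> vec \<Rightarrow> real" where
  "gfat n m x = unorm n x - 1 + phi (2 - unorm n x - vnorm n m x)"

lemma fat_disk_eq: "fat_disk n m = {x \<in> Rn (n + m). gfat n m x \<ge> 0}"
  by (auto simp: fat_disk_def gfat_def)

lemma fat_disk_subset: "fat_disk n m \<subseteq> Rn (n + m)"
  by (auto simp: fat_disk_def)

lemma fat_sphere_subset: "fat_sphere n m \<subseteq> fat_disk n m"
proof -
  have "1 - phi (2 - unorm n x - vnorm n m x) \<le> 1" for x using phi_nonneg by simp
  then show ?thesis unfolding fat_sphere_def fat_disk_def by (auto intro: order_trans[of _ 1])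
qed

text \<open>The constant is \<open>2 + 1/2\<close>: from there on the argument of \<open>phi\<close>
  is at most \<open>- 1/2\<close>, so \<open>phi\<close> vanishes and the disk condition becomes
  \<open>|u| >= 1\<close>.\<close>

lemma fat_disk_bounded:
  assumes "x \<in> fat_disk n m" "unorm n x < 1"
  shows "unorm n x + vnorm n m x < 5/2"
proof (rule ccontr)
  assume "\<not> ?thesis"
  then have "phi (2 - unorm n x - vnorm n m x) = 0" by (intro phi_zero) simp
  then show False using assms by (simp add: fat_disk_def)
qed

lemma continuous_gfat: "continuous_on A (gfat n m)"
  unfolding gfat_def[abs_def]
  by (intro continuous_intros continuous_unorm continuous_vnorm
    continuous_on_compose2[OF continuous_phi[of UNIV]]) auto

lemma smooth_gfat:
  assumes "domain N U" "\<And>x. x \<in> U \<Longrightarrow> unorm n x > 0" "\<And>x. x \<in> U \<Longrightarrow> vnorm n m x > 0"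
  shows "smooth_fun N U (gfat n m)"
  unfolding gfat_def[abs_def]
  by (intro smooth_add smooth_diff smooth_phi smooth_const smooth_unorm smooth_vnorm) (use assms in auto)

text \<open>Over \<open>T\<close> the set \<open>W\<close> is the preimage under \<open>s\<close> of
  the points that \<open>Q\<close> sends into \<open>W\<close>, and these form an open set because
  \<open>Q\<close> is a plot. Continuity of the section is enough to transfer openness.\<close>

lemma section_open:
  assumes W: "Dopen A (esub N A) W" and A: "A \<subseteq> Rn N" and T: "domain N T"
    and Q: "(N, V, Q) \<in> esub N A" and s: "continuous_on (A \<inter> T) s" "\<And>z. z \<in> A \<Longrightarrow> z \<in> T \<Longrightarrow> s z \<in> V"
    and Qs: "\<And>z. z \<in> A \<Longrightarrow> z \<in> T \<Longrightarrow> Q (s z) = z"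
  shows "openin (top_of_set A) (W \<inter> T)"
proof -
  have V: "V \<subseteq> Rn N" using Q domain_subset by (auto simp: esub_def)
  have WA: "W \<subseteq> A" using W by (simp add: Dopen_def)
  have "openin (top_of_set (Rn N)) {x\<in>V. Q x \<in> W}"
    using W Q by (auto simp: Dopen_def)
  then have "openin (top_of_set (A \<inter> T)) ((A \<inter> T) \<inter> s -` {x\<in>V. Q x \<in> W})"
    by (intro continuous_openin_preimage[OF s(1)]) (use s V in auto)
  moreover have "(A \<inter> T) \<inter> s -` {x\<in>V. Q x \<in> W} = W \<inter> T"
    using s Qs WA by auto
  moreover have "openin (top_of_set A) (A \<inter> T)"
  proof -
    obtain T0 where "open T0" "T = Rn N \<inter> T0" using T by (auto simp: domain_def openin_open)
    then show ?thesis using A by (auto simp: openin_open)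
  qed
  ultimately show ?thesis using openin_trans by metis
qed

lemma esub_incl:
  assumes "domain N V" "V \<subseteq> A"
  shows "(N, V, \<lambda>x. x) \<in> esub N A"
  using assms smooth_coord[OF assms(1)] domain_subset[OF assms(1)]
  by (auto simp: esub_def smooth_map_def)

lemma domain_pos: "continuous_on UNIV f \<Longrightarrow> domain n {x\<in>Rn n. 0 < (f x::real)}"
  by (rule domain_Collect_less[OF domain_Rn]) (auto intro: continuous_on_subset)

context
  fixes n m :: nat and W :: "vec set"
  assumes W: "Dopen (fat_disk n m) (esub (n + m) (fat_disk n m)) W"
begin

lemma Dopen_interior:
  assumes y: "y \<in> W" "gfat n m y > 0"
  shows "\<exists>T. domain (n + m) T \<and> y \<in> T \<and> openin (top_of_set (fat_disk n m)) (W \<inter> T)"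
proof -
  define T where "T = {x\<in>Rn (n + m). 0 < gfat n m x}"
  have T: "domain (n + m) T" unfolding T_def by (rule domain_pos[OF continuous_gfat])
  have "y \<in> T" using y W fat_disk_subset by (auto simp: T_def Dopen_def)
  moreover have "openin (top_of_set (fat_disk n m)) (W \<inter> T)"
    by (rule section_open[OF W fat_disk_subset T esub_incl[OF T], of "\<lambda>x. x"])
      (auto simp: T_def fat_disk_eq)
  ultimately show ?thesis using T by blast
qed

text \<open>In the coordinates \<open>q = 2 - |u| - |v|\<close> and \<open>|u|\<close> the fat disk is the
  epigraph \<open>|u| \<ge> 1 - \<phi>(q)\<close>, so squaring the height above the graph with \<open>q\<close> fixed is a plot;
  taking the square root of the height is a continuous section of it.\<close>

lemma Dopen_boundary:
  assumes y: "y \<in> W" "gfat n m y = 0" "unorm n y > 0" "vnorm n m y > 0"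
  shows "\<exists>T. domain (n + m) T \<and> y \<in> T \<and> openin (top_of_set (fat_disk n m)) (W \<inter> T)"
proof -
  let ?N = "n + m"
  define g where "g = gfat n m"
  \<comment> \<open>The factors turn \<open>|u|\<close> into \<open>|u| - g + p g\<close> and
    \<open>|v|\<close> into \<open>|v| + g - p g\<close>. This preserves \<open>|u| + |v|\<close>,
    hence the argument of \<open>phi\<close>, so that \<open>g\<close> becomes \<open>p g\<close>.
    With a parameter \<open>p\<close>, squaring and its inverse are treated at once.\<close>
  define a where "a p x = (unorm n x - g x + p (g x)) / unorm n x" for p :: "real \<Rightarrow> real" and x
  define b where "b p x = (vnorm n m x + g x - p (g x)) / vnorm n m x" for p :: "real \<Rightarrow> real" and x
  define Q where "Q p x = scl n m (a p x) (b p x) x" for p x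
  define V where "V p = {x\<in>Rn ?N. 0 < unorm n x} \<inter> {x\<in>Rn ?N. 0 < vnorm n m x} \<inter>
    {x\<in>Rn ?N. 0 < unorm n x - g x + p (g x)} \<inter> {x\<in>Rn ?N. 0 < vnorm n m x + g x - p (g x)}"
    for p :: "real \<Rightarrow> real"
  have cg: "continuous_on A g" for A unfolding g_def by (rule continuous_gfat)
  have domV: "domain ?N (V p)" if p: "continuous_on UNIV p" for p
    unfolding V_def
    by (intro domain_Int domain_pos continuous_intros continuous_unorm continuous_vnorm cg
      continuous_on_compose2[OF p]) auto
  have norms: "unorm n (Q p x) = unorm n x - g x + p (g x)"
      "vnorm n m (Q p x) = vnorm n m x + g x - p (g x)" if "x \<in> V p" for p x
    using that by (auto simp: Q_def unorm_scl vnorm_scl a_def b_def V_def)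
  have gQ: "g (Q p x) = p (g x)" if "x \<in> V p" for p x
  proof -
    have "2 - unorm n (Q p x) - vnorm n m (Q p x) = 2 - unorm n x - vnorm n m x"
      using norms[OF that] by simp
    then have "g (Q p x) = unorm n (Q p x) - 1 + phi (2 - unorm n x - vnorm n m x)"
      by (simp only: g_def gfat_def)
    also have "\<dots> = p (g x)" unfolding norms(1)[OF that] by (simp add: g_def gfat_def)
    finally show ?thesis .
  qed
  have QQ: "Q q (Q p x) = x" if x: "x \<in> V p" "q (p (g x)) = g x" for p q x
  proof -
    have pos: "0 < unorm n x" "0 < vnorm n m x" "0 < unorm n x - g x + p (g x)"
        "0 < vnorm n m x + g x - p (g x)"
      using x(1) by (auto simp: V_def)
    have "a q (Q p x) = unorm n x / (unorm n x - g x + p (g x))"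
      unfolding a_def norms[OF x(1)] gQ[OF x(1)] x(2) by simp
    moreover have "b q (Q p x) = vnorm n m x / (vnorm n m x + g x - p (g x))"
      unfolding b_def norms[OF x(1)] gQ[OF x(1)] x(2) by simp
    ultimately have "a q (Q p x) * a p x = 1" "b q (Q p x) * b p x = 1"
      using pos by (simp_all add: a_def[of p] b_def[of p])
    moreover have "x \<in> Rn ?N" using x by (simp add: V_def)
    moreover have "Q q (Q p x) = scl n m (a q (Q p x) * a p x) (b q (Q p x) * b p x) x"
      by (simp add: Q_def scl_scl)
    ultimately show ?thesis by (simp add: scl_one)
  qed
  define sq rt :: "real \<Rightarrow> real" where "sq w = w * w" and "rt w = sqrt \<bar>w\<bar>" for w
  have csq: "continuous_on UNIV sq" unfolding sq_def by (intro continuous_intros)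
  have crt: "continuous_on UNIV rt" unfolding rt_def by (intro continuous_intros)
  define VV T where "VV = V sq" and "T = V rt"
  have VV: "domain ?N VV" unfolding VV_def by (rule domV[OF csq])
  have T: "domain ?N T" unfolding T_def by (rule domV[OF crt])
  have sg: "smooth_fun ?N VV g" unfolding g_def by (rule smooth_gfat[OF VV]) (auto simp: VV_def V_def)
  have su: "smooth_fun ?N VV (unorm n)" by (rule smooth_unorm[OF VV]) (auto simp: VV_def V_def)
  have sv: "smooth_fun ?N VV (vnorm n m)" by (rule smooth_vnorm[OF VV]) (auto simp: VV_def V_def)
  have sa: "smooth_fun ?N VV (a sq)" unfolding a_def sq_def
    by (intro smooth_divide smooth_add smooth_diff smooth_mult VV sg su) (auto simp: VV_def V_def)
  have sb: "smooth_fun ?N VV (b sq)" unfolding b_def sq_def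
    by (intro smooth_divide smooth_add smooth_diff smooth_mult VV sg sv) (auto simp: VV_def V_def)
  have plot: "(?N, VV, Q sq) \<in> esub ?N (fat_disk n m)"
  proof -
    have "smooth_map ?N VV ?N (Q sq)" unfolding Q_def by (rule smooth_scl[OF VV sa sb])
    moreover have "Q sq x \<in> fat_disk n m" if "x \<in> VV" for x
      using gQ[of x sq] that scl_Rn by (auto simp: fat_disk_eq VV_def g_def sq_def Q_def)
    ultimately show ?thesis using VV by (auto simp: esub_def)
  qed
  have g0: "g z \<ge> 0" if "z \<in> fat_disk n m" for z using that by (simp add: g_def fat_disk_eq)
  have rs: "sq (rt (g z)) = g z" "rt (g z) = sqrt (g z)" if "z \<in> fat_disk n m" for z
    using g0[OF that] by (simp_all add: sq_def rt_def)
  have "openin (top_of_set (fat_disk n m)) (W \<inter> T)"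
  proof (rule section_open[OF W fat_disk_subset T plot])
    have "continuous_on T (Q rt)"
      unfolding Q_def
    proof (rule continuous_scl)
      show "continuous_on T (a rt)" unfolding a_def
        by (intro continuous_intros continuous_unorm cg continuous_on_compose2[OF crt])
          (auto simp: T_def V_def)
      show "continuous_on T (b rt)" unfolding b_def
        by (intro continuous_intros continuous_vnorm cg continuous_on_compose2[OF crt])
          (auto simp: T_def V_def)
    qed
    then show "continuous_on (fat_disk n m \<inter> T) (Q rt)" by (rule continuous_on_subset) auto
    fix z assume z: "z \<in> fat_disk n m" "z \<in> T"
    then have zV: "z \<in> V rt" by (simp add: T_def)
    show "Q rt z \<in> VV"
    proof -
      have "Q rt z \<in> Rn ?N" unfolding Q_def by (rule scl_Rn)
      then show ?thesis using norms[OF zV] gQ[OF zV] rs[OF z(1)] zV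
        by (simp add: VV_def V_def)
    qed
    show "Q sq (Q rt z) = z" by (rule QQ[OF zV]) (rule rs(1)[OF z(1)])
  qed
  moreover have "y \<in> T" using y W fat_disk_subset
    by (auto simp: T_def V_def Dopen_def g_def rt_def)
  ultimately show ?thesis using T by blast
qed

lemma Dopen_axis:
  assumes y: "y \<in> W" "gfat n m y = 0" "unorm n y = 0"
  shows "\<exists>T. domain (n + m) T \<and> y \<in> T \<and> openin (top_of_set (fat_disk n m)) (W \<inter> T)"
proof -
  let ?N = "n + m"
  have r: "vnorm n m y = 1"
  proof (cases "2 - vnorm n m y \<ge> 1/2")
    case True
    then show ?thesis using y phi_ident[OF True] by (simp add: gfat_def)
  next
    case False
    then have "phi (2 - vnorm n m y) \<le> phi (1/2)" by (intro phi_mono) simp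
    then show ?thesis using y phi_ident[of "1/2"] by (simp add: gfat_def)
  qed
  \<comment> \<open>\<open>1/4 + 5/4 = 3/2\<close> keeps the argument of \<open>phi\<close> above
    \<open>1/2\<close>, and \<open>3/4\<close> keeps \<open>|v|\<close> away from \<open>0\<close>
    and \<open>1 - |v|\<close> below \<open>1/4\<close>. In \<open>T\<close> the bound
    \<open>15/16\<close> gives \<open>sqrt (1 - |v|) < 1/4\<close>, so that the section takes values
    in \<open>V\<close>.\<close>
  define V where "V = {x\<in>Rn ?N. 0 < 1/4 - unorm n x} \<inter> {x\<in>Rn ?N. 0 < vnorm n m x - 3/4} \<inter>
    {x\<in>Rn ?N. 0 < 5/4 - vnorm n m x}"
  define T where "T = V \<inter> {x\<in>Rn ?N. 0 < vnorm n m x - 15/16}"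
  have V: "domain ?N V" unfolding V_def
    by (intro domain_Int domain_pos continuous_intros continuous_unorm continuous_vnorm)
  have T: "domain ?N T" unfolding T_def
    by (intro domain_Int V domain_pos continuous_intros continuous_unorm continuous_vnorm)
  have disk: "x \<in> fat_disk n m \<longleftrightarrow> vnorm n m x \<le> 1" if "x \<in> V" for x
    using that phi_ident[of "2 - unorm n x - vnorm n m x"] by (auto simp: fat_disk_eq gfat_def V_def)
  define b where "b p x = (1 - p (1 - vnorm n m x)) / vnorm n m x" for p :: "real \<Rightarrow> real" and x
  define Q where "Q p x = scl n m 1 (b p x) x" for p x
  define sq rt :: "real \<Rightarrow> real" where "sq w = w * w" and "rt w = sqrt w" for w
  have uQ: "unorm n (Q p x) = unorm n x" for p x by (simp add: Q_def unorm_scl)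
  have vQ: "vnorm n m (Q p x) = \<bar>1 - p (1 - vnorm n m x)\<bar>" if "x \<in> V" for p x
    using that by (simp add: Q_def vnorm_scl b_def V_def)
  have sv: "smooth_fun ?N V (vnorm n m)" by (rule smooth_vnorm[OF V]) (auto simp: V_def)
  have sb: "smooth_fun ?N V (b sq)" unfolding b_def sq_def
    by (intro smooth_divide smooth_add smooth_diff smooth_mult smooth_const V sv) (auto simp: V_def)
  have sqV: "sq (1 - vnorm n m x) \<le> 1/16" "sq (1 - vnorm n m x) \<ge> 0" if "x \<in> V" for x
  proof -
    have "0 < vnorm n m x - 3/4" "0 < 5/4 - vnorm n m x" using that by (simp_all add: V_def)
    then have "\<bar>1 - vnorm n m x\<bar> \<le> 1/4" by linarith
    then have "\<bar>1 - vnorm n m x\<bar> * \<bar>1 - vnorm n m x\<bar> \<le> 1/4 * (1/4)" by (intro mult_mono) auto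
    then show "sq (1 - vnorm n m x) \<le> 1/16" "sq (1 - vnorm n m x) \<ge> 0"
      by (simp_all add: sq_def abs_mult[symmetric])
  qed
  have plot: "(?N, V, Q sq) \<in> esub ?N (fat_disk n m)"
  proof -
    have "smooth_map ?N V ?N (Q sq)" unfolding Q_def
      by (rule smooth_scl[OF V smooth_const[OF V] sb])
    moreover have "Q sq x \<in> fat_disk n m" if x: "x \<in> V" for x
    proof -
      have "vnorm n m (Q sq x) = 1 - sq (1 - vnorm n m x)" using vQ[OF x] sqV[OF x] by simp
      then have "Q sq x \<in> V" using sqV[OF x] uQ x scl_Rn
        by (auto simp: V_def Q_def)
      then show ?thesis using disk sqV[OF x] vQ[OF x] by simp
    qed
    ultimately show ?thesis using V by (auto simp: esub_def)
  qed
  have "openin (top_of_set (fat_disk n m)) (W \<inter> T)"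
  proof (rule section_open[OF W fat_disk_subset T plot])
    have "continuous_on T (Q rt)"
      unfolding Q_def
    proof (rule continuous_scl)
      show "continuous_on T (b rt)" unfolding b_def rt_def
        by (intro continuous_intros continuous_vnorm) (auto simp: T_def V_def)
    qed (rule continuous_intros)
    then show "continuous_on (fat_disk n m \<inter> T) (Q rt)" by (rule continuous_on_subset) auto
    fix z assume z: "z \<in> fat_disk n m" "z \<in> T"
    then have zV: "z \<in> V" by (simp add: T_def)
    have v: "vnorm n m z \<le> 1" "vnorm n m z > 15/16" using disk[OF zV] z by (auto simp: T_def)
    have rt: "rt (1 - vnorm n m z) < 1/4" "rt (1 - vnorm n m z) \<ge> 0"
      "sq (rt (1 - vnorm n m z)) = 1 - vnorm n m z"
    proof -
      have "sqrt (1 - vnorm n m z) < sqrt (1/16)" using v by (intro real_sqrt_less_mono) simp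
      also have "sqrt (1/16) = 1/4" by (simp add: real_sqrt_divide)
      finally show "rt (1 - vnorm n m z) < 1/4" by (simp add: rt_def)
    qed (use v in \<open>auto simp: rt_def sq_def\<close>)
    have vz: "vnorm n m (Q rt z) = 1 - rt (1 - vnorm n m z)" using vQ[OF zV] rt by simp
    have "Q rt z \<in> Rn ?N" unfolding Q_def by (rule scl_Rn)
    then show inV: "Q rt z \<in> V" using zV rt vz by (simp add: V_def uQ)
    have "b sq (Q rt z) * b rt z = 1"
      using rt v vz by (simp add: b_def)
    moreover have "z \<in> Rn ?N" using zV by (simp add: V_def)
    moreover have "Q sq (Q rt z) = scl n m 1 (b sq (Q rt z) * b rt z) z"
      by (simp add: Q_def scl_scl)
    ultimately show "Q sq (Q rt z) = z" by (simp add: scl_one)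
  qed
  moreover have "y \<in> T" using y W fat_disk_subset r
    by (auto simp: T_def V_def Dopen_def)
  ultimately show ?thesis using T by blast
qed

lemma Dopen_imp_openin: "openin (top_of_set (fat_disk n m)) W"
proof (subst openin_subopen, intro ballI)
  fix y assume y: "y \<in> W"
  then have yD: "y \<in> fat_disk n m" using W by (auto simp: Dopen_def)
  have "\<exists>T. domain (n + m) T \<and> y \<in> T \<and> openin (top_of_set (fat_disk n m)) (W \<inter> T)"
  proof (cases "gfat n m y = 0")
    case True
    \<comment> \<open>No boundary point has \<open>v = 0\<close>: there \<open>gfat\<close> equals
      \<open>1\<close> if \<open>|u| <= 1\<close>, and is at least \<open>|u| - 1\<close>
      otherwise.\<close>
    have "vnorm n m y > 0"
    proof (rule ccontr)
      assume "\<not> vnorm n m y > 0"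
      then have v: "vnorm n m y = 0" using vnorm_nonneg[of n m y] by simp
      show False
      proof (cases "unorm n y \<le> 1")
        case u: True
        then show False using True v phi_ident[of "2 - unorm n y"] by (simp add: gfat_def)
      next
        case False
        then show False using True v phi_nonneg[of "2 - unorm n y"] by (simp add: gfat_def)
      qed
    qed
    then show ?thesis
      using Dopen_boundary[OF y True] Dopen_axis[OF y True] unorm_nonneg[of n y]
      by (cases "unorm n y = 0") auto
  next
    case False
    then have "gfat n m y > 0" using yD by (simp add: fat_disk_eq)
    then show ?thesis by (rule Dopen_interior[OF y])
  qed
  then show "\<exists>T. openin (top_of_set (fat_disk n m)) T \<and> y \<in> T \<and> T \<subseteq> W"
    using y by blast
qed

end

text \<open>Smoothness along plots makes preimages of open sets D-open, and in the fat disk D-open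
  sets are open.\<close>

lemma dfun_continuous:
  assumes "dfun (n + m) (fat_disk n m) f"
  shows "continuous_on (fat_disk n m) f"
  unfolding continuous_on_open_invariant
proof (intro allI impI)
  fix B :: "real set" assume B: "open B"
  have "Dopen (fat_disk n m) (esub (n + m) (fat_disk n m)) {y\<in>fat_disk n m. f y \<in> B}"
    unfolding Dopen_def
  proof (intro conjI allI impI)
    fix k U Q assume Q: "(k, U, Q) \<in> esub (n + m) (fat_disk n m)"
    have "domain k {x\<in>U. f (Q x) \<in> B}"
      by (rule domain_Collect[OF esubD(1)[OF Q] _ B])
        (rule smooth_imp_continuous[OF dfunD[OF assms Q]])
    moreover have "{x\<in>U. f (Q x) \<in> B} = {x\<in>U. Q x \<in> {y\<in>fat_disk n m. f y \<in> B}}"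
      using esubD(3)[OF Q] by auto
    ultimately show "openin (top_of_set (Rn k)) {x\<in>U. Q x \<in> {y\<in>fat_disk n m. f y \<in> B}}"
      by (simp add: domain_def)
  qed auto
  from Dopen_imp_openin[OF this] obtain T where "open T" "{y\<in>fat_disk n m. f y \<in> B} = fat_disk n m \<inter> T"
    by (auto simp: openin_open)
  then show "\<exists>T. open T \<and> T \<inter> fat_disk n m = f -` B \<inter> fat_disk n m"
    by (intro exI[of _ T]) auto
qed

section \<open>Closed and compact subsets of \<open>R^N\<close>\<close>

lemma closed_Rn: "closed (Rn N)"
proof -
  have "Rn N = (\<Inter>i\<in>{N..}. {x. x i = 0})" by (auto simp: Rn_def)
  moreover have "closed {x::vec. x i = 0}" for i
    by (intro closed_Collect_eq continuous_coord continuous_on_const)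
  ultimately show ?thesis by (simp add: closed_INT)
qed

lemma closed_fat_disk: "closed (fat_disk n m)"
proof -
  have "fat_disk n m = Rn (n + m) \<inter> {x. 0 \<le> gfat n m x}" by (auto simp: fat_disk_eq)
  moreover have "closed {x. 0 \<le> gfat n m x}"
    by (intro closed_Collect_le continuous_gfat continuous_on_const)
  ultimately show ?thesis by (simp add: closed_Int closed_Rn)
qed

text \<open>Tychonoff's theorem for the product of intervals \<open>{-B..B}\<close> and, from index
  \<open>N\<close> on, of the one-point sets \<open>{0}\<close>.\<close>

lemma compact_vec:
  assumes "closed K" "K \<subseteq> Rn N" "\<And>x i. x \<in> K \<Longrightarrow> i < N \<Longrightarrow> \<bar>x i\<bar> \<le> B"
  shows "compact K"
proof -
  define S where "S i = (if i < N then {-B..B} else {0::real})" for i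
  have "compactin (product_topology (\<lambda>i. euclidean) UNIV) (PiE UNIV S)"
    unfolding compactin_PiE by (auto simp: S_def)
  then have "compact (PiE UNIV S)"
    by (simp add: euclidean_product_topology)
  moreover have "K \<subseteq> PiE UNIV S"
  proof
    fix x assume x: "x \<in> K"
    have "x i \<in> S i" for i
      using x assms(2) assms(3)[OF x, of i] by (auto simp: S_def Rn_def abs_le_iff)
    then show "x \<in> PiE UNIV S" by auto
  qed
  ultimately show ?thesis using assms(1) by (metis compact_Int_closed inf.absorb_iff2)
qed

lemma coord_le_unorm: "i < n \<Longrightarrow> \<bar>x i\<bar> \<le> unorm n x"
  unfolding unorm_def by (rule real_le_rsqrt) (auto intro: member_le_sum)

lemma coord_le_vnorm: "n \<le> i \<Longrightarrow> i < n + m \<Longrightarrow> \<bar>x i\<bar> \<le> vnorm n m x"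
  unfolding vnorm_def by (rule real_le_rsqrt) (auto intro: member_le_sum)

subsection \<open>Flat functions\<close>

text \<open>Coordinate \<open>N\<close> is a free normal variable, playing the role of
  \<open>t\<close> or of \<open>tau\<close>, over a domain \<open>Z\<close> of parameters.\<close>

definition cyl :: "nat \<Rightarrow> vec set \<Rightarrow> vec set" where
  "cyl N Z = {x \<in> Rn (Suc N). x(N := 0) \<in> Z}"

lemma cyl_upd: "x \<in> cyl N Z \<Longrightarrow> x(N := s) \<in> cyl N Z"
  by (auto simp: cyl_def Rn_def)

lemma cyl_zero: "domain N Z \<Longrightarrow> z \<in> Z \<Longrightarrow> z \<in> cyl N Z"
proof -
  assume "domain N Z" "z \<in> Z"
  then have "z \<in> Rn N" using domain_subset by blast
  then have "z(N := 0) = z" "z \<in> Rn (Suc N)" by (auto simp: Rn_def)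
  then show ?thesis using \<open>z \<in> Z\<close> by (simp add: cyl_def)
qed

lemma cyl_drop: "x \<in> cyl N Z \<Longrightarrow> x(N := 0) \<in> Z"
  by (simp add: cyl_def)

lemma domain_cyl:
  assumes "domain N Z"
  shows "domain (Suc N) (cyl N Z)"
  unfolding domain_def openin_Rn_iff[OF order_refl]
proof (intro conjI ballI)
  show "cyl N Z \<subseteq> Rn (Suc N)" by (auto simp: cyl_def)
  fix x assume x: "x \<in> cyl N Z"
  obtain d where d: "d > 0" "\<And>y. y \<in> Rn N \<Longrightarrow> near N (x(N := 0)) d y \<Longrightarrow> y \<in> Z"
    using domain_near[OF assms cyl_drop[OF x]] by blast
  have "y \<in> cyl N Z" if "y \<in> Rn (Suc N)" "near (Suc N) x d y" for y
  proof -
    have "y(N := 0) \<in> Rn N" using that by (auto simp: Rn_def)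
    moreover have "near N (x(N := 0)) d (y(N := 0))" using that by (auto simp: near_def)
    ultimately show ?thesis using d that by (simp add: cyl_def)
  qed
  then show "\<exists>d>0. \<forall>y\<in>Rn (Suc N). near (Suc N) x d y \<longrightarrow> y \<in> cyl N Z" using d(1) by blast
qed

text \<open>Vanishing to infinite order, one-sided and locally uniform in the parameter. Only values
  of \<open>R\<close> are estimated; for smooth \<open>R\<close> the derivatives follow in
  \<open>flat_pd\<close>. As \<open>near N\<close> leaves coordinate \<open>N\<close> free, its
  range is bounded separately.\<close>

definition flat :: "nat \<Rightarrow> vec set \<Rightarrow> (vec \<Rightarrow> real) \<Rightarrow> bool" where
  "flat N Z R \<longleftrightarrow> (\<forall>z\<in>Z. \<forall>k. \<exists>d>0. \<exists>C. \<forall>x\<in>cyl N Z. near N z d x \<longrightarrow> 0 < x N \<longrightarrow> x N < d \<longrightarrow>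
     \<bar>R x\<bar> \<le> C * x N ^ k)"

lemma flatE:
  assumes "flat N Z R" "z \<in> Z"
  obtains d C where "d > 0" "C \<ge> 0"
    "\<And>x. x \<in> cyl N Z \<Longrightarrow> near N z d x \<Longrightarrow> 0 < x N \<Longrightarrow> x N < d \<Longrightarrow> \<bar>R x\<bar> \<le> C * x N ^ k"
proof -
  obtain d C where d: "d > 0" "\<And>x. x \<in> cyl N Z \<Longrightarrow> near N z d x \<Longrightarrow> 0 < x N \<Longrightarrow> x N < d \<Longrightarrow> \<bar>R x\<bar> \<le> C * x N ^ k"
    using assms unfolding flat_def by blast
  have "\<bar>R x\<bar> \<le> max C 0 * x N ^ k" if "x \<in> cyl N Z" "near N z d x" "0 < x N" "x N < d" for x
    using that(3) by (intro order_trans[OF d(2)[OF that] mult_right_mono]) auto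
  then show ?thesis using that[of d "max C 0"] d(1) by auto
qed

text \<open>This combination is the numerator that appears when
  \<open>R (sqrt tau) / sqrt tau ^ p\<close> is differentiated with respect to
  \<open>tau\<close>.\<close>

lemma flat_combination:
  assumes "flat N Z R" "flat N Z S"
  shows "flat N Z (\<lambda>x. (x N * S x - p * R x) / 2)"
  unfolding flat_def
proof (intro ballI allI)
  fix z and k :: nat assume z: "z \<in> Z"
  obtain d C where d: "d > 0" "C \<ge> 0"
    "\<And>x. x \<in> cyl N Z \<Longrightarrow> near N z d x \<Longrightarrow> 0 < x N \<Longrightarrow> x N < d \<Longrightarrow> \<bar>R x\<bar> \<le> C * x N ^ k"
    using flatE[OF assms(1) z] by blast
  obtain e B where e: "e > 0" "B \<ge> 0"
    "\<And>x. x \<in> cyl N Z \<Longrightarrow> near N z e x \<Longrightarrow> 0 < x N \<Longrightarrow> x N < e \<Longrightarrow> \<bar>S x\<bar> \<le> B * x N ^ k"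
    using flatE[OF assms(2) z] by blast
  define d' where "d' = min 1 (min d e)"
  have "\<bar>(x N * S x - p * R x) / 2\<bar> \<le> (B + \<bar>p\<bar> * C) * x N ^ k"
    if x: "x \<in> cyl N Z" "near N z d' x" "0 < x N" "x N < d'" for x
  proof -
    have R: "\<bar>R x\<bar> \<le> C * x N ^ k" using x d(3)[of x] near_mono[OF x(2), of d] by (auto simp: d'_def)
    have S: "\<bar>S x\<bar> \<le> B * x N ^ k" using x e(3)[of x] near_mono[OF x(2), of e] by (auto simp: d'_def)
    have "\<bar>x N * S x\<bar> \<le> 1 * \<bar>S x\<bar>" unfolding abs_mult using x by (intro mult_right_mono) (auto simp: d'_def)
    then have 1: "\<bar>x N * S x\<bar> \<le> B * x N ^ k" using S by linarith
    have 2: "\<bar>p * R x\<bar> \<le> \<bar>p\<bar> * (C * x N ^ k)" unfolding abs_mult using R by (intro mult_left_mono) auto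
    have "\<bar>(x N * S x - p * R x) / 2\<bar> \<le> \<bar>x N * S x - p * R x\<bar>" by simp
    also have "\<dots> \<le> \<bar>x N * S x\<bar> + \<bar>p * R x\<bar>" by (rule abs_triangle_ineq4)
    finally show ?thesis using 1 2 by (simp add: algebra_simps)
  qed
  moreover have "d' > 0" using d e by (simp add: d'_def)
  ultimately show "\<exists>d>0. \<exists>C. \<forall>x\<in>cyl N Z. near N z d x \<longrightarrow> 0 < x N \<longrightarrow> x N < d \<longrightarrow>
     \<bar>(x N * S x - p * R x) / 2\<bar> \<le> C * x N ^ k" by blast
qed

text \<open>The mean value theorem is used twice: \<open>f'\<close> at some \<open>s\<close> equals
  the difference quotient of \<open>f\<close>, and \<open>f' 0\<close> differs from it by at most
  \<open>M * h\<close>.\<close>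

lemma interpolation:
  fixes f f' f'' :: "real \<Rightarrow> real"
  assumes h: "h > 0"
    and f: "\<And>s. 0 \<le> s \<Longrightarrow> s \<le> h \<Longrightarrow> (f has_real_derivative f' s) (at s)"
    and f': "\<And>s. 0 \<le> s \<Longrightarrow> s \<le> h \<Longrightarrow> (f' has_real_derivative f'' s) (at s)"
    and b: "\<And>s. 0 \<le> s \<Longrightarrow> s \<le> h \<Longrightarrow> \<bar>f'' s\<bar> \<le> M"
  shows "\<bar>f' 0\<bar> \<le> \<bar>f h - f 0\<bar> / h + M * h"
proof -
  obtain s where s: "0 < s" "s < h" "f h - f 0 = (h - 0) * f' s"
    using MVT2[OF h, of f f'] f by blast
  obtain r where r: "0 < r" "r < s" "f' s - f' 0 = (s - 0) * f'' r"
    using MVT2[OF s(1), of f' f''] f' s by force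
  have "\<bar>f' s - f' 0\<bar> = s * \<bar>f'' r\<bar>" using r s by (simp add: abs_mult)
  also have "\<dots> \<le> h * M" using b[of r] r s by (intro mult_mono) auto
  finally have "\<bar>f' 0\<bar> \<le> \<bar>f' s\<bar> + M * h" by (simp add: mult.commute)
  moreover have "\<bar>f' s\<bar> = \<bar>f h - f 0\<bar> / h" using s h by (simp add: abs_mult)
  ultimately show ?thesis by simp
qed

text \<open>Bounding a first derivative by the function and its second derivative in the same direction
  shows that partial derivatives of flat functions are flat without any Taylor expansion or
  symmetry of mixed partial derivatives.\<close>

lemma flat_pd:
  assumes Z: "domain N Z" and R: "smooth_fun (Suc N) (cyl N Z) R" and fl: "flat N Z R"
    and i: "i < Suc N"
  shows "flat N Z (pd i R)"
  unfolding flat_def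
proof (intro ballI allI)
  fix z and k :: nat assume z: "z \<in> Z"
  \<comment> \<open>The step length will be \<open>h = t ^ (k + 1)\<close> with
    \<open>t = x N\<close>. Then \<open>t ^ K = h * h\<close>, so the difference quotient is of
    order \<open>h\<close>, like the second derivative term, and \<open>h <= t ^ k\<close>.\<close>
  define K where "K = 2 * (k + 1)"
  obtain d C where d: "d > 0" "C \<ge> 0"
    "\<And>x. x \<in> cyl N Z \<Longrightarrow> near N z d x \<Longrightarrow> 0 < x N \<Longrightarrow> x N < d \<Longrightarrow> \<bar>R x\<bar> \<le> C * x N ^ K"
    using flatE[OF fl z] by blast
  have zc: "z \<in> cyl N Z" by (rule cyl_zero[OF Z z])
  have zN: "z N = 0" using z domain_subset[OF Z] by (auto simp: Rn_def)
  have D: "domain (Suc N) (cyl N Z)" by (rule domain_cyl[OF Z])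
  have c2: "continuous_on (cyl N Z) (iter_pd [i, i] R)"
    by (rule smooth_fun_continuous[OF R]) (use i in auto)
  define M where "M = \<bar>iter_pd [i, i] R z\<bar> + 1"
  obtain d2 where d2: "d2 > 0" "\<And>y. y \<in> cyl N Z \<Longrightarrow> near (Suc N) z d2 y \<Longrightarrow> \<bar>iter_pd [i, i] R y\<bar> \<le> M"
  proof -
    obtain d2 where "d2 > 0" "\<forall>y\<in>cyl N Z. near (Suc N) z d2 y \<longrightarrow> \<bar>iter_pd [i, i] R y - iter_pd [i, i] R z\<bar> < 1"
      using c2 zc unfolding continuous_on_Rn_iff[OF domain_subset[OF D]] by (meson zero_less_one)
    then show ?thesis using that[of d2] unfolding M_def by fastforce
  qed
  obtain d3 where d3: "d3 > 0" "\<And>y. y \<in> Rn (Suc N) \<Longrightarrow> near (Suc N) z d3 y \<Longrightarrow> y \<in> cyl N Z"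
    using domain_near[OF D zc] by blast
  \<comment> \<open>Half of the available radius, because a point is moved by up to
    \<open>h <= t < \<delta>\<close> along the \<open>i\<close>-th axis.\<close>
  define \<delta> where "\<delta> = min (min d d2) (min d3 1) / 2"
  have \<delta>: "\<delta> > 0" "2 * \<delta> \<le> d" "2 * \<delta> \<le> d2" "2 * \<delta> \<le> d3" "\<delta> < 1"
    using d d2 d3 by (auto simp: \<delta>_def)
  have "\<bar>pd i R x\<bar> \<le> (2 * C * 2 ^ K + M) * x N ^ k"
    if x: "x \<in> cyl N Z" "near N z \<delta> x" "0 < x N" "x N < \<delta>" for x
  proof -
    define t where "t = x N"
    define h where "h = t ^ (k + 1)"
    have t: "0 < t" "t < \<delta>" "t < 1" using x \<delta> by (auto simp: t_def)
    have h: "0 < h" "h \<le> t" "h \<le> t ^ k"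
    proof -
      show "h \<le> t" using t power_decreasing[of 1 "k + 1" t] by (simp add: h_def)
      show "h \<le> t ^ k" using t power_decreasing[of k "k + 1" t] by (simp add: h_def)
    qed (use t in \<open>simp add: h_def\<close>)
    have slice: "x(i := x i + s) \<in> cyl N Z \<and> near (Suc N) z (2 * \<delta>) (x(i := x i + s))"
      if s: "0 \<le> s" "s \<le> h" for s
    proof -
      have "near (Suc N) z (2 * \<delta>) (x(i := x i + s))"
        unfolding near_def
      proof (intro allI impI)
        fix j assume j: "j < Suc N"
        have "\<bar>x j - z j\<bar> < \<delta>"
        proof (cases "j = N")
          case True then show ?thesis using x zN by simp
        next
          case False then show ?thesis using x(2) j by (simp add: near_def)
        qed
        then show "\<bar>(x(i := x i + s)) j - z j\<bar> < 2 * \<delta>" using s h t by auto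
      qed
      moreover have "x(i := x i + s) \<in> Rn (Suc N)" using x(1) i by (auto simp: cyl_def Rn_def)
      ultimately show ?thesis using d3(2) near_mono \<delta> by blast
    qed
    define y where "y s = x(i := x i + s)" for s
    have yupd: "(y s)(i := y s i + r) = y (s + r)" for s r by (simp add: y_def add.assoc)
    have der: "((\<lambda>s. iter_pd is R (y s)) has_real_derivative iter_pd (i # is) R (y s)) (at s)"
      if "0 \<le> s" "s \<le> h" "set is \<subseteq> {..<Suc N}" for s "is"
    proof -
      have "has_pd (iter_pd is R) i (y s) (iter_pd (i # is) R (y s))"
        by (rule smooth_fun_has_pd[OF R that(3) i]) (use slice that in \<open>simp add: y_def\<close>)
      then have "((\<lambda>r. iter_pd is R (y (s + r))) has_real_derivative iter_pd (i # is) R (y s)) (at 0)"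
        by (simp add: has_pd_def yupd)
      then show ?thesis
        using DERIV_shift[of "\<lambda>s. iter_pd is R (y s)" "iter_pd (i # is) R (y s)" 0 s]
        by (simp add: add.commute)
    qed
    have I: "\<bar>iter_pd [i] R (y 0)\<bar> \<le> \<bar>R (y h) - R (y 0)\<bar> / h + M * h"
    proof (rule interpolation[where f'' = "\<lambda>s. iter_pd [i, i] R (y s)"])
      show "\<bar>iter_pd [i, i] R (y s)\<bar> \<le> M" if "0 \<le> s" "s \<le> h" for s
        by (rule d2(2)) (use slice[OF that] near_mono[of "Suc N" z _ _ d2] \<delta> in \<open>auto simp: y_def\<close>)
      show "((\<lambda>s. R (y s)) has_real_derivative iter_pd [i] R (y s)) (at s)" if "0 \<le> s" "s \<le> h" for s
        using der[OF that, of "[]"] by simp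
      show "((\<lambda>s. iter_pd [i] R (y s)) has_real_derivative iter_pd [i, i] R (y s)) (at s)"
        if "0 \<le> s" "s \<le> h" for s
        by (rule der[OF that]) (use i in auto)
    qed (rule h)
    \<comment> \<open>The factor \<open>2\<close> is for \<open>i = N\<close>: the step then
      increases coordinate \<open>N\<close> itself, to at most
      \<open>t + h <= 2 * t\<close>.\<close>
    have Ry: "\<bar>R (y s)\<bar> \<le> C * (2 * t) ^ K" if s: "s = 0 \<or> s = h" for s
    proof -
      have sl: "y s \<in> cyl N Z" "near (Suc N) z d (y s)"
        using slice[of s] s h near_mono[of "Suc N" z "2 * \<delta>" _ d] \<delta> by (auto simp: y_def)
      have "0 < y s N" "y s N \<le> 2 * t" using s h t by (auto simp: y_def t_def)
      moreover have "near N z d (y s)" using sl(2) by (simp add: near_def)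
      ultimately have "\<bar>R (y s)\<bar> \<le> C * (y s N) ^ K" using d(3) sl t \<delta> by force
      also have "\<dots> \<le> C * (2 * t) ^ K"
        using d(2) \<open>0 < y s N\<close> \<open>y s N \<le> 2 * t\<close> by (intro mult_left_mono power_mono) auto
      finally show ?thesis .
    qed
    have "\<bar>R (y h) - R (y 0)\<bar> / h \<le> 2 * (C * (2 * t) ^ K) / h"
      using Ry[of h] Ry[of 0] h by (intro divide_right_mono) auto
    also have "\<dots> = 2 * C * 2 ^ K * h"
    proof -
      have "t ^ K = h * h" by (simp add: h_def K_def power_add[symmetric] mult_2)
      then show ?thesis using h by (simp add: power_mult_distrib)
    qed
    finally have 1: "\<bar>R (y h) - R (y 0)\<bar> / h \<le> 2 * C * 2 ^ K * h" .
    then have "\<bar>pd i R x\<bar> \<le> 2 * C * 2 ^ K * h + M * h" using I by (simp add: y_def)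
    also have "\<dots> = (2 * C * 2 ^ K + M) * h" by (simp add: algebra_simps)
    also have "\<dots> \<le> (2 * C * 2 ^ K + M) * t ^ k"
      using h d(2) by (intro mult_left_mono) (auto simp: M_def)
    finally show ?thesis by (simp add: t_def)
  qed
  then show "\<exists>d>0. \<exists>C. \<forall>x\<in>cyl N Z. near N z d x \<longrightarrow> 0 < x N \<longrightarrow> x N < d \<longrightarrow> \<bar>pd i R x\<bar> \<le> C * x N ^ k"
    using \<delta>(1) by blast
qed


text \<open>Admitting the powers of the root in the denominator makes this family of functions closed
  under partial derivatives.\<close>

definition root_quot :: "nat \<Rightarrow> nat \<Rightarrow> (vec \<Rightarrow> real) \<Rightarrow> vec \<Rightarrow> real" where
  "root_quot N p R x = (if 0 < x N then R (x(N := sqrt (x N))) / sqrt (x N) ^ p else 0)"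

text \<open>Flatness is used to order \<open>p + 2 * k\<close>: \<open>p\<close> powers of the root
  cancel the denominator, and the other \<open>2 * k\<close> are \<open>k\<close> powers of
  coordinate \<open>N\<close>.\<close>

lemma root_quot_bound:
  assumes Z: "domain N Z" and fl: "flat N Z R" and x: "x \<in> cyl N Z" "x N = 0"
  obtains d C where "d > 0" "C \<ge> 0"
    "\<And>y. y \<in> Rn (Suc N) \<Longrightarrow> near (Suc N) x d y \<Longrightarrow> \<bar>root_quot N p R y\<bar> \<le> C * \<bar>y N\<bar> ^ k"
proof -
  define z where "z = x(N := 0)"
  have z: "z \<in> Z" unfolding z_def by (rule cyl_drop[OF x(1)])
  obtain d C where d: "d > 0" "C \<ge> 0"
    "\<And>x. x \<in> cyl N Z \<Longrightarrow> near N z d x \<Longrightarrow> 0 < x N \<Longrightarrow> x N < d \<Longrightarrow> \<bar>R x\<bar> \<le> C * x N ^ (p + 2 * k)"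
    using flatE[OF fl z] by blast
  obtain d1 where d1: "d1 > 0" "\<And>y. y \<in> Rn (Suc N) \<Longrightarrow> near (Suc N) x d1 y \<Longrightarrow> y \<in> cyl N Z"
    using domain_near[OF domain_cyl[OF Z] x(1)] by blast
  \<comment> \<open>The bound \<open>d * d\<close> ensures \<open>s < d\<close> for
    \<open>s = sqrt (y N)\<close>.\<close>
  define e where "e = min d1 (min d (d * d))"
  have e: "e > 0" "e \<le> d1" "e \<le> d" "e \<le> d * d" using d d1 by (auto simp: e_def)
  have "\<bar>root_quot N p R y\<bar> \<le> C * \<bar>y N\<bar> ^ k" if y: "y \<in> Rn (Suc N)" "near (Suc N) x e y" for y
  proof (cases "0 < y N")
    case True
    define s where "s = sqrt (y N)"
    have yc: "y \<in> cyl N Z" by (rule d1(2)[OF y(1) near_mono[OF y(2) e(2)]])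
    have s: "s > 0" "s * s = y N" using True by (auto simp: s_def)
    have "y N < e" using y(2) x(2) True by (auto simp: near_def)
    then have "s * s < d * d" using s e by simp
    then have sd: "s < d" using d(1) s(1) by (meson less_imp_le mult_mono not_le)
    have "\<bar>R (y(N := s))\<bar> \<le> C * (y(N := s)) N ^ (p + 2 * k)"
      by (rule d(3)) (use yc cyl_upd s sd near_mono[OF y(2) e(3)] in \<open>auto simp: near_def z_def\<close>)
    then have "\<bar>R (y(N := s))\<bar> / s ^ p \<le> C * s ^ (p + 2 * k) / s ^ p"
      using s by (intro divide_right_mono) auto
    also have "\<dots> = C * (s * s) ^ k" using s by (simp add: power_add power_mult power2_eq_square)
    finally show ?thesis using True s by (simp add: root_quot_def s_def[symmetric] abs_divide)
  qed (use d in \<open>auto simp: root_quot_def\<close>)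
  then show ?thesis using that e(1) d(2) by blast
qed

lemma smooth_root_quot_pos:
  assumes Z: "domain N Z" and R: "smooth_fun (Suc N) (cyl N Z) R"
  shows "domain (Suc N) {x\<in>cyl N Z. 0 < x N}"
    "smooth_fun (Suc N) {x\<in>cyl N Z. 0 < x N} (root_quot N p R)"
proof -
  let ?A = "{x\<in>cyl N Z. 0 < x N}"
  show A: "domain (Suc N) ?A"
    by (rule domain_Collect_less[OF domain_cyl[OF Z]]) (auto intro: continuous_coord)
  have sq: "smooth_fun (Suc N) ?A (\<lambda>x. sqrt (x N))"
    by (rule smooth_sqrt[OF A smooth_coord[OF A]]) auto
  have "smooth_fun (Suc N) ?A (\<lambda>x. R (x(N := sqrt (x N))))"
  proof (rule smooth_compose[OF A domain_cyl[OF Z] _ R])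
    show "x(N := sqrt (x N)) \<in> cyl N Z" if "x \<in> ?A" for x using that cyl_upd by blast
    fix j
    show "smooth_fun (Suc N) ?A (\<lambda>x. (x(N := sqrt (x N))) j)"
      using sq smooth_coord[OF A] by (cases "j = N") auto
  qed
  from smooth_divide[OF A this smooth_power[OF A sq]]
  have "smooth_fun (Suc N) ?A (\<lambda>x. R (x(N := sqrt (x N))) / sqrt (x N) ^ p)" by simp
  then show "smooth_fun (Suc N) ?A (root_quot N p R)"
    by (rule smooth_cong[OF A, rotated]) (simp add: root_quot_def)
qed

lemma continuous_root_quot:
  assumes Z: "domain N Z" and R: "smooth_fun (Suc N) (cyl N Z) R" and fl: "flat N Z R"
  shows "continuous_on (cyl N Z) (root_quot N p R)"
  unfolding continuous_on_Rn_iff[OF domain_subset[OF domain_cyl[OF Z]]]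
proof (intro ballI allI impI)
  fix x e assume x: "x \<in> cyl N Z" and e: "(e::real) > 0"
  let ?f = "root_quot N p R"
  let ?A = "{x\<in>cyl N Z. 0 < x N}"
  have cR: "cyl N Z \<subseteq> Rn (Suc N)" by (auto simp: cyl_def)
  consider "x N > 0" | "x N < 0" | "x N = 0" by linarith
  then show "\<exists>d>0. \<forall>y\<in>cyl N Z. near (Suc N) x d y \<longrightarrow> \<bar>?f y - ?f x\<bar> < e"
  proof cases
    case 1
    note A = smooth_root_quot_pos[OF Z R]
    have xA: "x \<in> ?A" using 1 x by simp
    obtain d where d: "d > 0" "\<forall>y\<in>?A. near (Suc N) x d y \<longrightarrow> \<bar>?f y - ?f x\<bar> < e"
      using smooth_imp_continuous[OF A(2)] xA e
      unfolding continuous_on_Rn_iff[OF domain_subset[OF A(1)]] by blast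
    have "\<bar>?f y - ?f x\<bar> < e" if "y \<in> cyl N Z" "near (Suc N) x (min d (x N)) y" for y
    proof -
      have "y N > 0" using that(2) by (auto simp: near_def)
      then show ?thesis using d(2) near_mono[OF that(2), of d] that(1) by auto
    qed
    then show ?thesis using d(1) 1 by (intro exI[of _ "min d (x N)"]) auto
  next
    case 2
    have "\<bar>?f y - ?f x\<bar> < e" if "y \<in> cyl N Z" "near (Suc N) x (- x N) y" for y
    proof -
      have "y N < 0" using that(2) by (auto simp: near_def)
      then show ?thesis using 2 e by (simp add: root_quot_def)
    qed
    then show ?thesis using 2 by (intro exI[of _ "- x N"]) auto
  next
    case 3
    obtain d C where d: "d > 0" "C \<ge> 0"
      "\<And>y. y \<in> Rn (Suc N) \<Longrightarrow> near (Suc N) x d y \<Longrightarrow> \<bar>?f y\<bar> \<le> C * \<bar>y N\<bar> ^ 1"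
      using root_quot_bound[OF Z fl x 3, where k = 1] by blast
    define d' where "d' = min d (e / (C + 1))"
    have "\<bar>?f y - ?f x\<bar> < e" if y: "y \<in> cyl N Z" "near (Suc N) x d' y" for y
    proof -
      have "\<bar>y N\<bar> < e / (C + 1)" using y(2) 3 by (auto simp: near_def d'_def)
      then have "\<bar>y N\<bar> * (C + 1) < e" using d(2) by (simp add: pos_less_divide_eq)
      moreover have "\<bar>?f y\<bar> \<le> C * \<bar>y N\<bar>"
        using d(3)[of y] y cR near_mono[OF y(2), of d] by (auto simp: d'_def)
      moreover have "?f x = 0" using 3 by (simp add: root_quot_def)
      ultimately show ?thesis by (simp add: algebra_simps)
    qed
    moreover have "d' > 0" using d e by (simp add: d'_def)
    ultimately show ?thesis by blast
  qed
qed

lemma root_quot_algebra: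
  fixes t a b :: real
  assumes "t > 0"
  shows "(a * (inverse t / 2) * t ^ p - b * (real p * t ^ (p - 1) * (inverse t / 2))) / (t ^ p * t ^ p)
    = (t * a - real p * b) / 2 / t ^ (p + 2)"
proof (cases p)
  case 0
  then show ?thesis using assms by (simp add: field_simps power2_eq_square)
next
  case (Suc q)
  define s where "s = t ^ q"
  have "s > 0" using assms by (simp add: s_def)
  moreover have "t ^ p = t * s" "t ^ (p - 1) = s" "t ^ (p + 2) = t * t * t * s"
    by (simp_all add: Suc s_def)
  ultimately show ?thesis using assms by (simp add: field_simps)
qed

text \<open>In direction \<open>N\<close> the quotient rule, with \<open>1 / (2 * sqrt tau)\<close>
  as derivative of the root, raises the exponent by \<open>2\<close> and leaves a numerator that is
  again smooth and flat. At \<open>tau = 0\<close> the derivative is \<open>0\<close> by the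
  quadratic bound that flatness gives.\<close>

lemma has_pd_root_quot:
  assumes Z: "domain N Z" and R: "smooth_fun (Suc N) (cyl N Z) R" and fl: "flat N Z R"
    and x: "x \<in> cyl N Z"
  shows "i < N \<Longrightarrow> has_pd (root_quot N p R) i x (root_quot N p (pd i R) x)"
    "has_pd (root_quot N p R) N x (root_quot N (p + 2) (\<lambda>x. (x N * pd N R x - p * R x) / 2) x)"
proof -
  assume i: "i < N"
  show "has_pd (root_quot N p R) i x (root_quot N p (pd i R) x)"
  proof (cases "x N > 0")
    case True
    have "has_pd R i (x(N := sqrt (x N))) (pd i R (x(N := sqrt (x N))))"
      using smooth_fun_has_pd[OF R, of "[]" i] i cyl_upd[OF x] by simp
    then have "((\<lambda>h. R (x(i := x i + h, N := sqrt (x N)))) has_real_derivative pd i R (x(N := sqrt (x N)))) (at 0)"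
      using i by (simp add: has_pd_def fun_upd_twist)
    from DERIV_cdivide[OF this, of "sqrt (x N) ^ p"]
    show ?thesis using True i by (simp add: has_pd_def root_quot_def)
  next
    case False
    then have "root_quot N p R (x(i := x i + h)) = 0" for h using i by (simp add: root_quot_def)
    then show ?thesis using False by (simp add: has_pd_def root_quot_def)
  qed
next
  let ?R' = "\<lambda>x. (x N * pd N R x - p * R x) / 2"
  consider "x N > 0" | "x N < 0" | "x N = 0" by linarith
  then show "has_pd (root_quot N p R) N x (root_quot N (p + 2) ?R' x)"
  proof cases
    case 1
    define t where "t = sqrt (x N)"
    have t: "t > 0" "t * t = x N" using 1 by (auto simp: t_def)
    define y where "y = x(N := t)"
    have "has_pd R N y (pd N R y)"
      using smooth_fun_has_pd[OF R, of "[]" N] cyl_upd[OF x] by (simp add: y_def)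
    then have "((\<lambda>s. R (x(N := s))) has_real_derivative pd N R y) (at (sqrt (x N)))"
      using has_pd_DERIV[of R N y] by (simp add: y_def t_def)
    from DERIV_chain2[OF this DERIV_real_sqrt[OF 1]]
    have d1: "((\<lambda>s. R (x(N := sqrt s))) has_real_derivative pd N R y * (inverse t / 2)) (at (x N))"
      by (simp add: t_def)
    have d2: "((\<lambda>s. sqrt s ^ p) has_real_derivative real p * t ^ (p - 1) * (inverse t / 2)) (at (x N))"
      using 1 by (auto intro!: derivative_eq_intros simp: t_def)
    have "((\<lambda>s. R (x(N := sqrt s)) / sqrt s ^ p) has_real_derivative
        (pd N R y * (inverse t / 2) * t ^ p - R y * (real p * t ^ (p - 1) * (inverse t / 2))) / (t ^ p * t ^ p)) (at (x N))"
      using DERIV_divide[OF d1 d2] t(1) by (simp add: t_def y_def)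
    moreover have "(pd N R y * (inverse t / 2) * t ^ p - R y * (real p * t ^ (p - 1) * (inverse t / 2))) / (t ^ p * t ^ p)
        = root_quot N (p + 2) ?R' x"
      using 1 root_quot_algebra[OF t(1), of "pd N R y" p "R y"]
      by (simp add: root_quot_def t_def[symmetric] y_def[symmetric]) (simp add: y_def)
    ultimately have "((\<lambda>s. R (x(N := sqrt s)) / sqrt s ^ p) has_real_derivative root_quot N (p + 2) ?R' x) (at (x N))"
      by simp
    then have "((\<lambda>s. root_quot N p R (x(N := s))) has_real_derivative root_quot N (p + 2) ?R' x) (at (x N))"
      by (rule has_field_derivative_transform_within_open[where S = "{0<..}"])
        (use 1 in \<open>auto simp: root_quot_def\<close>)
    then show ?thesis by (rule DERIV_has_pd)
  next
    case 2
    have "((\<lambda>s. root_quot N p R (x(N := s))) has_real_derivative 0) (at (x N))"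
      by (rule has_field_derivative_transform_within_open[where S = "{..<0}" and f = "\<lambda>_. 0"])
        (use 2 in \<open>auto simp: root_quot_def\<close>)
    then have "has_pd (root_quot N p R) N x 0" by (rule DERIV_has_pd)
    then show ?thesis using 2 by (simp add: root_quot_def)
  next
    case 3
    obtain d C where d: "d > 0" "C \<ge> 0"
      "\<And>y. y \<in> Rn (Suc N) \<Longrightarrow> near (Suc N) x d y \<Longrightarrow> \<bar>root_quot N p R y\<bar> \<le> C * \<bar>y N\<bar> ^ 2"
      using root_quot_bound[OF Z fl x 3, where k = 2] by blast
    have "\<bar>root_quot N p R (x(N := x N + h))\<bar> \<le> C * h\<^sup>2" if "dist h 0 < d" for h
      using d(3)[of "x(N := x N + h)"] that 3 x d(1) by (auto simp: near_def cyl_def Rn_def)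
    then have "\<forall>\<^sub>F h in nhds 0. \<bar>root_quot N p R (x(N := x N + h))\<bar> \<le> C * h\<^sup>2"
      using d(1) unfolding eventually_nhds_metric by blast
    then have "has_pd (root_quot N p R) N x 0"
      unfolding has_pd_def by (rule DERIV_zero_quadratic)
    then show ?thesis using 3 by (simp add: root_quot_def)
  qed
qed

text \<open>A derivative changes both the exponent and the numerator, so the induction on the order
  runs over all exponents and all smooth flat numerators, although only exponent \<open>0\<close> is
  wanted.\<close>

lemma smooth_root:
  assumes Z: "domain N Z" and R: "smooth_fun (Suc N) (cyl N Z) R" and fl: "flat N Z R"
  shows "smooth_fun (Suc N) (cyl N Z) (root_quot N 0 R)"
proof -
  note D = domain_cyl[OF Z]
  have sp: "smooth_fun (Suc N) (cyl N Z) (pd i S)" if "smooth_fun (Suc N) (cyl N Z) S" "i < Suc N" for i S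
    using smooth_iter_pd[OF that(1), of "[i]"] that(2) by simp
  have "Ck (Suc N) (cyl N Z) k (root_quot N p S)"
    if "smooth_fun (Suc N) (cyl N Z) S" "flat N Z S" for k p S
    using that
  proof (induction k arbitrary: p S)
    case 0
    then show ?case by (simp add: continuous_root_quot[OF Z])
  next
    case (Suc k)
    note S = Suc.prems
    let ?S' = "\<lambda>x. (x N * pd N S x - real p * S x) / 2"
    have s': "smooth_fun (Suc N) (cyl N Z) ?S'"
      by (rule smooth_divide[OF D smooth_diff[OF D smooth_mult[OF D smooth_coord[OF D] sp[OF S(1)]]
            smooth_mult[OF D smooth_const[OF D] S(1)]] smooth_const[OF D]]) auto
    have f': "flat N Z ?S'" by (rule flat_combination[OF S(2) flat_pd[OF Z S]]) simp
    show ?case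
    proof (rule Ck_SucI[where D = "\<lambda>i. if i = N then root_quot N (p + 2) ?S' else root_quot N p (pd i S)"])
      show "continuous_on (cyl N Z) (root_quot N p S)" by (rule continuous_root_quot[OF Z S])
      fix i assume i: "i < Suc N"
      show "has_pd (root_quot N p S) i x ((if i = N then root_quot N (p + 2) ?S' else root_quot N p (pd i S)) x)"
        if "x \<in> cyl N Z" for x
        using has_pd_root_quot(1)[OF Z S that, of i p] has_pd_root_quot(2)[OF Z S that, of p] i
        by (cases "i = N") simp_all
      show "Ck (Suc N) (cyl N Z) k (if i = N then root_quot N (p + 2) ?S' else root_quot N p (pd i S))"
        using Suc.IH[OF s' f', of "p + 2"] Suc.IH[OF sp[OF S(1) i] flat_pd[OF Z S i], of p] by simp
    qed
  qed
  then show ?thesis using R fl by (simp add: smooth_fun_iff_Ck[OF D])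
qed

subsection \<open>Borel's lemma with parameters\<close>

text \<open>For a fixed list \<open>is\<close> the bound can fail only for the finitely many
  \<open>j <= length is\<close>, so every differentiated series converges uniformly and the sum may
  be differentiated term by term.\<close>

lemma smooth_series:
  assumes U: "domain n U" and f: "\<And>j. smooth_fun n U (f j)"
    and b: "\<And>is j x. set is \<subseteq> {..<n} \<Longrightarrow> length is < j \<Longrightarrow> x \<in> U \<Longrightarrow> \<bar>iter_pd is (f j) x\<bar> \<le> (1/2) ^ j"
  shows "smooth_fun n U (\<lambda>x. \<Sum>j. f j x)"
proof -
  have ev: "\<forall>\<^sub>F j in sequentially. \<forall>x\<in>U. norm (iter_pd is (f j) x) \<le> (1/2) ^ j"
    if "set is \<subseteq> {..<n}" for "is"
    using eventually_gt_at_top[of "length is"] by eventually_elim (use b that in auto)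
  have sum_half: "summable (\<lambda>j. (1/2::real) ^ j)" by (simp add: summable_geometric)
  have unif: "uniform_limit U (\<lambda>k x. \<Sum>j<k. iter_pd is (f j) x) (\<lambda>x. \<Sum>j. iter_pd is (f j) x) sequentially"
    if "set is \<subseteq> {..<n}" for "is"
    by (rule Weierstrass_m_test_ev[OF ev[OF that] sum_half])
  have cont: "continuous_on U (\<lambda>x. \<Sum>j. iter_pd is (f j) x)" if i: "set is \<subseteq> {..<n}" for "is"
  proof (rule uniform_limit_theorem[OF _ unif[OF i]])
    show "\<forall>\<^sub>F k in sequentially. continuous_on U (\<lambda>x. \<Sum>j<k. iter_pd is (f j) x)"
      by (intro always_eventually allI continuous_on_sum smooth_fun_continuous[OF f i])
  qed simp
  have pd: "has_pd (\<lambda>x. \<Sum>j. iter_pd is (f j) x) i x (\<Sum>j. iter_pd (i # is) (f j) x)"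
    if i: "set is \<subseteq> {..<n}" "i < n" and x: "x \<in> U" for "is" i x
  proof -
    obtain d where d: "d > 0" "\<And>h. dist h 0 < d \<Longrightarrow> x(i := x i + h) \<in> U"
      using slice_in[OF U x i(2)] unfolding eventually_nhds_metric by blast
    define y where "y h = x(i := x i + h)" for h
    have yU: "y h \<in> U" if "h \<in> ball 0 d" for h using d(2)[of h] that by (simp add: y_def dist_commute)
    have i': "set (i # is) \<subseteq> {..<n}" using i by auto
    have "((\<lambda>h. \<Sum>j. iter_pd is (f j) (y h)) has_field_derivative (\<Sum>j. iter_pd (i # is) (f j) (y 0))) (at 0)"
    proof (rule has_field_derivative_series'(2)[where S = "ball 0 d" and ?x0.0 = 0])
      show "convex (ball (0::real) d)" by simp
      show "((\<lambda>h. iter_pd is (f j) (y h)) has_field_derivative iter_pd (i # is) (f j) (y h)) (at h within ball 0 d)"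
        if h: "h \<in> ball 0 d" for j h
      proof -
        have "has_pd (iter_pd is (f j)) i (y h) (iter_pd (i # is) (f j) (y h))"
          by (rule smooth_fun_has_pd[OF f i yU[OF h]])
        then have "((\<lambda>r. iter_pd is (f j) (y (h + r))) has_real_derivative iter_pd (i # is) (f j) (y h)) (at 0)"
          by (simp add: has_pd_def y_def add.assoc)
        then have "((\<lambda>h. iter_pd is (f j) (y h)) has_real_derivative iter_pd (i # is) (f j) (y h)) (at h)"
          using DERIV_shift[of "\<lambda>s. iter_pd is (f j) (y s)" "iter_pd (i # is) (f j) (y h)" 0 h]
          by (simp add: add.commute)
        then show ?thesis by (rule has_field_derivative_at_within)
      qed
      have "\<forall>\<^sub>F j in sequentially. \<forall>h\<in>ball 0 d. norm (iter_pd (i # is) (f j) (y h)) \<le> (1/2) ^ j"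
        using ev[OF i'] by eventually_elim (use yU in blast)
      then show "uniformly_convergent_on (ball 0 d) (\<lambda>k h. \<Sum>j<k. iter_pd (i # is) (f j) (y h))"
        by (rule Weierstrass_m_test'_ev[OF _ sum_half])
      show "(0::real) \<in> ball 0 d" using d by simp
      have "\<forall>\<^sub>F j in sequentially. norm (iter_pd is (f j) (y 0)) \<le> (1/2) ^ j"
        using ev[OF i(1)] by eventually_elim (use yU[of 0] d in auto)
      then show "summable (\<lambda>j. iter_pd is (f j) (y 0))"
        by (rule summable_comparison_test_ev[OF _ sum_half])
      show "(0::real) \<in> interior (ball 0 d)" using d by simp
    qed
    then show ?thesis by (simp add: has_pd_def y_def)
  qed
  have "Ck n U k (\<lambda>x. \<Sum>j. iter_pd is (f j) x)" if "set is \<subseteq> {..<n}" for k "is"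
    using that
  proof (induction k arbitrary: "is")
    case (Suc k)
    show ?case
    proof (rule Ck_SucI[where D = "\<lambda>i x. \<Sum>j. iter_pd (i # is) (f j) x"])
      show "continuous_on U (\<lambda>x. \<Sum>j. iter_pd is (f j) x)" by (rule cont[OF Suc.prems])
      fix i assume i: "i < n"
      show "has_pd (\<lambda>x. \<Sum>j. iter_pd is (f j) x) i x (\<Sum>j. iter_pd (i # is) (f j) x)" if "x \<in> U" for x
        by (rule pd[OF Suc.prems i that])
      show "Ck n U k (\<lambda>x. \<Sum>j. iter_pd (i # is) (f j) x)"
        by (rule Suc.IH) (use Suc.prems i in auto)
    qed
  qed (simp add: cont)
  from this[of "[]"] show ?thesis by (simp add: smooth_fun_iff_Ck[OF U])
qed

text \<open>A smooth cut-off: the factor \<open>4/3\<close> makes the argument of \<open>lam\<close>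
  reach \<open>1\<close> exactly at \<open>|s| = 1/2\<close>, and it reaches \<open>0\<close> at
  \<open>|s| = 1\<close>. The square avoids the corner of the absolute value.\<close>

definition bumpf :: "real \<Rightarrow> real" where
  "bumpf s = lam (4/3 * (1 - s * s))"

lemma bumpf_bounds: "0 \<le> bumpf s" "bumpf s \<le> 1"
  by (simp_all add: bumpf_def lam_bounds)

lemma bumpf_one: "\<bar>s\<bar> \<le> 1/2 \<Longrightarrow> bumpf s = 1"
proof -
  assume "\<bar>s\<bar> \<le> 1/2"
  then have "\<bar>s\<bar> * \<bar>s\<bar> \<le> 1/2 * (1/2)" by (intro mult_mono) auto
  then show ?thesis unfolding bumpf_def by (intro lam_one) (simp add: abs_mult[symmetric])
qed

lemma bumpf_zero: "\<bar>s\<bar> \<ge> 1 \<Longrightarrow> bumpf s = 0"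
proof -
  assume "\<bar>s\<bar> \<ge> 1"
  then have "1 * 1 \<le> \<bar>s\<bar> * \<bar>s\<bar>" by (intro mult_mono) auto
  then show ?thesis unfolding bumpf_def by (intro lam_zero) (simp add: abs_mult[symmetric])
qed

definition bmon :: "nat \<Rightarrow> real \<Rightarrow> real" where
  "bmon j s = s ^ j * bumpf s"

lemma smooth_bmon:
  assumes "domain n U" "smooth_fun n U f"
  shows "smooth_fun n U (\<lambda>x. bmon j (f x))"
  unfolding bmon_def bumpf_def
  by (rule smooth_mult[OF assms(1) smooth_power[OF assms] smooth_lam[OF assms(1)
    smooth_mult[OF assms(1) smooth_const[OF assms(1)] smooth_diff[OF assms(1) smooth_const[OF assms(1)]
      smooth_mult[OF assms(1) assms(2) assms(2)]]]]])

text \<open>Both sides select a value from the same derivative relation, so they agree as functions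
  even where no derivative exists.\<close>

lemma pd_of_coord: "pd i (\<lambda>x. w (x i)) = (\<lambda>x. deriv w (x i))"
proof
  fix x :: vec
  have "((\<lambda>h. w (x i + h)) has_real_derivative D) (at 0) \<longleftrightarrow> (w has_real_derivative D) (at (x i))" for D
    using DERIV_shift[of w D 0 "x i"] by (simp add: add.commute)
  then show "pd i (\<lambda>x. w (x i)) x = deriv w (x i)" by (simp add: pd_def deriv_def)
qed

text \<open>Smoothness in one variable is read off from the calculus in \<open>R^1\<close>: the
  \<open>k\<close>-fold \<open>deriv\<close> is \<open>iter_pd\<close> along \<open>k\<close> copies
  of the only coordinate direction.\<close>

lemma DERIV_bmon: "((deriv ^^ k) (bmon j) has_real_derivative (deriv ^^ Suc k) (bmon j) s) (at s)"
proof -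
  have s: "smooth_fun 1 (Rn 1) (\<lambda>x. bmon j (x 0))"
    by (rule smooth_bmon[OF domain_Rn smooth_coord[OF domain_Rn]])
  have it: "iter_pd (replicate k 0) (\<lambda>x. bmon j (x 0)) = (\<lambda>x. (deriv ^^ k) (bmon j) (x 0))" for k
    by (induction k) (auto simp: pd_of_coord)
  define x :: vec where "x = (\<lambda>i. if i = 0 then s else 0)"
  have "has_pd (iter_pd (replicate k 0) (\<lambda>x. bmon j (x 0))) 0 x (iter_pd (0 # replicate k 0) (\<lambda>x. bmon j (x 0)) x)"
    by (rule smooth_fun_has_pd[OF s]) (auto simp: x_def Rn_def)
  from has_pd_DERIV[OF this] show ?thesis
    using it[of "Suc k"] by (simp add: it x_def)
qed

text \<open>All derivatives vanish on the open set \<open>|s| > 1\<close> and are continuous on the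
  compact remainder.\<close>

lemma bounded_bmon: "\<exists>B. \<forall>s. \<bar>(deriv ^^ k) (bmon j) s\<bar> \<le> B"
proof -
  have zero: "(deriv ^^ k) (bmon j) s = 0" if "\<bar>s\<bar> > 1" for s
    using that
  proof (induction k arbitrary: s)
    case 0
    then show ?case by (simp add: bmon_def bumpf_zero)
  next
    case (Suc k)
    have "open {s::real. \<bar>s\<bar> > 1}" by (intro open_Collect_less continuous_intros)
    then have "((deriv ^^ k) (bmon j) has_real_derivative 0) (at s)"
      by (rule has_field_derivative_transform_within_open[where f = "\<lambda>_. 0", rotated])
        (use Suc in auto)
    then show ?case using DERIV_unique[OF DERIV_bmon] by blast
  qed
  have "continuous_on {-1..1} (\<lambda>s. \<bar>(deriv ^^ k) (bmon j) s\<bar>)"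
    by (intro continuous_intros continuous_at_imp_continuous_on ballI DERIV_isCont[OF DERIV_bmon])
  from compact_continuous_image[OF this] have "bounded ((\<lambda>s. \<bar>(deriv ^^ k) (bmon j) s\<bar>) ` {-1..1})"
    by (simp add: compact_imp_bounded)
  then obtain B where B: "\<And>s. s \<in> {-1..1} \<Longrightarrow> \<bar>(deriv ^^ k) (bmon j) s\<bar> \<le> B"
    unfolding bounded_iff by (metis imageI real_norm_def abs_idempotent)
  have "\<bar>(deriv ^^ k) (bmon j) s\<bar> \<le> max B 0" for s
  proof (cases "\<bar>s\<bar> > 1")
    case False
    then have "s \<in> {-1..1}" by auto
    from B[OF this] show ?thesis by (simp add: le_max_iff_disj)
  qed (simp add: zero)
  then show ?thesis by blast
qed

lemma iter_pd_indep:
  assumes "\<And>x s. E (x(N := s)) = E x" "N \<notin> set is"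
  shows "iter_pd is E (x(N := s)) = iter_pd is E x"
  using assms(2)
proof (induction "is" arbitrary: x)
  case (Cons i js)
  have "iter_pd js E ((x(N := s))(i := (x(N := s)) i + h)) = iter_pd js E (x(i := x i + h))" for h
  proof -
    have eq: "(x(N := s))(i := (x(N := s)) i + h) = (x(i := x i + h))(N := s)"
      using Cons.prems by (auto simp: fun_eq_iff)
    have "N \<notin> set js" using Cons.prems by simp
    then show ?thesis unfolding eq by (rule Cons.IH)
  qed
  then show ?case unfolding iter_pd.simps pd_def by presburger
qed (simp add: assms)

text \<open>The variables are separated, so each \<open>N\<close> in the list differentiates the
  second factor and brings out a factor \<open>c\<close>, while every other index acts on
  \<open>E\<close>. The order of the latter is kept, so no partial derivatives are
  interchanged.\<close>

lemma iter_pd_separated: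
  assumes D: "domain (Suc N) U" and E: "smooth_fun (Suc N) U E" "\<And>x s. E (x(N := s)) = E x"
    and "set is \<subseteq> {..<Suc N}" "x \<in> U"
  shows "iter_pd is (\<lambda>x. E x * (a * bmon j (c * x N))) x =
    iter_pd (filter (\<lambda>i. i \<noteq> N) is) E x *
    (a * c ^ length (filter (\<lambda>i. i = N) is) * (deriv ^^ length (filter (\<lambda>i. i = N) is)) (bmon j) (c * x N))"
  using assms(4,5)
proof (induction "is" arbitrary: x)
  case (Cons i js)
  let ?A = "iter_pd (filter (\<lambda>i. i \<noteq> N) js) E" and ?p = "length (filter (\<lambda>i. i = N) js)"
  let ?v = "\<lambda>x. a * c ^ ?p * (deriv ^^ ?p) (bmon j) (c * x N)"
  have i: "i < Suc N" and js: "set js \<subseteq> {..<Suc N}" using Cons.prems by auto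
  have fjs: "set (filter (\<lambda>i. i \<noteq> N) js) \<subseteq> {..<Suc N}" using js by auto
  have "iter_pd (i # js) (\<lambda>x. E x * (a * bmon j (c * x N))) x =
      pd i (\<lambda>x. ?A x * ?v x) x"
    using pd_cong[OF D Cons.prems(2) i Cons.IH[OF js]] by simp
  moreover have "has_pd (\<lambda>x. ?A x * ?v x) i x (iter_pd (filter (\<lambda>i. i \<noteq> N) (i # js)) E x *
    (a * c ^ length (filter (\<lambda>i. i = N) (i # js)) * (deriv ^^ length (filter (\<lambda>i. i = N) (i # js))) (bmon j) (c * x N)))"
  proof (cases "i = N")
    case True
    have A: "has_pd ?A N x 0"
      using iter_pd_indep[of E N "filter (\<lambda>i. i \<noteq> N) js", OF E(2)] by (simp add: has_pd_def)
    have "((\<lambda>s. (deriv ^^ ?p) (bmon j) (c * s)) has_real_derivative (deriv ^^ Suc ?p) (bmon j) (c * x N) * c) (at (x N))"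
      by (rule DERIV_chain2[OF DERIV_bmon]) (auto intro!: derivative_eq_intros)
    from DERIV_cmult[OF this, of "a * c ^ ?p"]
    have "has_pd ?v N x (a * c ^ ?p * ((deriv ^^ Suc ?p) (bmon j) (c * x N) * c))"
      by (intro DERIV_has_pd) simp
    from has_pd_mult[OF A this] show ?thesis using True by (simp add: mult_ac)
  next
    case False
    have A: "has_pd ?A i x (iter_pd (i # filter (\<lambda>i. i \<noteq> N) js) E x)"
      by (rule smooth_fun_has_pd[OF E(1) fjs i Cons.prems(2)])
    have "has_pd ?v i x 0" using False by (simp add: has_pd_def)
    from has_pd_mult[OF A this] show ?thesis using False by simp
  qed
  ultimately show ?case by (simp only: has_pd_imp_pd)
qed simp

lemma finite_uniform_bound:
  assumes "finite A" "\<And>a. a \<in> A \<Longrightarrow> \<exists>B::real. \<forall>y\<in>Y. f a y \<le> B"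
  shows "\<exists>B. \<forall>a\<in>A. \<forall>y\<in>Y. f a y \<le> B"
  using assms
proof (induction A)
  case (insert a A)
  then obtain B C where B: "\<forall>a\<in>A. \<forall>y\<in>Y. f a y \<le> B" and C: "\<forall>y\<in>Y. f a y \<le> C" by blast
  have "\<forall>b\<in>insert a A. \<forall>y\<in>Y. f b y \<le> max B C" using B C by (auto intro: max.coboundedI1 max.coboundedI2)
  then show ?case by blast
qed simp

text \<open>Each of the fewer than \<open>j\<close> derivatives contributes at most one factor
  \<open>c\<close>, against \<open>c ^ j\<close> in the denominator. At least one factor
  \<open>1 / c\<close> remains, and a large \<open>c\<close> makes all these derivatives
  small.\<close>

lemma borel_scale:
  assumes D: "domain (Suc N) U" and E: "smooth_fun (Suc N) U E" "\<And>x s. E (x(N := s)) = E x"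
    and bd: "\<And>is. set is \<subseteq> {..<N} \<Longrightarrow> \<exists>B. \<forall>x\<in>U. \<bar>iter_pd is E x\<bar> \<le> B"
  obtains c :: real where "c \<ge> 2"
    "\<And>is x. set is \<subseteq> {..<Suc N} \<Longrightarrow> length is < j \<Longrightarrow> x \<in> U \<Longrightarrow>
      \<bar>iter_pd is (\<lambda>x. E x * (inverse (c ^ j) * bmon j (c * x N))) x\<bar> \<le> (1/2) ^ j"
    "\<And>x. x \<in> U \<Longrightarrow> \<bar>E x\<bar> / c \<le> (1/2) ^ j"
proof -
  \<comment> \<open>With \<open><= j\<close> instead of \<open>< j\<close> the empty list belongs to
    \<open>L\<close> also for \<open>j = 0\<close>; it yields the bound on \<open>E\<close>
    itself.\<close>
  define L where "L = {is. set is \<subseteq> {..<Suc N} \<and> length is \<le> j}"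
  have L: "finite L" unfolding L_def by (rule finite_lists_length_le) simp
  let ?E = "\<lambda>is x. \<bar>iter_pd (filter (\<lambda>i. i \<noteq> N) is) E x\<bar>"
  let ?v = "\<lambda>is s. \<bar>(deriv ^^ length (filter (\<lambda>i. i = N) is)) (bmon j) s\<bar>"
  obtain B1 where B1: "\<forall>is\<in>L. \<forall>x\<in>U. ?E is x \<le> B1"
  proof -
    have "\<exists>B. \<forall>x\<in>U. ?E is x \<le> B" if "is \<in> L" for "is"
      by (rule bd) (use that in \<open>auto simp: L_def less_Suc_eq\<close>)
    from finite_uniform_bound[OF L, of U ?E, OF this] show ?thesis using that by blast
  qed
  obtain B2 where B2: "\<forall>is\<in>L. \<forall>s\<in>UNIV. ?v is s \<le> B2"
  proof -
    have "\<exists>B. \<forall>s\<in>UNIV. ?v is s \<le> B" if "is \<in> L" for "is" using bounded_bmon by simp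
    from finite_uniform_bound[OF L, of UNIV ?v, OF this] show ?thesis using that by blast
  qed
  define B where "B = max 0 (max B1 B2)"
  have B: "B \<ge> 0" "\<And>is x. is \<in> L \<Longrightarrow> x \<in> U \<Longrightarrow> ?E is x \<le> B" "\<And>is s. is \<in> L \<Longrightarrow> ?v is s \<le> B"
    using B1 B2 by (auto simp: B_def max.coboundedI1 max.coboundedI2)
  \<comment> \<open>Chosen so that \<open>c / 2 ^ j\<close> dominates both \<open>B * B\<close>,
    which bounds a product of derivatives of the two factors, and \<open>B\<close>, which bounds
    \<open>E\<close>; the summand \<open>2\<close> secures \<open>c >= 2\<close>.\<close>
  define c where "c = 2 + 2 ^ j * (B * B + B)"
  have c2: "c \<ge> 2" using B(1) by (simp add: c_def)
  have cB: "B * B \<le> c * (1/2) ^ j" "B \<le> c * (1/2) ^ j"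
  proof -
    have eq: "c * (1/2) ^ j = 2 * (1/2) ^ j + (B * B + B)"
      by (simp add: c_def power_one_over algebra_simps)
    have "B * B \<ge> 0" "(1/2::real) ^ j \<ge> 0" by auto
    then show "B * B \<le> c * (1/2) ^ j" "B \<le> c * (1/2) ^ j" unfolding eq using B(1) by linarith+
  qed
  show ?thesis
  proof (rule that[OF c2])
    fix "is" x assume i: "set is \<subseteq> {..<Suc N}" "length is < j" and x: "x \<in> U"
    define p where "p = length (filter (\<lambda>i. i = N) is)"
    have p: "p < j" using i(2) le_less_trans[OF length_filter_le] by (auto simp: p_def)
    have iL: "is \<in> L" using i by (simp add: L_def)
    have "inverse (c ^ j) * c ^ p \<le> inverse c"
    proof -
      have "c ^ j = c ^ p * c ^ (j - p)" using p by (simp add: power_add[symmetric])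
      then have "inverse (c ^ j) * c ^ p = inverse (c ^ (j - p))" using c2 by simp
      also have "\<dots> \<le> inverse c"
        using c2 p power_increasing[of 1 "j - p" c] by (intro le_imp_inverse_le) auto
      finally show ?thesis .
    qed
    have "\<bar>iter_pd is (\<lambda>x. E x * (inverse (c ^ j) * bmon j (c * x N))) x\<bar> =
      ?E is x * (inverse (c ^ j) * c ^ p * ?v is (c * x N))"
      using iter_pd_separated[OF D E i(1) x, of "inverse (c ^ j)" j c] c2
      by (simp add: p_def abs_mult)
    also have "\<dots> \<le> B * (inverse c * B)"
      using B(1) B(2)[OF iL x] B(3)[OF iL] \<open>inverse (c ^ j) * c ^ p \<le> inverse c\<close> c2
      by (intro mult_mono) auto
    also have "\<dots> = (B * B) / c" by (simp add: divide_inverse mult_ac)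
    also have "\<dots> \<le> (1/2) ^ j" using cB(1) c2 by (simp add: divide_le_eq mult.commute)
    finally show "\<bar>iter_pd is (\<lambda>x. E x * (inverse (c ^ j) * bmon j (c * x N))) x\<bar> \<le> (1/2) ^ j" .
  next
    fix x assume x: "x \<in> U"
    have "\<bar>E x\<bar> \<le> B" using B(2)[of "[]" x] x by (simp add: L_def)
    also have "\<dots> \<le> c * (1/2) ^ j" by (rule cB)
    finally show "\<bar>E x\<bar> / c \<le> (1/2) ^ j" using c2 by (simp add: divide_le_eq mult.commute)
  qed
qed

text \<open>With \<open>t = x N\<close>, \<open>F\<close> is the sum of the terms
  \<open>E j x * t ^ j * bumpf (c j * t)\<close>: near \<open>t = 0\<close> each term is its
  monomial, and the scales \<open>c j\<close> make the series converge with all derivatives. As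
  \<open>c j >= 2\<close>, every term vanishes for \<open>t <= - 1/2\<close>, which will allow
  continuation by \<open>0\<close> towards \<open>u = 0\<close>.\<close>

lemma borel:
  assumes D: "domain (Suc N) U" and E: "\<And>j. smooth_fun (Suc N) U (E j)" "\<And>j x s. E j (x(N := s)) = E j x"
    and bd: "\<And>j is. set is \<subseteq> {..<N} \<Longrightarrow> \<exists>B. \<forall>x\<in>U. \<bar>iter_pd is (E j) x\<bar> \<le> B"
  obtains F where "smooth_fun (Suc N) U F" "\<And>x. x N \<le> - 1/2 \<Longrightarrow> F x = 0"
    "\<And>k. \<exists>C\<ge>0. \<forall>x\<in>U. \<bar>x N\<bar> \<le> 1 \<longrightarrow> \<bar>F x - (\<Sum>j<k. E j x * x N ^ j)\<bar> \<le> C * \<bar>x N\<bar> ^ k"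
proof -
  let ?P = "\<lambda>j c. c \<ge> 2 \<and>
    (\<forall>is x. set is \<subseteq> {..<Suc N} \<longrightarrow> length is < j \<longrightarrow> x \<in> U \<longrightarrow>
      \<bar>iter_pd is (\<lambda>x. E j x * (inverse (c ^ j) * bmon j (c * x N))) x\<bar> \<le> (1/2) ^ j) \<and>
    (\<forall>x\<in>U. \<bar>E j x\<bar> / c \<le> (1/2) ^ j)"
  define c :: "nat \<Rightarrow> real" where "c j = (SOME c. ?P j c)" for j
  have "?P j (c j)" for j
  proof -
    have "\<exists>c::real. ?P j c"
      by (rule borel_scale[OF D E(1) E(2) bd, of j j]) blast+
    then show ?thesis unfolding c_def by (rule someI_ex)
  qed
  then have c: "\<And>j. c j \<ge> 2"
    "\<And>j is x. set is \<subseteq> {..<Suc N} \<Longrightarrow> length is < j \<Longrightarrow> x \<in> U \<Longrightarrow>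
      \<bar>iter_pd is (\<lambda>x. E j x * (inverse (c j ^ j) * bmon j (c j * x N))) x\<bar> \<le> (1/2) ^ j"
    "\<And>j x. x \<in> U \<Longrightarrow> \<bar>E j x\<bar> / c j \<le> (1/2) ^ j"
    by blast+
  define f where "f j x = E j x * (inverse (c j ^ j) * bmon j (c j * x N))" for j x
  have f_alt: "f j x = E j x * (x N ^ j * bumpf (c j * x N))" for j x
  proof -
    have "c j \<noteq> 0" using c(1)[of j] by auto
    then show ?thesis by (simp add: f_def bmon_def power_mult_distrib)
  qed
  define F where "F x = (\<Sum>j. f j x)" for x
  have sf: "smooth_fun (Suc N) U (f j)" for j
    unfolding f_def
    by (rule smooth_mult[OF D E(1) smooth_mult[OF D smooth_const[OF D] smooth_bmon[OF D
          smooth_mult[OF D smooth_const[OF D] smooth_coord[OF D]]]]])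
  have fb: "\<bar>iter_pd is (f j) x\<bar> \<le> (1/2) ^ j" if "set is \<subseteq> {..<Suc N}" "length is < j" "x \<in> U" for "is" j x
    using c(2)[OF that] by (simp add: f_def[abs_def])
  have half: "summable (\<lambda>j. (1/2::real) ^ j)" by (simp add: summable_geometric)
  show ?thesis
  proof (rule that[of F])
    show "smooth_fun (Suc N) U F" unfolding F_def by (rule smooth_series[OF D sf fb])
    fix x :: vec assume x: "x N \<le> - 1/2"
    have "f j x = 0" for j
    proof -
      have "c j * (- x N) \<ge> 2 * (1/2)" using c(1)[of j] x by (intro mult_mono) auto
      then show ?thesis by (simp add: f_alt bumpf_zero)
    qed
    then show "F x = 0" by (simp add: F_def)
  next
    fix k
    have "\<exists>B\<ge>0. \<forall>x\<in>U. \<bar>E j x\<bar> \<le> B" for j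
      using bd[of "[]" j] by (metis empty_set empty_subsetI iter_pd.simps(1) max.cobounded1 max.coboundedI2 max.commute)
    then obtain e where e: "\<And>j. e j \<ge> 0" "\<And>j x. x \<in> U \<Longrightarrow> \<bar>E j x\<bar> \<le> e j" by metis
    \<comment> \<open>The factor of \<open>|t| ^ k\<close> in the bound for term \<open>j\<close>.
      For \<open>j < k\<close> the cut-off causes an error only if
      \<open>1 <= 2 * c j * |t|\<close>, and then \<open>(2 * c j * |t|) ^ (k - j)\<close> supplies
      the missing powers. For \<open>j > k\<close> the term vanishes unless
      \<open>|t| <= 1 / c j\<close>, so one surplus power of \<open>|t|\<close> turns
      \<open>|E j x|\<close> into \<open>|E j x| / c j\<close>.\<close>
    define a where "a j = (if j \<le> k then e j * (2 * c j) ^ (k - j) else (1/2) ^ j)" for j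
    have a: "summable a"
    proof (rule summable_comparison_test_ev[OF _ half])
      show "\<forall>\<^sub>F j in sequentially. norm (a j) \<le> (1/2) ^ j"
        using eventually_gt_at_top[of k] by eventually_elim (simp add: a_def)
    qed
    have a0: "a j \<ge> 0" for j using e(1)[of j] c(1)[of j] by (simp add: a_def)
    have bnd: "\<bar>f j x - (if j < k then E j x * x N ^ j else 0)\<bar> \<le> a j * \<bar>x N\<bar> ^ k"
      if x: "x \<in> U" "\<bar>x N\<bar> \<le> 1" for j x
    proof -
      let ?t = "x N" and ?b = "bumpf (c j * x N)"
      consider "j < k" | "j = k" | "j > k" by linarith
      then show ?thesis
      proof cases
        case 1
        show ?thesis
        proof (cases "\<bar>c j * ?t\<bar> \<le> 1/2")
          case True
          then show ?thesis using 1 a0[of j] by (simp add: f_alt bumpf_one)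
        next
          case False
          then have "1 \<le> 2 * c j * \<bar>?t\<bar>" using c(1)[of j] by (simp add: abs_mult)
          then have g: "1 \<le> (2 * c j * \<bar>?t\<bar>) ^ (k - j)" by (rule one_le_power)
          have "f j x - E j x * ?t ^ j = E j x * (?t ^ j * (?b - 1))" by (simp add: f_alt algebra_simps)
          then have "\<bar>f j x - E j x * ?t ^ j\<bar> = \<bar>E j x\<bar> * (\<bar>?t\<bar> ^ j * \<bar>?b - 1\<bar>)"
            by (simp add: abs_mult power_abs)
          also have "\<dots> \<le> e j * (\<bar>?t\<bar> ^ j * (2 * c j * \<bar>?t\<bar>) ^ (k - j))"
            using e(2)[OF x(1)] e(1) g bumpf_bounds[of "c j * ?t"]
            by (intro mult_mono) auto
          also have "\<bar>?t\<bar> ^ j * (2 * c j * \<bar>?t\<bar>) ^ (k - j) = (2 * c j) ^ (k - j) * \<bar>?t\<bar> ^ k"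
          proof -
            have "\<bar>?t\<bar> ^ k = \<bar>?t\<bar> ^ j * \<bar>?t\<bar> ^ (k - j)" using 1 by (simp add: power_add[symmetric])
            then show ?thesis by (simp add: power_mult_distrib)
          qed
          finally show ?thesis using 1 by (simp add: a_def mult_ac)
        qed
      next
        case 2
        have "\<bar>f j x\<bar> = \<bar>E j x\<bar> * (\<bar>?t\<bar> ^ k * ?b)"
          using 2 bumpf_bounds[of "c j * ?t"] by (simp add: f_alt abs_mult power_abs)
        also have "\<dots> \<le> e j * (\<bar>?t\<bar> ^ k * 1)"
          using e(2)[OF x(1)] e(1) bumpf_bounds[of "c j * ?t"] by (intro mult_mono) auto
        finally show ?thesis using 2 by (simp add: a_def)
      next
        case 3
        show ?thesis
        proof (cases "\<bar>c j * ?t\<bar> \<ge> 1")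
          case True
          then show ?thesis using 3 a0[of j] by (simp add: f_alt bumpf_zero)
        next
          case False
          then have ct: "\<bar>?t\<bar> \<le> 1 / c j" using c(1)[of j] by (simp add: abs_mult field_simps)
          have "\<bar>?t\<bar> ^ j = \<bar>?t\<bar> ^ k * \<bar>?t\<bar> ^ (j - k)" using 3 by (simp add: power_add[symmetric])
          also have "\<bar>?t\<bar> ^ (j - k) \<le> \<bar>?t\<bar> ^ 1" using 3 x(2) by (intro power_decreasing) auto
          also have "\<bar>?t\<bar> ^ 1 \<le> 1 / c j" using ct by simp
          finally have tj: "\<bar>?t\<bar> ^ j \<le> \<bar>?t\<bar> ^ k * (1 / c j)" by (simp add: mult_left_mono)
          have "\<bar>f j x\<bar> = \<bar>E j x\<bar> * (\<bar>?t\<bar> ^ j * ?b)"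
            using bumpf_bounds[of "c j * ?t"] by (simp add: f_alt abs_mult power_abs)
          also have "\<dots> \<le> \<bar>E j x\<bar> * (\<bar>?t\<bar> ^ k * (1 / c j) * 1)"
            using tj bumpf_bounds[of "c j * ?t"] c(1)[of j] by (intro mult_left_mono mult_mono) auto
          also have "\<dots> = (\<bar>E j x\<bar> / c j) * \<bar>?t\<bar> ^ k" by simp
          also have "\<dots> \<le> (1/2) ^ j * \<bar>?t\<bar> ^ k" by (intro mult_right_mono c(3) x) auto
          finally show ?thesis using 3 by (simp add: a_def)
        qed
      qed
    qed
    have "\<bar>F x - (\<Sum>j<k. E j x * x N ^ j)\<bar> \<le> suminf a * \<bar>x N\<bar> ^ k"
      if x: "x \<in> U" "\<bar>x N\<bar> \<le> 1" for x
    proof -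
      let ?r = "\<lambda>j. f j x - (if j < k then E j x * x N ^ j else 0)"
      have "\<forall>\<^sub>F j in sequentially. norm (f j x) \<le> (1/2) ^ j"
        using eventually_gt_at_top[of 0] by eventually_elim (use fb[of "[]"] x in auto)
      then have "summable (\<lambda>j. f j x)" by (rule summable_comparison_test_ev[OF _ half])
      then have 1: "(\<lambda>j. f j x) sums F x" by (simp add: F_def summable_sums)
      have 2: "(\<lambda>j. if j < k then E j x * x N ^ j else 0) sums (\<Sum>j<k. E j x * x N ^ j)"
        using sums_If_finite_set[of "{..<k}" "\<lambda>j. E j x * x N ^ j"] by simp
      from sums_diff[OF 1 2] have r: "?r sums (F x - (\<Sum>j<k. E j x * x N ^ j))" .
      have sa: "summable (\<lambda>j. a j * \<bar>x N\<bar> ^ k)" by (rule summable_mult2[OF a])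
      have "norm (\<Sum>j. ?r j) \<le> (\<Sum>j. a j * \<bar>x N\<bar> ^ k)"
        by (rule norm_suminf_le[OF _ sa]) (use bnd[OF x] in simp)
      then show ?thesis using sums_unique[OF r] suminf_mult2[OF a, of "\<bar>x N\<bar> ^ k"] by simp
    qed
    moreover have "suminf a \<ge> 0" by (rule suminf_nonneg[OF a a0])
    ultimately show "\<exists>C\<ge>0. \<forall>x\<in>U. \<bar>x N\<bar> \<le> 1 \<longrightarrow> \<bar>F x - (\<Sum>j<k. E j x * x N ^ j)\<bar> \<le> C * \<bar>x N\<bar> ^ k"
      by blast
  qed
qed

subsection \<open>Extension of smooth functions from the fat sphere\<close>

lemma unorm_upd: "n \<le> N \<Longrightarrow> unorm n (x(N := s)) = unorm n x"
  by (auto simp: unorm_def intro!: sum.cong)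

lemma vnorm_upd: "n + m \<le> N \<Longrightarrow> vnorm n m (x(N := s)) = vnorm n m x"
  by (auto simp: vnorm_def intro!: sum.cong)

lemma scl_upd: "scl n m a b (x(n + m := s)) = scl n m a b x"
  by (auto simp: scl_def)

lemma even_part_sum:
  fixes a :: "nat \<Rightarrow> real"
  shows "(\<Sum>j<2 * k. a j * t ^ j) + (\<Sum>j<2 * k. a j * (- t) ^ j) = 2 * (\<Sum>j<k. a (2 * j) * (t\<^sup>2) ^ j)"
proof (induction k)
  case (Suc k)
  have "2 * Suc k = Suc (Suc (2 * k))" by simp
  then show ?case using Suc by (simp add: power_mult[symmetric] algebra_simps)
qed simp

text \<open>Averaging the Taylor formulas at \<open>t\<close> and \<open>- t\<close> cancels the odd
  terms and leaves a polynomial in \<open>t^2\<close>; the remainder of order \<open>2 * k\<close>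
  in \<open>t\<close> has order \<open>k\<close> in \<open>t^2\<close>.\<close>

lemma even_taylor:
  fixes \<phi> :: "real \<Rightarrow> real"
  assumes d: "\<And>j s. (d j has_real_derivative d (Suc j) s) (at s)"
    and even: "d 0 (- t) = d 0 t" and b: "\<And>s. \<bar>s\<bar> \<le> \<bar>t\<bar> \<Longrightarrow> \<bar>d (2 * k) s\<bar> \<le> B"
  shows "\<bar>d 0 t - (\<Sum>j<k. d (2 * j) 0 / fact (2 * j) * (t\<^sup>2) ^ j)\<bar> \<le> B * (t\<^sup>2) ^ k"
proof -
  define a where "a j = d j 0 / fact j" for j
  have r: "\<exists>s. \<bar>s\<bar> \<le> \<bar>r\<bar> \<and> d 0 r = (\<Sum>j<2 * k. a j * r ^ j) + d (2 * k) s / fact (2 * k) * r ^ (2 * k)" for r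
    unfolding a_def by (rule Maclaurin_bi_le) (use d in auto)
  obtain p where p: "\<bar>p\<bar> \<le> \<bar>t\<bar>" "d 0 t = (\<Sum>j<2 * k. a j * t ^ j) + d (2 * k) p / fact (2 * k) * t ^ (2 * k)"
    using r[of t] by blast
  obtain q where q: "\<bar>q\<bar> \<le> \<bar>t\<bar>" "d 0 t = (\<Sum>j<2 * k. a j * (- t) ^ j) + d (2 * k) q / fact (2 * k) * t ^ (2 * k)"
    using r[of "- t"] even by auto
  define u where "u s = d (2 * k) s / fact (2 * k)" for s
  have u: "\<bar>u s\<bar> \<le> B" if "\<bar>s\<bar> \<le> \<bar>t\<bar>" for s
  proof -
    have "\<bar>u s\<bar> \<le> \<bar>d (2 * k) s\<bar> / 1"
      unfolding u_def abs_divide by (intro divide_left_mono) (auto simp: fact_ge_1)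
    then show ?thesis using b[OF that] by simp
  qed
  have "2 * d 0 t = 2 * (\<Sum>j<k. a (2 * j) * (t\<^sup>2) ^ j) + (u p + u q) * t ^ (2 * k)"
    using p(2) q(2) even_part_sum[of a t k] by (simp add: u_def algebra_simps)
  then have "d 0 t - (\<Sum>j<k. a (2 * j) * (t\<^sup>2) ^ j) = (u p + u q) / 2 * (t\<^sup>2) ^ k"
    by (simp add: power_mult)
  also have "\<bar>\<dots>\<bar> \<le> B * (t\<^sup>2) ^ k"
    unfolding abs_mult using u[OF p(1)] u[OF q(1)] by (intro mult_mono) auto
  finally show ?thesis by (simp add: a_def)
qed

locale sphere_fun =
  fixes n m :: nat and g :: "vec \<Rightarrow> real"
  assumes g: "dfun (n + m) (fat_sphere n m) g"
begin

definition N :: nat where "N = n + m"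

definition U0 :: "vec set" where "U0 = {x\<in>Rn (Suc N). 0 < unorm n x}"

text \<open>The bounds \<open>3\<close> exceed \<open>5/2\<close>, so this open set contains all
  points with \<open>1/4 < |u| <= 1\<close> and \<open>|u| + |v| <= 5/2\<close>; the lower bound on
  \<open>|u|\<close> keeps the norm smooth.\<close>

definition Z :: "vec set" where
  "Z = {x\<in>Rn N. 0 < unorm n x - 1/4} \<inter> {x\<in>Rn N. 0 < 3 - unorm n x} \<inter> {x\<in>Rn N. 0 < 3 - vnorm n m x}"

text \<open>A compact subset of \<open>U0\<close> that contains the part \<open>|x N| <= 1\<close>
  of the cylinder over \<open>Z\<close>; it supplies the uniform bounds that \<open>borel\<close>
  and the Taylor estimate ask for.\<close>

definition K :: "vec set" where
  "K = {x\<in>Rn (Suc N). 1/4 \<le> unorm n x \<and> unorm n x \<le> 3 \<and> vnorm n m x \<le> 3 \<and> \<bar>x N\<bar> \<le> 1}"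

text \<open>The radial coordinate is substituted by \<open>1 + t\<^sup>2\<close>, which turns \<open>g\<close> into a smooth function
  on an open set that is even in \<open>t\<close>.\<close>

definition G :: "vec \<Rightarrow> real" where
  "G x = g (scl n m ((1 + (x N)\<^sup>2) / unorm n x) 1 x)"

text \<open>The coefficient of \<open>t ^ (2 * j)\<close> in the Taylor series of \<open>G\<close>
  at \<open>t = 0\<close>, that is, of \<open>tau ^ j\<close> after
  \<open>tau = t^2\<close>.\<close>

definition E :: "nat \<Rightarrow> vec \<Rightarrow> real" where
  "E j x = iter_pd (replicate (2 * j) N) G (x(N := 0)) / fact (2 * j)"

lemma norms_upd: "unorm n (x(N := s)) = unorm n x" "vnorm n m (x(N := s)) = vnorm n m x"
  by (simp_all add: N_def unorm_upd vnorm_upd)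

lemma domain_U0: "domain (Suc N) U0"
  unfolding U0_def by (rule domain_pos[OF continuous_unorm])

lemma domain_Z: "domain N Z"
  unfolding Z_def by (intro domain_Int domain_pos continuous_intros continuous_unorm continuous_vnorm)

lemma cyl_bounds:
  assumes "x \<in> cyl N Z"
  shows "1/4 < unorm n x" "unorm n x < 3" "vnorm n m x < 3" "x \<in> Rn (Suc N)"
  using assms by (auto simp: cyl_def Z_def norms_upd)

lemma cyl_subset_U0: "cyl N Z \<subseteq> U0"
  using cyl_bounds by (fastforce simp: U0_def)

lemma cyl_in_K: "x \<in> cyl N Z \<Longrightarrow> \<bar>s\<bar> \<le> 1 \<Longrightarrow> x(N := s) \<in> K"
  using cyl_bounds[of x] by (auto simp: K_def norms_upd Rn_def)

lemma K_subset: "K \<subseteq> U0"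
  by (auto simp: K_def U0_def)

lemma compact_K: "compact K"
proof (rule compact_vec)
  have "K = Rn (Suc N) \<inter> {x. 1/4 \<le> unorm n x} \<inter> {x. unorm n x \<le> 3} \<inter> {x. vnorm n m x \<le> 3}
      \<inter> {x. \<bar>x N\<bar> \<le> 1}"
    by (auto simp: K_def)
  moreover have "closed {x. 1/4 \<le> unorm n x}" "closed {x. unorm n x \<le> 3}" "closed {x. vnorm n m x \<le> 3}"
      "closed {x::vec. \<bar>x N\<bar> \<le> 1}"
    by (intro closed_Collect_le continuous_unorm continuous_vnorm continuous_on_const
        continuous_intros continuous_coord)+
  ultimately show "closed K" by (simp add: closed_Int closed_Rn)
  show "K \<subseteq> Rn (Suc N)" by (auto simp: K_def)
  fix x i assume x: "x \<in> K" and i: "i < Suc N"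
  consider "i < n" | "n \<le> i" "i < n + m" | "i = N" using i by (simp add: N_def) linarith
  then show "\<bar>x i\<bar> \<le> 3"
    by cases (use x coord_le_unorm[of i n x] coord_le_vnorm[of n i m x] in \<open>auto simp: K_def\<close>)
qed

lemma bounded_on_K:
  assumes "smooth_fun (Suc N) U0 f" "set is \<subseteq> {..<Suc N}"
  shows "\<exists>B\<ge>0. \<forall>x\<in>K. \<bar>iter_pd is f x\<bar> \<le> B"
proof -
  have "continuous_on K (iter_pd is f)"
    using smooth_fun_continuous[OF assms] K_subset continuous_on_subset by blast
  from compact_continuous_image[OF this compact_K] have "bounded (iter_pd is f ` K)"
    by (rule compact_imp_bounded)
  then obtain B where "\<forall>y\<in>iter_pd is f ` K. norm y \<le> B" unfolding bounded_iff by blast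
  then have "\<forall>x\<in>K. \<bar>iter_pd is f x\<bar> \<le> max B 0" by (auto simp: le_max_iff_disj)
  then show ?thesis by (intro exI[of _ "max B 0"]) simp
qed

text \<open>The substitution gives \<open>u\<close> the norm \<open>1 + t^2 >= 1\<close> for every
  \<open>t\<close>, so it is a plot of the fat sphere with domain \<open>U0\<close>, and smoothness
  of \<open>g\<close> applies by definition.\<close>

lemma smooth_G: "smooth_fun (Suc N) U0 G"
proof -
  have u: "smooth_fun (Suc N) U0 (unorm n)"
    by (rule smooth_unorm[OF domain_U0]) (simp add: U0_def)
  have a: "smooth_fun (Suc N) U0 (\<lambda>x. (1 + (x N)\<^sup>2) / unorm n x)"
    by (rule smooth_divide[OF domain_U0 smooth_add[OF domain_U0 smooth_const[OF domain_U0]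
          smooth_power[OF domain_U0 smooth_coord[OF domain_U0]]] u]) (simp add: U0_def)
  have "smooth_map (Suc N) U0 (n + m) (\<lambda>x. scl n m ((1 + (x N)\<^sup>2) / unorm n x) 1 x)"
    by (rule smooth_scl[OF domain_U0 a smooth_const[OF domain_U0]])
  moreover have "scl n m ((1 + (x N)\<^sup>2) / unorm n x) 1 x \<in> fat_sphere n m" if "x \<in> U0" for x
    using that scl_Rn by (auto simp: fat_sphere_def unorm_scl U0_def abs_divide)
  ultimately have "(Suc N, U0, \<lambda>x. scl n m ((1 + (x N)\<^sup>2) / unorm n x) 1 x) \<in> esub (n + m) (fat_sphere n m)"
    using domain_U0 by (auto simp: esub_def)
  from dfunD[OF g this] show ?thesis by (simp add: G_def[abs_def])
qed

lemma G_even: "G (x(N := - s)) = G (x(N := s))"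
  by (simp add: G_def norms_upd) (simp add: N_def scl_upd)

lemma smooth_E: "smooth_fun (Suc N) U0 (E j)"
proof -
  let ?is = "replicate (2 * j) N"
  have "smooth_fun (Suc N) U0 (\<lambda>x. iter_pd ?is G (x(N := 0)))"
  proof (rule smooth_compose[OF domain_U0 domain_U0, where f = "iter_pd ?is G" and F = "\<lambda>x. x(N := 0)"])
    show "x(N := 0) \<in> U0" if "x \<in> U0" for x using that by (auto simp: U0_def norms_upd Rn_def)
    show "smooth_fun (Suc N) U0 (iter_pd ?is G)" by (rule smooth_iter_pd[OF smooth_G]) auto
    show "smooth_fun (Suc N) U0 (\<lambda>x. (x(N := 0)) i)" for i
      using smooth_coord[OF domain_U0] smooth_const[OF domain_U0] by (cases "i = N") auto
  qed
  from smooth_divide[OF domain_U0 this smooth_const[OF domain_U0]]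
  show ?thesis by (simp add: E_def[abs_def])
qed

lemma E_indep: "E j (x(N := s)) = E j x"
  by (simp add: E_def)

lemma bounded_E:
  assumes "set is \<subseteq> {..<N}"
  shows "\<exists>B. \<forall>x\<in>cyl N Z. \<bar>iter_pd is (E j) x\<bar> \<le> B"
proof -
  obtain B where B: "\<And>x. x \<in> K \<Longrightarrow> \<bar>iter_pd is (E j) x\<bar> \<le> B"
    using bounded_on_K[OF smooth_E, of "is" j] assms by force
  have "\<bar>iter_pd is (E j) x\<bar> \<le> B" if "x \<in> cyl N Z" for x
  proof -
    have "N \<notin> set is" using assms by auto
    from iter_pd_indep[of "E j" N "is" x 0, OF E_indep this]
    show ?thesis using B[OF cyl_in_K[OF that, of 0]] by simp
  qed
  then show ?thesis by blast
qed

lemma taylor_G: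
  "\<exists>B\<ge>0. \<forall>x\<in>cyl N Z. \<bar>x N\<bar> \<le> 1 \<longrightarrow> \<bar>G x - (\<Sum>j<k. E j x * ((x N)\<^sup>2) ^ j)\<bar> \<le> B * ((x N)\<^sup>2) ^ k"
proof -
  obtain B where B: "B \<ge> 0" "\<And>x. x \<in> K \<Longrightarrow> \<bar>iter_pd (replicate (2 * k) N) G x\<bar> \<le> B"
    using bounded_on_K[OF smooth_G, of "replicate (2 * k) N"] by fastforce
  have "\<bar>G x - (\<Sum>j<k. E j x * ((x N)\<^sup>2) ^ j)\<bar> \<le> B * ((x N)\<^sup>2) ^ k"
    if x: "x \<in> cyl N Z" "\<bar>x N\<bar> \<le> 1" for x
  proof -
    define d where "d j s = iter_pd (replicate j N) G (x(N := s))" for j s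
    have "\<bar>d 0 (x N) - (\<Sum>j<k. d (2 * j) 0 / fact (2 * j) * ((x N)\<^sup>2) ^ j)\<bar> \<le> B * ((x N)\<^sup>2) ^ k"
    proof (rule even_taylor)
      show "(d j has_real_derivative d (Suc j) s) (at s)" for j s
      proof -
        have "x(N := s) \<in> U0" using cyl_upd[OF x(1)] cyl_subset_U0 by blast
        then have "has_pd (iter_pd (replicate j N) G) N (x(N := s)) (iter_pd (N # replicate j N) G (x(N := s)))"
          by (intro smooth_fun_has_pd[OF smooth_G]) auto
        from has_pd_DERIV[OF this] show ?thesis by (simp add: d_def[abs_def])
      qed
      show "d 0 (- x N) = d 0 (x N)" using G_even[of x "x N"] by (simp add: d_def)
      show "\<bar>d (2 * k) s\<bar> \<le> B" if "\<bar>s\<bar> \<le> \<bar>x N\<bar>" for s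
        unfolding d_def by (rule B(2)[OF cyl_in_K[OF x(1)]]) (use that x(2) in simp)
    qed
    then show ?thesis by (simp add: d_def E_def)
  qed
  then show ?thesis using B(1) by blast
qed

lemma extension:
  obtains e where "dfun (n + m) (fat_disk n m) e" "\<And>y. y \<in> fat_sphere n m \<Longrightarrow> e y = g y"
proof -
  note DC = domain_cyl[OF domain_Z]
  obtain F where F: "smooth_fun (Suc N) (cyl N Z) F" "\<And>x. x N \<le> - 1/2 \<Longrightarrow> F x = 0"
    "\<And>k. \<exists>C\<ge>0. \<forall>x\<in>cyl N Z. \<bar>x N\<bar> \<le> 1 \<longrightarrow> \<bar>F x - (\<Sum>j<k. E j x * x N ^ j)\<bar> \<le> C * \<bar>x N\<bar> ^ k"
  proof (rule borel[where E = E, OF DC smooth_subset[OF smooth_E cyl_subset_U0] E_indep bounded_E])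
    fix F assume "smooth_fun (Suc N) (cyl N Z) F" "\<And>x. x N \<le> - 1/2 \<Longrightarrow> F x = 0"
      "\<And>k. \<exists>C\<ge>0. \<forall>x\<in>cyl N Z. \<bar>x N\<bar> \<le> 1 \<longrightarrow> \<bar>F x - (\<Sum>j<k. E j x * x N ^ j)\<bar> \<le> C * \<bar>x N\<bar> ^ k"
    then show thesis by (rule that)
  qed
  define R where "R x = G x - F (x(N := (x N)\<^sup>2))" for x
  have sR: "smooth_fun (Suc N) (cyl N Z) R"
    unfolding R_def
  proof (rule smooth_diff[OF DC smooth_subset[OF smooth_G cyl_subset_U0]])
    show "smooth_fun (Suc N) (cyl N Z) (\<lambda>x. F (x(N := (x N)\<^sup>2)))"
    proof (rule smooth_compose[OF DC DC cyl_upd F(1)])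
      show "smooth_fun (Suc N) (cyl N Z) (\<lambda>x. (x(N := (x N)\<^sup>2)) i)" for i
        using smooth_coord[OF DC] smooth_power[OF DC smooth_coord[OF DC]] by (cases "i = N") auto
    qed
  qed
  have fR: "flat N Z R"
    unfolding flat_def
  proof (intro ballI allI)
    fix z and k :: nat assume "z \<in> Z"
    obtain B where B: "B \<ge> 0" "\<And>x. x \<in> cyl N Z \<Longrightarrow> \<bar>x N\<bar> \<le> 1 \<Longrightarrow>
        \<bar>G x - (\<Sum>j<k. E j x * ((x N)\<^sup>2) ^ j)\<bar> \<le> B * ((x N)\<^sup>2) ^ k"
      using taylor_G[of k] by blast
    obtain C where C: "C \<ge> 0" "\<And>x. x \<in> cyl N Z \<Longrightarrow> \<bar>x N\<bar> \<le> 1 \<Longrightarrow>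
        \<bar>F x - (\<Sum>j<k. E j x * x N ^ j)\<bar> \<le> C * \<bar>x N\<bar> ^ k"
      using F(3)[of k] by blast
    have "\<bar>R x\<bar> \<le> (B + C) * x N ^ k" if x: "x \<in> cyl N Z" "0 < x N" "x N < 1" for x
    proof -
      let ?t = "x N"
      have t: "?t\<^sup>2 \<le> ?t" "?t\<^sup>2 \<ge> 0" using x by (auto simp: power2_eq_square mult_left_le)
      have "\<bar>F (x(N := ?t\<^sup>2)) - (\<Sum>j<k. E j x * (?t\<^sup>2) ^ j)\<bar> \<le> C * (?t\<^sup>2) ^ k"
        using C(2)[OF cyl_upd[OF x(1)], of "?t\<^sup>2"] t x by (simp add: E_indep)
      then have "\<bar>R x\<bar> \<le> B * (?t\<^sup>2) ^ k + C * (?t\<^sup>2) ^ k"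
        using B(2)[OF x(1)] x unfolding R_def by linarith
      also have "\<dots> = (B + C) * (?t\<^sup>2) ^ k" by (simp add: algebra_simps)
      also have "\<dots> \<le> (B + C) * ?t ^ k"
        using t B(1) C(1) by (intro mult_left_mono power_mono) auto
      finally show ?thesis .
    qed
    then show "\<exists>d>0. \<exists>C. \<forall>x\<in>cyl N Z. near N z d x \<longrightarrow> 0 < x N \<longrightarrow> x N < d \<longrightarrow> \<bar>R x\<bar> \<le> C * x N ^ k"
      by (intro exI[of _ 1] conjI exI[of _ "B + C"]) auto
  qed
  \<comment> \<open>For \<open>tau > 0\<close> the second summand is
    \<open>G (sqrt tau) - F tau\<close>, so that \<open>H\<close> is \<open>G (sqrt tau)\<close>;
    for \<open>tau < 0\<close> only \<open>F\<close> is left. At \<open>tau = 0\<close> the two fit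
    because the expansion of \<open>F\<close> begins with \<open>E 0\<close>.\<close>
  define H where "H x = F x + root_quot N 0 R x" for x
  have sH: "smooth_fun (Suc N) (cyl N Z) H"
    unfolding H_def by (rule smooth_add[OF DC F(1) smooth_root[OF domain_Z sR fR]])
  have H_pos: "H x = G (x(N := sqrt (x N)))" if x: "x \<in> cyl N Z" "x N \<ge> 0" for x
  proof (cases "x N = 0")
    case True
    obtain C where "\<And>x. x \<in> cyl N Z \<Longrightarrow> \<bar>x N\<bar> \<le> 1 \<Longrightarrow> \<bar>F x - (\<Sum>j<1. E j x * x N ^ j)\<bar> \<le> C * \<bar>x N\<bar> ^ 1"
      using F(3)[of 1] by blast
    from this[OF x(1)] have "F x = E 0 x" using True by simp
    then show ?thesis using True by (simp add: H_def root_quot_def E_def)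
  next
    case False
    then show ?thesis using x by (simp add: H_def root_quot_def R_def)
  qed
  have cylZ: "y(N := s) \<in> cyl N Z" if "y \<in> Z" for y s
    using cyl_upd[OF cyl_zero[OF domain_Z that]] .
  have H_sphere: "H (y(N := unorm n y - 1)) = g y" if y: "y \<in> Z" "unorm n y \<ge> 1" for y
  proof -
    have yR: "y \<in> Rn (n + m)" using y domain_subset[OF domain_Z] by (auto simp: N_def)
    have "H (y(N := unorm n y - 1)) = G (y(N := sqrt (unorm n y - 1)))"
      using H_pos[OF cylZ[OF y(1)], of "unorm n y - 1"] y(2) by simp
    also have "\<dots> = g (scl n m (unorm n y / unorm n y) 1 y)"
      using y(2) by (simp add: G_def norms_upd) (simp add: N_def scl_upd)
    also have "\<dots> = g y" using y(2) scl_one[OF yR] by simp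
    finally show ?thesis .
  qed
  \<comment> \<open>The formulas agree on overlaps: for \<open>1/4 < |u| < 1/2\<close> one has
    \<open>tau < - 1/2\<close>, where \<open>F\<close> and the root term vanish, and for
    \<open>|u| >= 1\<close> inside \<open>Z\<close> the third formula gives \<open>g\<close> by
    \<open>H_sphere\<close>.\<close>
  define e where "e y = (if 1 \<le> unorm n y then g y else if unorm n y \<le> 1/4 then 0
    else H (y(N := unorm n y - 1)))" for y
  have "dfun (n + m) (fat_disk n m) e"
  proof (rule dfun_local)
    fix y assume y: "y \<in> fat_disk n m"
    then have yR: "y \<in> Rn (n + m)" using fat_disk_subset by blast
    have sphere: "\<exists>V f. y \<in> V \<and> domain (n + m) V \<and> dfun (n + m) (fat_disk n m \<inter> V) f \<and>
        (\<forall>z\<in>fat_disk n m \<inter> V. e z = f z)"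
      if V: "y \<in> V" "domain (n + m) V" "fat_disk n m \<inter> V \<subseteq> fat_sphere n m" for V
      using V dfun_subset[OF g V(3)] by (intro exI[of _ V] exI[of _ g]) (auto simp: e_def fat_sphere_def)
    \<comment> \<open>The second case serves points with \<open>|u| = 1\<close> and large
      \<open>|v|\<close>, which may lie outside \<open>Z\<close>; near them the fat disk is
      contained in the fat sphere by \<open>fat_disk_bounded\<close>.\<close>
    consider "unorm n y > 1" | "unorm n y + vnorm n m y > 5/2" | "unorm n y \<le> 1/4"
      | "unorm n y \<le> 1" "unorm n y + vnorm n m y \<le> 5/2" "1/4 < unorm n y" by linarith
    then show "\<exists>V f. y \<in> V \<and> domain (n + m) V \<and> dfun (n + m) (fat_disk n m \<inter> V) f \<and>
        (\<forall>z\<in>fat_disk n m \<inter> V. e z = f z)"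
    proof cases
      case 1
      show ?thesis
      proof (rule sphere)
        show "y \<in> {x\<in>Rn (n + m). 0 < unorm n x - 1}" using 1 yR by simp
        show "domain (n + m) {x\<in>Rn (n + m). 0 < unorm n x - 1}"
          by (intro domain_pos continuous_intros continuous_unorm)
      qed (auto simp: fat_sphere_def)
    next
      case 2
      show ?thesis
      proof (rule sphere)
        show "y \<in> {x\<in>Rn (n + m). 0 < unorm n x + vnorm n m x - 5/2}" using 2 yR by simp
        show "domain (n + m) {x\<in>Rn (n + m). 0 < unorm n x + vnorm n m x - 5/2}"
          by (intro domain_pos continuous_intros continuous_unorm continuous_vnorm)
        show "fat_disk n m \<inter> {x\<in>Rn (n + m). 0 < unorm n x + vnorm n m x - 5/2} \<subseteq> fat_sphere n m"
          using fat_disk_bounded[of _ n m] by (force simp: fat_sphere_def)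
      qed
    next
      case 3
      let ?V = "{x\<in>Rn (n + m). 0 < 1/2 - unorm n x}"
      have V: "domain (n + m) ?V" by (intro domain_pos continuous_intros continuous_unorm)
      have "e z = 0" if "z \<in> ?V" for z
        using that F(2)[of "z(N := unorm n z - 1)"] by (auto simp: e_def H_def root_quot_def)
      then show ?thesis
        using V 3 yR dfun_subset[OF smooth_imp_dfun[OF V smooth_const[OF V]]]
        by (intro exI[of _ ?V] exI[of _ "\<lambda>_. 0"]) auto
    next
      case 4
      have yZ: "y \<in> Z" using 4 yR unorm_nonneg[of n y] by (auto simp: Z_def N_def)
      let ?f = "\<lambda>y. H (y(N := unorm n y - 1))"
      have su: "smooth_fun N Z (unorm n)" by (rule smooth_unorm[OF domain_Z]) (auto simp: Z_def)
      have sf: "smooth_fun N Z ?f"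
      proof (rule smooth_compose[OF domain_Z DC cylZ sH])
        show "smooth_fun N Z (\<lambda>x. (x(N := unorm n x - 1)) i)" for i
          using smooth_coord[OF domain_Z] smooth_diff[OF domain_Z su smooth_const[OF domain_Z]]
          by (cases "i = N") auto
      qed
      have "e z = ?f z" if "z \<in> Z" for z
        using H_sphere[OF that] that by (auto simp: e_def Z_def)
      moreover have "dfun (n + m) (fat_disk n m \<inter> Z) ?f"
        using dfun_subset[OF smooth_imp_dfun[OF domain_Z sf]] by (simp add: N_def)
      ultimately show ?thesis
        using yZ domain_Z by (intro exI[of _ Z] exI[of _ ?f]) (auto simp: N_def)
    qed
  qed
  moreover have "e y = g y" if "y \<in> fat_sphere n m" for y
    using that by (simp add: e_def fat_sphere_def)
  ultimately show ?thesis using that by blast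
qed

end

subsection \<open>Attaching fat cells\<close>

lemma smooth_sqdist:
  assumes "domain N U"
  shows "smooth_fun N U (\<lambda>x. ell (c - (\<Sum>i\<in>I. (x i - p i)\<^sup>2)))"
  by (rule smooth_ell[OF assms smooth_diff[OF assms smooth_const[OF assms] smooth_sum[OF assms
      smooth_power[OF assms smooth_diff[OF assms smooth_coord[OF assms] smooth_const[OF assms]]]]]])

lemma dfun_sqdist: "A \<subseteq> Rn N \<Longrightarrow> dfun N A (\<lambda>x. ell (c - (\<Sum>i\<in>I. (x i - p i)\<^sup>2)))"
  by (rule dfun_subset[OF smooth_imp_dfun[OF domain_Rn smooth_sqdist[OF domain_Rn]]])

lemma dfun_const: "A \<subseteq> Rn N \<Longrightarrow> dfun N A (\<lambda>_. c)"
  by (rule dfun_subset[OF smooth_imp_dfun[OF domain_Rn smooth_const[OF domain_Rn]]])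

lemma dfun_cmult:
  assumes "dfun N A f"
  shows "dfun N A (\<lambda>x. c * f x)"
  unfolding dfun_def
proof (intro allI impI)
  fix k U Q assume Q: "(k, U, Q) \<in> esub N A"
  note U = esubD(1)[OF Q]
  show "smooth_fun k U (\<lambda>x. c * f (Q x))"
    by (rule smooth_mult[OF U smooth_const[OF U] dfunD[OF assms Q]])
qed

lemma unorm_lt_one_iff: "unorm n x < 1 \<longleftrightarrow> (\<Sum>i<n. (x i)\<^sup>2) < 1"
  by (simp add: unorm_def)

text \<open>A multiple of \<open>r\<close> works because \<open>r\<close> vanishes on the fat sphere
  and is positive on the compact set \<open>K\<close>, where \<open>e / r\<close> is therefore
  bounded. At the other points outside \<open>W\<close> the function is already negative, and
  subtracting \<open>r >= 0\<close> only lowers it.\<close>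

lemma push_down:
  assumes e: "dfun (n + m) (fat_disk n m) e"
    and W: "Dopen (fat_disk n m) (esub (n + m) (fat_disk n m)) W"
    and eW: "\<And>y. y \<in> fat_sphere n m \<Longrightarrow> e y \<ge> 0 \<Longrightarrow> y \<in> W"
  obtains e' where "dfun (n + m) (fat_disk n m) e'" "\<And>y. y \<in> fat_sphere n m \<Longrightarrow> e' y = e y"
    "\<And>y. y \<in> fat_disk n m \<Longrightarrow> e' y \<ge> 0 \<Longrightarrow> y \<in> W"
proof -
  define K where "K = {y\<in>fat_disk n m. e y \<ge> 0} - W"
  \<comment> \<open>The term \<open>- 0\<close> makes this an instance of \<open>dfun_sqdist\<close>
    with centre \<open>0\<close>.\<close>
  define r where "r = (\<lambda>y::vec. ell (1 - (\<Sum>i<n. (y i - 0)\<^sup>2)))"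
  have r: "dfun (n + m) (fat_disk n m) r" unfolding r_def by (rule dfun_sqdist[OF fat_disk_subset])
  have ce: "continuous_on (fat_disk n m) e" by (rule dfun_continuous[OF e])
  have cr: "continuous_on (fat_disk n m) r" by (rule dfun_continuous[OF r])
  have r0: "r y \<ge> 0" for y by (simp add: r_def ell_nonneg)
  have K1: "unorm n y < 1" if "y \<in> K" for y
    using that eW[of y] fat_disk_subset by (force simp: K_def fat_sphere_def)
  have "compact K"
  proof (rule compact_vec)
    obtain T where T: "open T" "W = fat_disk n m \<inter> T"
      using Dopen_imp_openin[OF W] by (auto simp: openin_open)
    have "closed (fat_disk n m \<inter> e -` {0..})"
      by (rule continuous_closed_preimage[OF ce closed_fat_disk closed_atLeast])
    moreover have "K = (fat_disk n m \<inter> e -` {0..}) \<inter> - T" using T by (auto simp: K_def)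
    ultimately show "closed K" using T by (simp add: closed_Int closed_Compl)
    show "K \<subseteq> Rn (n + m)" using fat_disk_subset by (auto simp: K_def)
    fix y i assume y: "y \<in> K" and i: "i < n + m"
    have "unorm n y + vnorm n m y < 5/2"
      using fat_disk_bounded[OF _ K1[OF y]] y by (simp add: K_def)
    then have "unorm n y \<le> 5/2" "vnorm n m y \<le> 5/2" using unorm_nonneg[of n y] vnorm_nonneg[of n m y] by auto
    then show "\<bar>y i\<bar> \<le> 5/2"
      using coord_le_unorm[of i n y] coord_le_vnorm[of n i m y] i by (cases "i < n") auto
  qed
  have rpos: "r y > 0" if "y \<in> K" for y
    using K1[OF that] by (simp add: r_def ell_pos_iff unorm_lt_one_iff)
  have "continuous_on K (\<lambda>y. e y / r y)"
    using ce cr rpos by (intro continuous_on_divide continuous_on_subset[of "fat_disk n m" _ K])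
      (force simp: K_def)+
  from compact_continuous_image[OF this \<open>compact K\<close>] have "bounded ((\<lambda>y. e y / r y) ` K)"
    by (rule compact_imp_bounded)
  then obtain C where C: "\<forall>y\<in>(\<lambda>y. e y / r y) ` K. norm y \<le> C" unfolding bounded_iff by blast
  \<comment> \<open>The summand \<open>1\<close> makes the inequality on \<open>K\<close> strict,
    and \<open>\<bar>C\<bar>\<close> keeps the factor positive even if \<open>K\<close> is empty and
    \<open>C\<close> arbitrary.\<close>
  define e' where "e' = (\<lambda>y. e y - (\<bar>C\<bar> + 1) * r y)"
  show ?thesis
  proof (rule that[of e'])
    show "dfun (n + m) (fat_disk n m) e'" unfolding e'_def by (rule dfun_diff[OF e dfun_cmult[OF r]])
    show "e' y = e y" if "y \<in> fat_sphere n m" for y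
      using that unorm_lt_one_iff[of n y]
      by (auto simp: e'_def r_def fat_sphere_def intro!: ell_nonpos)
    fix y assume y: "y \<in> fat_disk n m" "e' y \<ge> 0"
    show "y \<in> W"
    proof (rule ccontr)
      assume "y \<notin> W"
      have "(\<bar>C\<bar> + 1) * r y \<ge> 0" using r0 by simp
      then have "e y \<ge> 0" using y(2) by (simp add: e'_def)
      then have yK: "y \<in> K" using y \<open>y \<notin> W\<close> by (simp add: K_def)
      then have "\<bar>e y / r y\<bar> \<le> C" using C by simp
      then have "e y / r y < \<bar>C\<bar> + 1" by linarith
      then have "e y < (\<bar>C\<bar> + 1) * r y" using rpos[OF yK] by (simp add: divide_less_eq)
      then show False using y(2) by (simp add: e'_def)
    qed
  qed
qed

lemma cell_bump:
  assumes W: "Dopen (fat_disk n m) (esub (n + m) (fat_disk n m)) W"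
    and p: "p \<in> W" "p \<notin> fat_sphere n m"
  obtains e where "dfun (n + m) (fat_disk n m) e" "\<And>y. y \<in> fat_sphere n m \<Longrightarrow> e y = -1"
    "\<And>y. y \<in> fat_disk n m \<Longrightarrow> e y \<ge> 0 \<Longrightarrow> y \<in> W" "e p > 0"
proof -
  have pD: "p \<in> fat_disk n m" using p W by (auto simp: Dopen_def)
  then have pR: "p \<in> Rn (n + m)" using fat_disk_subset by blast
  obtain d1 where d1: "d1 > 0" "\<And>y. y \<in> fat_disk n m \<Longrightarrow> near (n + m) p d1 y \<Longrightarrow> y \<in> W"
    using Dopen_imp_openin[OF W] p(1) unfolding openin_Rn_iff[OF fat_disk_subset] by blast
  have dV: "domain (n + m) {x\<in>Rn (n + m). 0 < 1 - unorm n x}"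
    by (intro domain_pos continuous_intros continuous_unorm)
  have "p \<in> {x\<in>Rn (n + m). 0 < 1 - unorm n x}" using p(2) pR by (simp add: fat_sphere_def)
  from domain_near[OF dV this] obtain d2 where d2: "d2 > 0"
    "\<And>y. y \<in> Rn (n + m) \<Longrightarrow> near (n + m) p d2 y \<Longrightarrow> unorm n y < 1" by auto
  define d where "d = min d1 d2"
  have d: "d > 0" using d1 d2 by (simp add: d_def)
  \<comment> \<open>Supported in the ball of radius \<open>d\<close> about \<open>p\<close>, which
    lies in the box \<open>near (n + m) p d\<close>; that box misses the fat sphere by the choice of
    \<open>d2\<close>, and its points in the disk lie in \<open>W\<close> by the choice of
    \<open>d1\<close>.\<close>
  define r where "r = (\<lambda>y::vec. ell (d\<^sup>2 - (\<Sum>i<n+m. (y i - p i)\<^sup>2)))"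
  have rnear: "near (n + m) p d y" if "r y \<noteq> 0" for y
    unfolding near_def
  proof (intro allI impI)
    fix i assume i: "i < n + m"
    have "(\<Sum>i<n+m. (y i - p i)\<^sup>2) < d\<^sup>2"
    proof (rule ccontr)
      assume "\<not> ?thesis"
      then have "r y = 0" unfolding r_def by (intro ell_nonpos) simp
      then show False using that by simp
    qed
    moreover have "(y i - p i)\<^sup>2 \<le> (\<Sum>i<n+m. (y i - p i)\<^sup>2)" using i by (intro member_le_sum) auto
    ultimately have "\<bar>y i - p i\<bar>\<^sup>2 < d\<^sup>2" by simp
    then show "\<bar>y i - p i\<bar> < d" using d by (intro power2_less_imp_less[of _ d]) auto
  qed
  have rp: "r p > 0" using d by (simp add: r_def ell_pos_iff)
  \<comment> \<open>Normalised so that \<open>e p = 1\<close>, while \<open>e = -1\<close> wherever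
    the bump vanishes.\<close>
  define e where "e = (\<lambda>y. (2 / r p) * r y - 1)"
  show ?thesis
  proof (rule that[of e])
    show "dfun (n + m) (fat_disk n m) e" unfolding e_def r_def
      by (rule dfun_diff[OF dfun_cmult[OF dfun_sqdist[OF fat_disk_subset]] dfun_const[OF fat_disk_subset]])
    show "e y = -1" if "y \<in> fat_sphere n m" for y
    proof -
      have "r y = 0"
        using rnear[of y] d2(2)[of y] near_mono[of "n + m" p d y d2] that by (fastforce simp: fat_sphere_def d_def)
      then show ?thesis by (simp add: e_def)
    qed
    show "y \<in> W" if "y \<in> fat_disk n m" "e y \<ge> 0" for y
    proof -
      have "r y \<noteq> 0" using that(2) by (auto simp: e_def)
      then show ?thesis using rnear[of y] d1(2)[OF that(1)] near_mono[of "n + m" p d y d1] by (simp add: d_def)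
    qed
    show "e p > 0" using rp by (simp add: e_def)
  qed
qed

text \<open>A plot of the generated diffeology is locally constant or locally a generating plot, and
  smoothness is local.\<close>

lemma smooth_real_generated:
  assumes G: "\<And>k U P. (k, U, P) \<in> G \<Longrightarrow> domain k U \<Longrightarrow> smooth_fun k U (\<lambda>x. f (P x))"
  shows "smooth_real S (generated S G) f"
  unfolding smooth_real_def
proof (intro allI impI)
  fix k U P assume P: "(k, U, P) \<in> generated S G"
  then have U: "domain k U" by (simp add: generated_def)
  have "smooth_fun k U (\<lambda>x. f (P x))"
  proof (rule smooth_local[OF U])
    fix x assume x: "x \<in> U"
    obtain V where V: "x \<in> V" "domain k V"
      "(\<exists>c. \<forall>y\<in>V. P y = c) \<or> (\<exists>Q. (k, V, Q) \<in> G \<and> (\<forall>y\<in>V. P y = Q y))"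
      using P x unfolding generated_def by blast
    have "smooth_fun k V (\<lambda>x. f (P x))"
      using V(3)
    proof
      assume "\<exists>c. \<forall>y\<in>V. P y = c"
      then obtain c where "\<And>y. y \<in> V \<Longrightarrow> P y = c" by blast
      then show ?thesis by (intro smooth_cong[OF V(2) _ smooth_const[OF V(2), of "f c"]]) simp
    next
      assume "\<exists>Q. (k, V, Q) \<in> G \<and> (\<forall>y\<in>V. P y = Q y)"
      then obtain Q where Q: "(k, V, Q) \<in> G" "\<And>y. y \<in> V \<Longrightarrow> P y = Q y" by blast
      show ?thesis by (rule smooth_cong[OF V(2) _ G[OF Q(1) V(2)]]) (simp add: Q(2))
    qed
    then show "\<exists>V. x \<in> V \<and> domain k V \<and> smooth_fun k V (\<lambda>x. f (P x))" using V by blast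
  qed
  then show "smooth_fun k U (f \<circ> P)" by (simp add: o_def)
qed

lemma smooth_realD: "smooth_real S D f \<Longrightarrow> (k, U, P) \<in> D \<Longrightarrow> smooth_fun k U (\<lambda>x. f (P x))"
  by (simp add: smooth_real_def o_def)

lemma coprod_plot:
  assumes "j \<in> J" "(k, U, Q) \<in> esub (d j) (A j)"
  shows "(k, U, \<lambda>x. (j, Q x)) \<in> coprod J d A"
proof -
  let ?G = "{(n, U, \<lambda>y. (j, Q y)) | n U Q j. j \<in> J \<and> (n, U, Q) \<in> esub (d j) (A j)}"
  note Q = esubD[OF assms(2)]
  have G: "(k, U, \<lambda>x. (j, Q x)) \<in> ?G" using assms by blast
  have "(\<lambda>x. (j, Q x)) ` U \<subseteq> Sigma J A" using Q(3) assms(1) by auto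
  then show ?thesis
    unfolding coprod_def generated_def mem_Collect_eq case_prod_conv
    by (intro conjI ballI exI[of _ U] disjI2 exI[of _ "\<lambda>x. (j, Q x)"] Q(1) G[unfolded mem_Collect_eq] order_refl refl)
qed

text \<open>One attaching step: \<open>Y\<close> is the \<open>n\<close>-skeleton, \<open>Z\<close> the previous one.\<close>

locale attach =
  fixes D :: "'a plots" and Y Z :: "'a set" and n :: nat and J :: "'j set" and m :: "'j \<Rightarrow> nat"
    and h Phi :: "'j \<times> vec \<Rightarrow> 'a"
  assumes h: "dsmooth (Sigma J (\<lambda>j. fat_sphere n (m j)))
      (subdiff (coprod J (\<lambda>j. n + m j) (\<lambda>j. fat_disk n (m j))) (Sigma J (\<lambda>j. fat_sphere n (m j))))
      Z (subdiff D Z) h"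
    and Phi: "dsmooth (Sigma J (\<lambda>j. fat_disk n (m j)))
      (coprod J (\<lambda>j. n + m j) (\<lambda>j. fat_disk n (m j))) Y (subdiff D Y) Phi"
    and push: "is_pushout Y (subdiff D Y) Z (subdiff D Z) (Sigma J (\<lambda>j. fat_disk n (m j)))
      (coprod J (\<lambda>j. n + m j) (\<lambda>j. fat_disk n (m j))) (Sigma J (\<lambda>j. fat_sphere n (m j))) h Phi"
begin

lemma h_in: "j \<in> J \<Longrightarrow> y \<in> fat_sphere n (m j) \<Longrightarrow> h (j, y) \<in> Z"
  using h unfolding dsmooth_def by blast

lemma Phi_h: "j \<in> J \<Longrightarrow> y \<in> fat_sphere n (m j) \<Longrightarrow> Phi (j, y) = h (j, y)"
  using push unfolding is_pushout_def by blast

lemma Y_eq: "Y = Z \<union> Phi ` Sigma J (\<lambda>j. fat_disk n (m j))"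
  using push unfolding is_pushout_def by blast

lemma diffeology_Y: "subdiff D Y = generated Y (subdiff D Z \<union> {(k, U, Phi \<circ> Q) | k U Q.
    (k, U, Q) \<in> coprod J (\<lambda>j. n + m j) (\<lambda>j. fat_disk n (m j))})"
  using push unfolding is_pushout_def by (elim conjE)

text \<open>The universal property of the pushout for functions into the reals: \<open>ef\<close> is
  the compatibility along \<open>h\<close>, and smoothness is checked on the generating
  plots.\<close>

lemma glue:
  assumes f: "smooth_real Z (subdiff D Z) f"
    and e: "\<And>j. j \<in> J \<Longrightarrow> dfun (n + m j) (fat_disk n (m j)) (e j)"
    and ef: "\<And>j y. j \<in> J \<Longrightarrow> y \<in> fat_sphere n (m j) \<Longrightarrow> e j y = f (h (j, y))"
  obtains f' where "smooth_real Y (subdiff D Y) f'" "\<And>x. x \<in> Z \<Longrightarrow> f' x = f x"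
    "\<And>j y. j \<in> J \<Longrightarrow> y \<in> fat_disk n (m j) \<Longrightarrow> f' (Phi (j, y)) = e j y"
proof -
  let ?B = "Sigma J (\<lambda>j. fat_disk n (m j))" and ?A = "Sigma J (\<lambda>j. fat_sphere n (m j))"
  \<comment> \<open>A point off \<open>Z\<close> has exactly one preimage in a disk minus its
    sphere, since \<open>Phi\<close> is injective there.\<close>
  define f' where "f' x = (if x \<in> Z then f x else case inv_into (?B - ?A) Phi x of (j, y) \<Rightarrow> e j y)" for x
  have ZY: "f' x = f x" if "x \<in> Z" for x using that by (simp add: f'_def)
  have cell: "f' (Phi (j, y)) = e j y" if j: "j \<in> J" "y \<in> fat_disk n (m j)" for j y
  proof (cases "y \<in> fat_sphere n (m j)")
    case True
    then have "h (j, y) \<in> Z" "Phi (j, y) = h (j, y)"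
      using h_in Phi_h j by auto
    then show ?thesis using ef[OF j(1) True] by (simp add: ZY)
  next
    case False
    then have b: "(j, y) \<in> ?B - ?A" using j by auto
    then have "Phi (j, y) \<notin> Z" using push unfolding is_pushout_def by blast
    moreover have "inv_into (?B - ?A) Phi (Phi (j, y)) = (j, y)"
      using push b by (intro inv_into_f_f) (auto simp: is_pushout_def)
    ultimately show ?thesis by (simp add: f'_def)
  qed
  have cop: "smooth_real ?B (coprod J (\<lambda>j. n + m j) (\<lambda>j. fat_disk n (m j))) (\<lambda>b. f' (Phi b))"
    unfolding coprod_def
  proof (rule smooth_real_generated)
    fix k U P
    assume "(k, U, P) \<in> {(na, U, \<lambda>y. (j, Q y)) | na U Q j. j \<in> J \<and> (na, U, Q) \<in> esub (n + m j) (fat_disk n (m j))}"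
      and U: "domain k U"
    then obtain Q j where Q: "P = (\<lambda>y. (j, Q y))" "j \<in> J" "(k, U, Q) \<in> esub (n + m j) (fat_disk n (m j))" by auto
    show "smooth_fun k U (\<lambda>x. f' (Phi (P x)))"
      by (rule smooth_cong[OF U _ dfunD[OF e[OF Q(2)] Q(3)]])
        (use Q esubD(3)[OF Q(3)] in \<open>auto simp: cell image_subset_iff\<close>)
  qed
  have "smooth_real Y (generated Y (subdiff D Z \<union> {(k, U, Phi \<circ> Q) | k U Q.
      (k, U, Q) \<in> coprod J (\<lambda>j. n + m j) (\<lambda>j. fat_disk n (m j))})) f'"
  proof (rule smooth_real_generated)
    fix k U P
    assume U: "domain k U" and "(k, U, P) \<in> subdiff D Z \<union> {(k, U, Phi \<circ> Q) | k U Q.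
      (k, U, Q) \<in> coprod J (\<lambda>j. n + m j) (\<lambda>j. fat_disk n (m j))}"
    then consider "(k, U, P) \<in> subdiff D Z"
      | Q where "P = Phi \<circ> Q" "(k, U, Q) \<in> coprod J (\<lambda>j. n + m j) (\<lambda>j. fat_disk n (m j))" by auto
    then show "smooth_fun k U (\<lambda>x. f' (P x))"
    proof cases
      case 1
      show ?thesis
        by (rule smooth_cong[OF U _ smooth_realD[OF f 1]]) (use 1 in \<open>auto simp: subdiff_def ZY\<close>)
    next
      case 2
      from smooth_realD[OF cop 2(2)] show ?thesis using 2(1) by simp
    qed
  qed
  then have "smooth_real Y (subdiff D Y) f'" by (simp only: diffeology_Y)
  then show ?thesis using that[of f'] ZY cell by simp
qed

lemma cell_Dopen:
  assumes W: "Dopen S D W" and j: "j \<in> J"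
  shows "Dopen (fat_disk n (m j)) (esub (n + m j) (fat_disk n (m j))) {y\<in>fat_disk n (m j). Phi (j, y) \<in> W}"
  unfolding Dopen_def
proof (intro conjI allI impI)
  fix k U Q assume Q: "(k, U, Q) \<in> esub (n + m j) (fat_disk n (m j))"
  have "(k, U, \<lambda>x. (j, Q x)) \<in> coprod J (\<lambda>j. n + m j) (\<lambda>j. fat_disk n (m j))"
    by (rule coprod_plot[OF j]) (rule Q)
  then have "(k, U, Phi \<circ> (\<lambda>x. (j, Q x))) \<in> subdiff D Y"
    using Phi unfolding dsmooth_def by blast
  then have "(k, U, Phi \<circ> (\<lambda>x. (j, Q x))) \<in> D" by (simp add: subdiff_def)
  then have "openin (top_of_set (Rn k)) {x\<in>U. (Phi \<circ> (\<lambda>x. (j, Q x))) x \<in> W}"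
    using W unfolding Dopen_def by blast
  moreover have "{x\<in>U. (Phi \<circ> (\<lambda>x. (j, Q x))) x \<in> W} = {x\<in>U. Q x \<in> {y\<in>fat_disk n (m j). Phi (j, y) \<in> W}}"
    using esubD(3)[OF Q] by auto
  ultimately show "openin (top_of_set (Rn k)) {x\<in>U. Q x \<in> {y\<in>fat_disk n (m j). Phi (j, y) \<in> W}}"
    by simp
qed auto

lemma in_Y_cases:
  assumes "x \<in> Y" "x \<notin> Z"
  obtains j y where "j \<in> J" "y \<in> fat_disk n (m j)" "y \<notin> fat_sphere n (m j)" "x = Phi (j, y)"
proof -
  obtain j y where "j \<in> J" "y \<in> fat_disk n (m j)" "x = Phi (j, y)"
    using assms Y_eq by blast
  moreover from this have "y \<notin> fat_sphere n (m j)"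
    using assms(2) h_in[of j y] Phi_h[of j y] by auto
  ultimately show ?thesis using that by blast
qed

text \<open>On each cell the pulled-back function is extended and then pushed down. The cells are
  treated independently, one function being chosen for each, and \<open>glue\<close> assembles the
  choices.\<close>

lemma attach_step:
  assumes W: "Dopen S D W" and f: "smooth_real Z (subdiff D Z) f" "\<And>x. x \<in> Z \<Longrightarrow> f x \<ge> 0 \<Longrightarrow> x \<in> W"
  obtains f' where "smooth_real Y (subdiff D Y) f'" "\<And>x. x \<in> Z \<Longrightarrow> f' x = f x"
    "\<And>x. x \<in> Y \<Longrightarrow> f' x \<ge> 0 \<Longrightarrow> x \<in> W"
proof -
  let ?C = "coprod J (\<lambda>j. n + m j) (\<lambda>j. fat_disk n (m j))" and ?A = "Sigma J (\<lambda>j. fat_sphere n (m j))"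
  let ?P = "\<lambda>j e. dfun (n + m j) (fat_disk n (m j)) e \<and> (\<forall>y\<in>fat_sphere n (m j). e y = f (h (j, y))) \<and>
    (\<forall>y\<in>fat_disk n (m j). e y \<ge> 0 \<longrightarrow> Phi (j, y) \<in> W)"
  have ex: "\<exists>e. ?P j e" if j: "j \<in> J" for j
  proof -
    have hZ: "h (j, y) \<in> Z" "Phi (j, y) = h (j, y)" if "y \<in> fat_sphere n (m j)" for y
      using h_in Phi_h j that by auto
    have "dfun (n + m j) (fat_sphere n (m j)) (\<lambda>y. f (h (j, y)))"
      unfolding dfun_def
    proof (intro allI impI)
      fix k U Q assume Q: "(k, U, Q) \<in> esub (n + m j) (fat_sphere n (m j))"
      have "(k, U, Q) \<in> esub (n + m j) (fat_disk n (m j))"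
        using Q fat_sphere_subset unfolding esub_def by blast
      from coprod_plot[where A = "\<lambda>j. fat_disk n (m j)" and d = "\<lambda>j. n + m j", OF j this]
      have "(k, U, \<lambda>x. (j, Q x)) \<in> subdiff ?C ?A"
        using esubD(3)[OF Q] j by (auto simp: subdiff_def)
      then have "(k, U, h \<circ> (\<lambda>x. (j, Q x))) \<in> subdiff D Z"
        using h unfolding dsmooth_def by blast
      from smooth_realD[OF f(1) this] show "smooth_fun k U (\<lambda>x. f (h (j, Q x)))" by simp
    qed
    then interpret sphere_fun n "m j" "\<lambda>y. f (h (j, y))" by unfold_locales
    obtain e0 where e0: "dfun (n + m j) (fat_disk n (m j)) e0"
      "\<And>y. y \<in> fat_sphere n (m j) \<Longrightarrow> e0 y = f (h (j, y))" using extension by blast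
    have "y \<in> {y\<in>fat_disk n (m j). Phi (j, y) \<in> W}" if y: "y \<in> fat_sphere n (m j)" "e0 y \<ge> 0" for y
      using f(2)[of "h (j, y)"] hZ[OF y(1)] e0(2)[OF y(1)] y fat_sphere_subset by auto
    from push_down[OF e0(1) cell_Dopen[OF W j] this] obtain e where
      "dfun (n + m j) (fat_disk n (m j)) e" "\<And>y. y \<in> fat_sphere n (m j) \<Longrightarrow> e y = e0 y"
      "\<And>y. y \<in> fat_disk n (m j) \<Longrightarrow> e y \<ge> 0 \<Longrightarrow> y \<in> {y\<in>fat_disk n (m j). Phi (j, y) \<in> W}" by blast
    then show ?thesis using e0(2) by (intro exI[of _ e]) auto
  qed
  define e where "e j = (SOME e. ?P j e)" for j
  have e: "?P j (e j)" if "j \<in> J" for j unfolding e_def by (rule someI_ex[OF ex[OF that]])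
  obtain f' where f': "smooth_real Y (subdiff D Y) f'" "\<And>x. x \<in> Z \<Longrightarrow> f' x = f x"
    "\<And>j y. j \<in> J \<Longrightarrow> y \<in> fat_disk n (m j) \<Longrightarrow> f' (Phi (j, y)) = e j y"
    by (rule glue[OF f(1), of e]) (use e in blast)+
  show ?thesis
  proof (rule that[OF f'(1,2)])
    fix x assume x: "x \<in> Y" "f' x \<ge> 0"
    show "x \<in> W"
    proof (cases "x \<in> Z")
      case True
      then show ?thesis using f(2) f'(2) x by simp
    next
      case False
      from in_Y_cases[OF x(1) this] obtain j y where
        j: "j \<in> J" "y \<in> fat_disk n (m j)" "x = Phi (j, y)" by blast
      then show ?thesis using e[OF j(1)] f'(3)[OF j(1,2)] x(2) by auto
    qed
  qed
qed

text \<open>The function is \<open>-1\<close> on \<open>Z\<close> and on all cells but the one whose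
  interior contains \<open>x\<close>, so the points with nonnegative value lie in that cell, where
  \<open>cell_bump\<close> controls them.\<close>

lemma attach_start:
  assumes W: "Dopen S D W" and D: "\<And>k U P. (k, U, P) \<in> D \<Longrightarrow> domain k U"
    and x: "x \<in> Y" "x \<notin> Z" "x \<in> W"
  obtains f where "smooth_real Y (subdiff D Y) f" "\<And>x. x \<in> Y \<Longrightarrow> f x \<ge> 0 \<Longrightarrow> x \<in> W" "f x > 0"
proof -
  obtain j p where j: "j \<in> J" "p \<in> fat_disk n (m j)" "p \<notin> fat_sphere n (m j)" "x = Phi (j, p)"
    using in_Y_cases[OF x(1,2)] by blast
  have pW: "p \<in> {y\<in>fat_disk n (m j). Phi (j, y) \<in> W}" using j x by simp
  obtain b where b: "dfun (n + m j) (fat_disk n (m j)) b" "\<And>y. y \<in> fat_sphere n (m j) \<Longrightarrow> b y = -1"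
    "\<And>y. y \<in> fat_disk n (m j) \<Longrightarrow> b y \<ge> 0 \<Longrightarrow> y \<in> {y\<in>fat_disk n (m j). Phi (j, y) \<in> W}" "b p > 0"
    using cell_bump[OF cell_Dopen[OF W j(1)] pW j(3)] by blast
  define e where "e i = (if i = j then b else (\<lambda>_. -1))" for i
  have f: "smooth_real Z (subdiff D Z) (\<lambda>_. -1)"
    using D smooth_const by (auto simp: smooth_real_def subdiff_def o_def)
  obtain f' where f': "smooth_real Y (subdiff D Y) f'" "\<And>x. x \<in> Z \<Longrightarrow> f' x = -1"
    "\<And>i y. i \<in> J \<Longrightarrow> y \<in> fat_disk n (m i) \<Longrightarrow> f' (Phi (i, y)) = e i y"
  proof (rule glue[OF f, of e])
    show "dfun (n + m i) (fat_disk n (m i)) (e i)" for i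
      using b(1) dfun_const[OF fat_disk_subset] by (cases "i = j") (simp_all add: e_def)
    show "e i y = -1" if "y \<in> fat_sphere n (m i)" for i y
      using b(2) that by (cases "i = j") (simp_all add: e_def)
  qed (rule that)
  show ?thesis
  proof (rule that[OF f'(1)])
    show "f' x > 0" using f'(3)[OF j(1,2)] b(4) j(4) by (simp add: e_def)
    fix z assume z: "z \<in> Y" "f' z \<ge> 0"
    have "z \<notin> Z" using f'(2) z(2) by fastforce
    from in_Y_cases[OF z(1) this] obtain i y where
      i: "i \<in> J" "y \<in> fat_disk n (m i)" "z = Phi (i, y)" by blast
    then have ey: "e i y \<ge> 0" using f'(3) z(2) by simp
    then have "i = j" by (rule_tac ccontr) (simp add: e_def)
    then show "z \<in> W" using b(3)[of y] i ey by (simp add: e_def)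
  qed
qed

end

section \<open>Construction along the skeleta\<close>

lemma fat_CW_attach:
  assumes "fat_CW S D Sk J m h"
  obtains Phi where "attach D (Sk n) (prev_sk Sk n) n (J n) (m n) (h n) Phi"
proof -
  have h: "dsmooth (cells_sphere J m n)
            (subdiff (coprod (J n) (\<lambda>j. n + m n j) (\<lambda>j. fat_disk n (m n j))) (cells_sphere J m n))
            (prev_sk Sk n) (subdiff D (prev_sk Sk n)) (h n)"
    using assms unfolding fat_CW_def by blast
  obtain Phi where "dsmooth (cells_disk J m n) (coprod (J n) (\<lambda>j. n + m n j) (\<lambda>j. fat_disk n (m n j)))
                (Sk n) (subdiff D (Sk n)) Phi"
        "is_pushout (Sk n) (subdiff D (Sk n)) (prev_sk Sk n) (subdiff D (prev_sk Sk n))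
           (cells_disk J m n) (coprod (J n) (\<lambda>j. n + m n j) (\<lambda>j. fat_disk n (m n j)))
           (cells_sphere J m n) (h n) Phi"
    using assms unfolding fat_CW_def by blast
  then show ?thesis using h that unfolding attach_def cells_sphere_def cells_disk_def by blast
qed

theorem theorem6p3:
  fixes S :: "'a set" and D :: "'a plots" and Sk :: "nat \<Rightarrow> 'a set"
    and J :: "nat \<Rightarrow> 'j set" and m :: "nat \<Rightarrow> 'j \<Rightarrow> nat" and h :: "nat \<Rightarrow> 'j \<times> vec \<Rightarrow> 'a"
  assumes "fat_CW S D Sk J m h"
  shows "(\<forall>f. smooth_real S D f \<longrightarrow> Dopen S D {x \<in> S. f x \<in> {0<..<1}}) \<and>
         (\<forall>W x. Dopen S D W \<and> x \<in> W \<longrightarrow>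
            (\<exists>f. smooth_real S D f \<and> x \<in> {y \<in> S. f y \<in> {0<..<1}} \<and> {y \<in> S. f y \<in> {0<..<1}} \<subseteq> W))"
proof (intro conjI allI impI)
  have "diffeology S D" using assms unfolding fat_CW_def by (elim conjE)
  then have "\<forall>k U P. (k, U, P) \<in> D \<longrightarrow> domain k U \<and> P ` U \<subseteq> S"
    unfolding diffeology_def by (elim conjE)
  then have diff: "domain k U \<and> P ` U \<subseteq> S" if "(k, U, P) \<in> D" for k U P using that by blast
  {
    fix f assume f: "smooth_real S D f"
    show "Dopen S D {x \<in> S. f x \<in> {0<..<1}}"
      unfolding Dopen_def
    proof (intro conjI allI impI)
      fix k U P assume P: "(k, U, P) \<in> D"
      have "domain k {x\<in>U. f (P x) \<in> {0<..<1}}"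
        by (rule domain_Collect[OF _ smooth_imp_continuous[OF smooth_realD[OF f P]]]) (use diff[OF P] in auto)
      moreover have "{x\<in>U. f (P x) \<in> {0<..<1}} = {x\<in>U. P x \<in> {x \<in> S. f x \<in> {0<..<1}}}"
        using diff[OF P] by auto
      ultimately show "openin (top_of_set (Rn k)) {x\<in>U. P x \<in> {x \<in> S. f x \<in> {0<..<1}}}"
        by (simp add: domain_def)
    qed auto
  }
  fix W x assume "Dopen S D W \<and> x \<in> W"
  then have W: "Dopen S D W" and x: "x \<in> W" by auto
  have SU: "S = (\<Union>n. Sk n)"
    using assms unfolding fat_CW_def by (elim conjE)
  have DU: "D = generated S (\<Union>n. subdiff D (Sk n))"
    using assms unfolding fat_CW_def by (elim conjE)
  have mono1: "Sk i \<subseteq> Sk (Suc i)" for i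
  proof -
    have "prev_sk Sk (Suc i) \<subseteq> Sk (Suc i)" using assms unfolding fat_CW_def by blast
    then show ?thesis by (simp add: prev_sk_def)
  qed
  have mono: "Sk i \<subseteq> Sk j" if "i \<le> j" for i j using mono1 that by (rule lift_Suc_mono_le)
  \<comment> \<open>In the first skeleton containing \<open>x\<close>, this point lies in a disk
    minus its sphere, where a bump fits without touching the previous skeleton.\<close>
  define n0 where "n0 = (LEAST n. x \<in> Sk n)"
  have "x \<in> S" using W x by (auto simp: Dopen_def)
  then have xn: "x \<in> Sk n0" unfolding n0_def SU by (auto intro: LeastI)
  have xp: "x \<notin> prev_sk Sk n0"
  proof
    assume a: "x \<in> prev_sk Sk n0"
    then have "n0 \<noteq> 0" "x \<in> Sk (n0 - 1)" by (auto simp: prev_sk_def split: if_splits)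
    then show False using Least_le[of "\<lambda>n. x \<in> Sk n" "n0 - 1"] by (simp add: n0_def)
  qed
  let ?P = "\<lambda>i f. smooth_real (Sk (n0 + i)) (subdiff D (Sk (n0 + i))) f \<and>
    (\<forall>y\<in>Sk (n0 + i). f y \<ge> 0 \<longrightarrow> y \<in> W) \<and> f x > 0"
  have "\<exists>F. \<forall>i. ?P i (F i) \<and> (\<forall>y\<in>Sk (n0 + i). F (Suc i) y = F i y)"
  \<comment> \<open>Each function has to extend the one chosen before, so separate existence at
    every stage would not do.\<close>
  proof (rule dependent_nat_choice[of ?P "\<lambda>i f f'. \<forall>y\<in>Sk (n0 + i). f' y = f y"])
    obtain Phi where "attach D (Sk n0) (prev_sk Sk n0) n0 (J n0) (m n0) (h n0) Phi"
      using fat_CW_attach[OF assms] by blast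
    then interpret attach D "Sk n0" "prev_sk Sk n0" n0 "J n0" "m n0" "h n0" Phi .
    show "\<exists>f. ?P 0 f"
      by (rule attach_start[OF W _ xn xp x]) (use diff in auto)
  next
    fix f i assume f: "?P i f"
    let ?n = "Suc (n0 + i)"
    obtain Phi where "attach D (Sk ?n) (prev_sk Sk ?n) ?n (J ?n) (m ?n) (h ?n) Phi"
      using fat_CW_attach[OF assms] by blast
    then interpret attach D "Sk ?n" "Sk (n0 + i)" ?n "J ?n" "m ?n" "h ?n" Phi by (simp add: prev_sk_def)
    obtain f' where "smooth_real (Sk ?n) (subdiff D (Sk ?n)) f'" "\<And>y. y \<in> Sk (n0 + i) \<Longrightarrow> f' y = f y"
      "\<And>y. y \<in> Sk ?n \<Longrightarrow> f' y \<ge> 0 \<Longrightarrow> y \<in> W"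
      by (rule attach_step[OF W, of f]) (use f in auto)
    moreover have "x \<in> Sk (n0 + i)" using xn mono[of n0 "n0 + i"] by auto
    ultimately show "\<exists>f'. ?P (Suc i) f' \<and> (\<forall>y\<in>Sk (n0 + i). f' y = f y)"
      using f by (intro exI[of _ f']) auto
  qed
  then obtain F where F: "\<And>i. ?P i (F i)" "\<And>i y. y \<in> Sk (n0 + i) \<Longrightarrow> F (Suc i) y = F i y" by blast
  have Fle: "F j y = F i y" if "i \<le> j" "y \<in> Sk (n0 + i)" for i j y
    using that(1)
  proof (induction j rule: dec_induct)
    case (step j)
    have "y \<in> Sk (n0 + j)" using that(2) mono[of "n0 + i" "n0 + j"] step.hyps by auto
    then show ?case using F(2) step.IH by simp
  qed simp
  \<comment> \<open>The least stage merely fixes a choice: by \<open>Fle\<close> all later stages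
    give the same value.\<close>
  define H where "H y = F (LEAST i. y \<in> Sk (n0 + i)) y" for y
  have H: "H y = F i y" if "y \<in> Sk (n0 + i)" for i y
    unfolding H_def using that Fle[OF Least_le[of "\<lambda>i. y \<in> Sk (n0 + i)" i]] LeastI[of "\<lambda>i. y \<in> Sk (n0 + i)" i]
    by simp
  have "smooth_real S (generated S (\<Union>n. subdiff D (Sk n))) H"
  proof (rule smooth_real_generated)
    fix k U P assume U: "domain k U" and "(k, U, P) \<in> (\<Union>n. subdiff D (Sk n))"
    then obtain i where i: "(k, U, P) \<in> D" "P ` U \<subseteq> Sk i" by (auto simp: subdiff_def)
    then have Pi: "P ` U \<subseteq> Sk (n0 + i)" using mono[of i "n0 + i"] by auto
    then have "(k, U, P) \<in> subdiff D (Sk (n0 + i))" using i by (simp add: subdiff_def)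
    from smooth_realD[OF conjunct1[OF F(1)] this] have "smooth_fun k U (\<lambda>x. F i (P x))" .
    then show "smooth_fun k U (\<lambda>x. H (P x))"
      by (rule smooth_cong[OF U, rotated]) (use Pi H in auto)
  qed
  then have sH: "smooth_real S D H" using DU by simp
  have "smooth_real S D (\<lambda>y. ell (H y))"
    unfolding smooth_real_def o_def
    using smooth_ell smooth_realD[OF sH] diff by blast
  moreover have "ell (H x) \<in> {0<..<1}"
    using H[of x 0] xn F(1)[of 0] by (simp add: ell_pos_iff ell_less_one)
  moreover have "y \<in> W" if "y \<in> S" "ell (H y) \<in> {0<..<1}" for y
  proof -
    obtain i where "y \<in> Sk i" using \<open>y \<in> S\<close> unfolding SU by blast
    then have yi: "y \<in> Sk (n0 + i)" using mono[of i "n0 + i"] by auto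
    have "H y > 0" using that(2) by (simp add: ell_pos_iff)
    then show ?thesis using F(1)[of i] H[OF yi] yi by auto
  qed
  ultimately show "\<exists>f. smooth_real S D f \<and> x \<in> {y \<in> S. f y \<in> {0<..<1}} \<and> {y \<in> S. f y \<in> {0<..<1}} \<subseteq> W"
    using \<open>x \<in> S\<close> by (intro exI[of _ "\<lambda>y. ell (H y)"]) auto
qed

end
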